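(* Let $n\in\mathbb N$ and $\mathbf t=(t_1,\dots,t_n)$ with all $t_j>0$. Let $$\mathcal R_{cl,0}:=\sum_{V}\mathcal R_{cl,V},$$ the sum being over all Lagrangian subspaces $V$ of $(\mathbb C^n,\sigma_{\mathbf t})$, where $\mathcal R_{cl,V}=C^\ast\big((\lambda-2i\sigma_{\mathbf t}(\cdot,z))^{-1}: z\in V,\ \lambda\in\mathbb C\setminus i\mathbb R\big)$. Then $$\mathcal R(\mathbb C^n,\sigma_{\mathbf t})=\mathcal T^{\mathbf t}\big(\overline{\mathcal R_{cl,0}}\big).$$
   Context: Write $\langle z,w\rangle_{\mathbf t}=\sum_{j=1}^n z_j\overline{w_j}/t_j$ and $\sigma_{\mathbf t}(w,z)=\operatorname{Im}\langle w,z\rangle_{\mathbf t}$ on $\mathbb C^n$. Let $d\mu_{\mathbf t}(z)=\frac{1}{\pi^n t_1\cdots t_n}e^{-\sum_j|z_j|^2/t_j}\,dV(z)$ (with $dV$ here Lebesgue measure) and $F_{\mathbf t}^2=L^2(\mathbb C^n,\mu_{\mathbf t})\cap\mathrm{Hol}(\mathbb C^n)$ the Fock-Bargmann space, with orthogonal projection $P^{\mathbf t}:L^2(\mathbb C^n,\mu_{\mathbf t})\to F_{\mathbf t}^2$. For measurable $\varphi:\mathbb C^n\to\mathbb C$ the Toeplitz operator is $T^{\mathbf t}_\varphi g=P^{\mathbf t}(\varphi g)$ with domain $\{g\in F_{\mathbf t}^2:\varphi g\in L^2(\mathbb C^n,\mu_{\mathbf t})\}$. The operators $T^{\mathbf t}_{2\sigma_{\mathbf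 t}(\cdot,z)}$ are self-adjoint. The resolvent algebra $\mathcal R(\mathbb C^n,\sigma_{\mathbf t})\subset\mathcal L(F^2_{\mathbf t})$ is the $C^\ast$ algebra generated by all $(i\lambda-T^{\mathbf t}_{2\sigma_{\mathbf t}(\cdot,z)})^{-1}$ with $\lambda\in\mathbb R\setminus\{0\}$, $z\in\mathbb C^n$. A Lagrangian subspace of $\mathbb C^n$ is a real linear subspace $V$ of real dimension $n$ with $\sigma_{\mathbf t}(z,w)=0$ for all $z,w\in V$. Each $\mathcal R_{cl,V}$ is a $C^\ast$ subalgebra of $\mathrm{BUC}(\mathbb C^n)$ (bounded uniformly continuous functions, sup norm); the sum $\sum_V$ is the algebraic sum (all finite sums) and the bar is the sup norm closure. For $S\subset L^\infty(\mathbb C^n)$, $\mathcal T^{\mathbf t}(S)$ is the $C^\ast$ algebra generated by $\{T_f^{\mathbf t}:f\in S\}$. *)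

theory Defs
  imports "HOL-Analysis.Analysis"
begin

section \<open>Generated C*-algebras\<close>

text \<open>The operations of an ambient C*-algebra with carrier \<open>elems\<close>. Both bounded functions and
  bounded operators on a Fock space (a set of functions depending on a parameter) are treated as
  instances, so that ``C*-algebra generated by'' is a single notion. Generated algebras are not
  required to be unital.\<close>

record 'a cstar_ops =
  elems :: "'a set"
  add_op :: "'a \<Rightarrow> 'a \<Rightarrow> 'a"
  scale_op :: "complex \<Rightarrow> 'a \<Rightarrow> 'a"
  mult_op :: "'a \<Rightarrow> 'a \<Rightarrow> 'a"
  star_op :: "'a \<Rightarrow> 'a"
  norm_op :: "'a \<Rightarrow> real"

definition norm_closure :: "'a cstar_ops \<Rightarrow> 'a set \<Rightarrow> 'a set" where
  "norm_closure \<A> S = {a \<in> elems \<A>. \<exists>X :: nat \<Rightarrow> 'a. (\<forall>k. X k \<in> S) \<and>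
     (\<lambda>k. norm_op \<A> (add_op \<A> (X k) (scale_op \<A> (- 1) a))) \<longlonglongrightarrow> 0}"

definition cstar_subalgebra :: "'a cstar_ops \<Rightarrow> 'a set \<Rightarrow> bool" where
  "cstar_subalgebra \<A> B \<longleftrightarrow> B \<subseteq> elems \<A> \<and> B \<noteq> {} \<and>
     (\<forall>a\<in>B. \<forall>b\<in>B. add_op \<A> a b \<in> B) \<and>
     (\<forall>c. \<forall>a\<in>B. scale_op \<A> c a \<in> B) \<and>
     (\<forall>a\<in>B. \<forall>b\<in>B. mult_op \<A> a b \<in> B) \<and>
     (\<forall>a\<in>B. star_op \<A> a \<in> B) \<and>
     norm_closure \<A> B \<subseteq> B"

definition cstar_generated :: "'a cstar_ops \<Rightarrow> 'a set \<Rightarrow> 'a set" where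
  "cstar_generated \<A> S = cstar_subalgebra \<A> hull S"


section \<open>The symplectic form and the Fock-Bargmann space\<close>

definition inner_t :: "real ^ 'n \<Rightarrow> complex ^ 'n \<Rightarrow> complex ^ 'n \<Rightarrow> complex" where
  "inner_t t z w = (\<Sum>j\<in>UNIV. z $ j * cnj (w $ j) / complex_of_real (t $ j))"

definition sigma_t :: "real ^ 'n \<Rightarrow> complex ^ 'n \<Rightarrow> complex ^ 'n \<Rightarrow> real" where
  "sigma_t t w z = Im (inner_t t w z)"

definition mu_t :: "real ^ 'n \<Rightarrow> (complex ^ 'n) measure" where
  "mu_t t = density lborel (\<lambda>z. ennreal
     (exp (- (\<Sum>j\<in>UNIV. (cmod (z $ j))\<^sup>2 / t $ j)) / (pi ^ CARD('n) * (\<Prod>j\<in>UNIV. t $ j))))"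

text \<open>Square integrable functions themselves, not classes modulo null sets. No quotient is needed
  below: the Fock space consists of continuous functions, and its orthogonal projection depends
  only on the class of its argument.\<close>

definition L2_t :: "real ^ 'n \<Rightarrow> (complex ^ 'n \<Rightarrow> complex) set" where
  "L2_t t = {f \<in> borel_measurable (mu_t t). integrable (mu_t t) (\<lambda>z. (cmod (f z))\<^sup>2)}"

definition L2_inner :: "real ^ 'n \<Rightarrow> (complex ^ 'n \<Rightarrow> complex) \<Rightarrow> (complex ^ 'n \<Rightarrow> complex) \<Rightarrow> complex" where
  "L2_inner t f g = (LINT z|mu_t t. f z * cnj (g z))"

definition L2_norm :: "real ^ 'n \<Rightarrow> (complex ^ 'n \<Rightarrow> complex) \<Rightarrow> real" where
  "L2_norm t f = sqrt (LINT z|mu_t t. (cmod (f z))\<^sup>2)"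

text \<open>Holomorphic in several variables: everywhere differentiable with complex linear derivative.\<close>

definition entire :: "(complex ^ 'n \<Rightarrow> complex) \<Rightarrow> bool" where
  "entire f \<longleftrightarrow> (\<forall>z. \<exists>D. (f has_derivative D) (at z) \<and> (\<forall>c v. D (c *s v) = c * D v))"

definition Fock :: "real ^ 'n \<Rightarrow> (complex ^ 'n \<Rightarrow> complex) set" where
  "Fock t = {f \<in> L2_t t. entire f}"

definition Fock_proj :: "real ^ 'n \<Rightarrow> (complex ^ 'n \<Rightarrow> complex) \<Rightarrow> (complex ^ 'n \<Rightarrow> complex)" where
  "Fock_proj t f = (THE g. g \<in> Fock t \<and> (\<forall>h\<in>Fock t. L2_inner t (\<lambda>z. f z - g z) h = 0))"


section \<open>Bounded operators on the Fock space\<close>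

text \<open>Operators are functions on \<open>Fock t\<close>, made extensional (\<open>undefined\<close> off \<open>Fock t\<close>) so that
  equality of operators is equality in the logic.\<close>

type_synonym 'n fock_op = "(complex ^ 'n \<Rightarrow> complex) \<Rightarrow> (complex ^ 'n \<Rightarrow> complex)"

definition bounded_ops :: "real ^ 'n \<Rightarrow> 'n fock_op set" where
  "bounded_ops t = {A \<in> Fock t \<rightarrow>\<^sub>E Fock t.
     (\<forall>f\<in>Fock t. \<forall>g\<in>Fock t. A (\<lambda>z. f z + g z) = (\<lambda>z. A f z + A g z)) \<and>
     (\<forall>c. \<forall>f\<in>Fock t. A (\<lambda>z. c * f z) = (\<lambda>z. c * A f z)) \<and>
     (\<exists>C. \<forall>f\<in>Fock t. L2_norm t (A f) \<le> C * L2_norm t f)}"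

definition adjoint_op :: "real ^ 'n \<Rightarrow> 'n fock_op \<Rightarrow> 'n fock_op" where
  "adjoint_op t A = (THE B. B \<in> bounded_ops t \<and>
     (\<forall>f\<in>Fock t. \<forall>g\<in>Fock t. L2_inner t (A f) g = L2_inner t f (B g)))"

definition Fock_cstar :: "real ^ 'n \<Rightarrow> 'n fock_op cstar_ops" where
  "Fock_cstar t = \<lparr>
     elems = bounded_ops t,
     add_op = (\<lambda>A B. \<lambda>f\<in>Fock t. \<lambda>z. A f z + B f z),
     scale_op = (\<lambda>c A. \<lambda>f\<in>Fock t. \<lambda>z. c * A f z),
     mult_op = (\<lambda>A B. \<lambda>f\<in>Fock t. A (B f)),
     star_op = adjoint_op t,
     norm_op = (\<lambda>A. Sup {L2_norm t (A f) | f. f \<in> Fock t \<and> L2_norm t f \<le> 1}) \<rparr>"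


section \<open>Toeplitz operators, Toeplitz algebras and the resolvent algebra\<close>

definition toeplitz_dom :: "real ^ 'n \<Rightarrow> (complex ^ 'n \<Rightarrow> complex) \<Rightarrow> (complex ^ 'n \<Rightarrow> complex) set" where
  "toeplitz_dom t \<phi> = {g \<in> Fock t. (\<lambda>z. \<phi> z * g z) \<in> L2_t t}"

definition toeplitz :: "real ^ 'n \<Rightarrow> (complex ^ 'n \<Rightarrow> complex) \<Rightarrow> 'n fock_op" where
  "toeplitz t \<phi> = (\<lambda>g\<in>toeplitz_dom t \<phi>. Fock_proj t (\<lambda>z. \<phi> z * g z))"

text \<open>The resolvent \<open>(\<mu> - T)\<^sup>-\<^sup>1\<close> of the (in general unbounded) Toeplitz operator \<open>T\<close> with symbol
  \<open>\<phi>\<close>, as an operator from \<open>Fock t\<close> onto the domain of \<open>T\<close>.\<close>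

definition toeplitz_resolvent :: "real ^ 'n \<Rightarrow> complex \<Rightarrow> (complex ^ 'n \<Rightarrow> complex) \<Rightarrow> 'n fock_op" where
  "toeplitz_resolvent t \<mu> \<phi> =
     (\<lambda>h\<in>Fock t. the_inv_into (toeplitz_dom t \<phi>) (\<lambda>g z. \<mu> * g z - toeplitz t \<phi> g z) h)"

definition resolvent_algebra :: "real ^ 'n \<Rightarrow> 'n fock_op set" where
  "resolvent_algebra t = cstar_generated (Fock_cstar t)
     {toeplitz_resolvent t (\<i> * complex_of_real r) (\<lambda>w. complex_of_real (2 * sigma_t t w z)) | r z.
        r \<noteq> 0}"

definition toeplitz_algebra :: "real ^ 'n \<Rightarrow> (complex ^ 'n \<Rightarrow> complex) set \<Rightarrow> 'n fock_op set" where
  "toeplitz_algebra t S = cstar_generated (Fock_cstar t) (toeplitz t ` S)"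


section \<open>The classical resolvent algebras\<close>

definition BUC_cstar :: "(complex ^ 'n \<Rightarrow> complex) cstar_ops" where
  "BUC_cstar = \<lparr>
     elems = {f. uniformly_continuous_on UNIV f \<and> bounded (range f)},
     add_op = (\<lambda>f g z. f z + g z),
     scale_op = (\<lambda>c f z. c * f z),
     mult_op = (\<lambda>f g z. f z * g z),
     star_op = (\<lambda>f z. cnj (f z)),
     norm_op = (\<lambda>f. SUP z. cmod (f z)) \<rparr>"

text \<open>\<open>subspace\<close> and \<open>dim\<close> refer to the real vector space structure of \<open>complex ^ 'n\<close>.\<close>

definition lagrangian :: "real ^ 'n \<Rightarrow> (complex ^ 'n) set \<Rightarrow> bool" where
  "lagrangian t V \<longleftrightarrow> subspace V \<and> dim V = CARD('n) \<and> (\<forall>z\<in>V. \<forall>w\<in>V. sigma_t t z w = 0)"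

definition R_cl_V :: "real ^ 'n \<Rightarrow> (complex ^ 'n) set \<Rightarrow> (complex ^ 'n \<Rightarrow> complex) set" where
  "R_cl_V t V = cstar_generated BUC_cstar
     {(\<lambda>w. inverse (c - 2 * \<i> * complex_of_real (sigma_t t w z))) | c z. z \<in> V \<and> Re c \<noteq> 0}"

definition R_cl_0 :: "real ^ 'n \<Rightarrow> (complex ^ 'n \<Rightarrow> complex) set" where
  "R_cl_0 t = {(\<lambda>w. \<Sum>V\<in>\<V>. g V w) | \<V> g.
     finite \<V> \<and> (\<forall>V\<in>\<V>. lagrangian t V \<and> g V \<in> R_cl_V t V)}"

end

theory Submission
  imports Defs "HOL-Probability.Probability" "HOL-Complex_Analysis.Complex_Analysis" "HOL-Real_Asymp.Real_Asymp"
begin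

text \<open>
  Let \<open>W\<^sub>v\<close> be the Weyl operators on the Fock space. Both generators are absolutely convergent integrals of
  them: the resolvent of \<open>T\<close> with symbol \<open>2 \<sigma>(\<cdot>, z)\<close> is, up to a factor, \<open>\<integral> e\<^sup>-\<^sup>\<lambda>\<^sup>s W\<^sub>s\<^sub>z ds\<close> over \<open>s > 0\<close>, and a
  symbol \<open>\<integral> \<kappa>(x) exp (2 i \<sigma>(\<cdot>, v(x))) dx\<close> has the Toeplitz operator \<open>\<integral> \<kappa>(x) \<gamma>(v(x)) W\<^sub>v\<^sub>(\<^sub>x\<^sub>) dx\<close> with the Gaussian
  \<open>\<gamma>(v) = exp (- \<bar>v\<bar>\<^sup>2 / 2)\<close>. The operator norm of such an integral is at most the \<open>L\<^sup>1\<close> norm of its density, so it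
  remains to remove or insert the factor \<open>\<gamma>\<close> by dominated convergence. It is removed with the power series of
  \<open>1 / \<gamma>\<close>, the powers of \<open>s\<close> being obtained by differentiating in \<open>\<lambda>\<close>. It is inserted by approximating \<open>\<gamma>\<close> by
  products of \<open>cos (x / sqrt m) ^ m\<close>: a factor \<open>exp (2 i \<sigma>(v, u))\<close> only moves the resolvent parameters, and
  products of resolvents along an isotropic subspace are again integrals of Weyl operators.
\<close>

section \<open>Lebesgue measure on complex vectors\<close>

text \<open>The two directions are not symmetric. Removing \<open>\<gamma>\<close> is needed only
  along a single line, where the density \<open>exp (- l s) \<gamma>(s z)\<close> still carries the
  Gaussian: the partial sums for \<open>1 / \<gamma>\<close> stay below \<open>1 / \<gamma>\<close>,
  which the density cancels. Insertion cannot use a series in the same way: the partial sums for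
  \<open>\<gamma>\<close> alternate, and for \<open>z \<noteq> 0\<close> no bound uniform in their
  length is integrable against \<open>exp (- l s)\<close>. Hence an approximation bounded by 1 is
  wanted, and cosines provide one by nothing but imaginary shifts of the parameters. Nor can
  insertion be done generator by generator, since the Toeplitz operator of a product of symbols is
  not the product of the Toeplitz operators. Products of k resolvent functions are therefore treated
  directly as k-fold integrals. Isotropy of the subspace makes the Weyl operators along it compose
  additively, so that a product of resolvents has the product density; the Gaussian to be inserted,
  taken at a sum of k vectors, need not factor over the variables.\<close>

lemma prod_Basis_vec:
  fixes g :: "'a::euclidean_space ^ 'n \<Rightarrow> 'b::comm_monoid_mult"
  shows "(\<Prod>b\<in>Basis. g b) = (\<Prod>i\<in>UNIV. \<Prod>u\<in>Basis. g (axis i u))"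
proof -
  have inj: "inj_on (\<lambda>(i, u). axis i u) (UNIV \<times> (Basis :: 'a set))"
    by (auto simp: inj_on_def axis_eq_axis)
  have "(Basis :: ('a ^ 'n) set) = (\<lambda>(i, u). axis i u) ` (UNIV \<times> Basis)"
    by (auto simp: Basis_vec_def)
  then have "(\<Prod>b\<in>Basis. g b) = (\<Prod>(i, u)\<in>UNIV \<times> Basis. g (axis i u))"
    using prod.reindex[OF inj, of g] by (simp add: case_prod_unfold o_def)
  then show ?thesis
    by (simp add: prod.cartesian_product)
qed

lemma mem_box_vec: "z \<in> box l u \<longleftrightarrow> (\<forall>i. z $ i \<in> box (l $ i) (u $ i))"
  for z :: "'a::euclidean_space ^ 'n"
  by (auto simp: mem_box Basis_vec_def inner_axis)

lemma vec_lambda_measurable: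
  "(\<lambda>f. \<chi> i. f i) \<in> (\<Pi>\<^sub>M i\<in>(UNIV::'n::finite set). lborel :: 'a::euclidean_space measure) \<rightarrow>\<^sub>M borel"
proof -
  have "(\<lambda>f. \<chi> i. f i) \<in> (\<Pi>\<^sub>M i\<in>(UNIV::'n set). borel :: 'a measure) \<rightarrow>\<^sub>M borel"
    by (subst borel_measurable_euclidean_space)
      (auto simp: Basis_vec_def inner_axis intro!: borel_measurable_inner)
  then show ?thesis
    by (simp cong: measurable_cong_sets sets_PiM_cong)
qed

lemma prod_emeasure_box:
  fixes l u :: "'a::euclidean_space ^ 'n"
  assumes "\<And>b. b \<in> Basis \<Longrightarrow> l \<bullet> b \<le> u \<bullet> b"
  shows "(\<Prod>i\<in>UNIV. emeasure lborel (box (l $ i) (u $ i))) = ennreal (\<Prod>b\<in>Basis. (u - l) \<bullet> b)"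
proof -
  have le: "(l $ i) \<bullet> b \<le> (u $ i) \<bullet> b" if "b \<in> Basis" for i b
    using assms[of "axis i b"] that by (simp add: inner_axis Basis_vec_def) blast
  then have "(\<Prod>i\<in>UNIV. emeasure lborel (box (l $ i) (u $ i))) = (\<Prod>i\<in>UNIV. ennreal (\<Prod>b\<in>Basis. (u $ i - l $ i) \<bullet> b))"
    by (intro prod.cong) (auto simp: emeasure_lborel_box_eq)
  also have "\<dots> = ennreal (\<Prod>i\<in>UNIV. \<Prod>b\<in>Basis. (u $ i - l $ i) \<bullet> b)"
    using le by (intro prod_ennreal prod_nonneg) (auto simp: inner_diff_left)
  finally show ?thesis by (simp add: prod_Basis_vec inner_axis)
qed

text \<open>Lebesgue measure is determined by the volumes of boxes, and a box of vectors is the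
  product of its coordinate boxes. The identity makes product measure arguments available coordinate
  by coordinate.\<close>

lemma lborel_vec_eq_PiM:
  "(lborel :: ('a::euclidean_space ^ 'n) measure) =
     distr (\<Pi>\<^sub>M i\<in>UNIV. lborel) borel (\<lambda>f. \<chi> i. f i)"
proof (rule lborel_eqI)
  interpret product_sigma_finite "\<lambda>_::'n. lborel :: 'a measure" ..
  fix l u :: "'a ^ 'n"
  assume le: "\<And>b. b \<in> Basis \<Longrightarrow> l \<bullet> b \<le> u \<bullet> b"
  have "emeasure (distr (\<Pi>\<^sub>M i\<in>UNIV. lborel) borel (\<lambda>f. \<chi> i. f i)) (box l u) =
     emeasure (\<Pi>\<^sub>M i\<in>UNIV. lborel) (\<Pi>\<^sub>E i\<in>UNIV. box (l $ i) (u $ i))"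
    by (subst emeasure_distr[OF vec_lambda_measurable]) (auto simp: mem_box_vec space_PiM PiE_UNIV_domain Pi_iff intro!: arg_cong2[where f = emeasure])
  also have "\<dots> = (\<Prod>i\<in>UNIV. emeasure lborel (box (l $ i) (u $ i)))"
    by (subst emeasure_PiM) auto
  also have "\<dots> = ennreal (\<Prod>b\<in>Basis. (u - l) \<bullet> b)"
    by (rule prod_emeasure_box[OF le])
  finally show "emeasure (distr (\<Pi>\<^sub>M i\<in>UNIV. lborel) borel (\<lambda>f. \<chi> i. f i)) (box l u) =
     (\<Prod>b\<in>Basis. (u - l) \<bullet> b)" by simp
qed simp

lemma Complex_measurable [measurable (raw)]:
  assumes [measurable]: "f \<in> borel_measurable M" "g \<in> borel_measurable M"
  shows "(\<lambda>x. Complex (f x) (g x)) \<in> borel_measurable M"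
  unfolding Complex_eq by measurable

lemma lborel_complex_eq_distr:
  "lborel = distr (lborel :: (real \<times> real) measure) borel (\<lambda>(x, y). Complex x y)"
proof (rule lborel_eqI)
  fix l u :: complex
  assume le: "\<And>b. b \<in> Basis \<Longrightarrow> l \<bullet> b \<le> u \<bullet> b"
  have m: "(\<lambda>(x, y). Complex x y) \<in> borel \<rightarrow>\<^sub>M borel"
    unfolding case_prod_unfold borel_prod[symmetric] by measurable
  have "(\<lambda>(x, y). Complex x y) -` box l u = box (Re l, Im l) (Re u, Im u)"
    by (auto simp: mem_box Basis_complex_def Basis_prod_def)
  moreover have "Re l \<le> Re u" "Im l \<le> Im u"
    using le[of 1] le[of \<i>] by (auto simp: Basis_complex_def)
  ultimately show "emeasure (distr (lborel :: (real \<times> real) measure) borel (\<lambda>(x, y). Complex x y)) (box l u)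
      = (\<Prod>b\<in>Basis. (u - l) \<bullet> b)"
    using m by (subst emeasure_distr)
      (auto simp: emeasure_lborel_box_eq Basis_complex_def Basis_prod_def)
qed simp

lemma nn_integral_complex:
  fixes f :: "complex \<Rightarrow> ennreal"
  assumes [measurable]: "f \<in> borel_measurable borel"
  shows "(\<integral>\<^sup>+z. f z \<partial>lborel) = (\<integral>\<^sup>+x. \<integral>\<^sup>+y. f (Complex x y) \<partial>lborel \<partial>lborel)"
    and "(\<integral>\<^sup>+z. f z \<partial>lborel) = (\<integral>\<^sup>+y. \<integral>\<^sup>+x. f (Complex x y) \<partial>lborel \<partial>lborel)"
    and "(\<lambda>(x, y). f (Complex x y)) \<in> borel_measurable (lborel \<Otimes>\<^sub>M lborel)"
proof -
  have m: "(\<lambda>(x, y). Complex x y) \<in> borel \<rightarrow>\<^sub>M borel"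
    unfolding case_prod_unfold borel_prod[symmetric] by measurable
  have "(\<integral>\<^sup>+z. f z \<partial>lborel) = (\<integral>\<^sup>+(x, y). f (Complex x y) \<partial>(lborel \<Otimes>\<^sub>M lborel))"
    using m by (subst lborel_complex_eq_distr) (simp add: nn_integral_distr lborel_prod case_prod_unfold)
  moreover from m show mf: "(\<lambda>(x, y). f (Complex x y)) \<in> borel_measurable (lborel \<Otimes>\<^sub>M lborel)"
    using measurable_comp[OF m assms] by (simp add: lborel_prod o_def case_prod_unfold)
  ultimately show "(\<integral>\<^sup>+z. f z \<partial>lborel) = (\<integral>\<^sup>+x. \<integral>\<^sup>+y. f (Complex x y) \<partial>lborel \<partial>lborel)"
     "(\<integral>\<^sup>+z. f z \<partial>lborel) = (\<integral>\<^sup>+y. \<integral>\<^sup>+x. f (Complex x y) \<partial>lborel \<partial>lborel)"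
    using lborel_pair.nn_integral_snd[of "\<lambda>(x, y). f (Complex x y)"] lborel.nn_integral_fst[of "\<lambda>(x, y). f (Complex x y)" lborel]
    by simp_all
qed

lemma nn_integral_lborel_shift:
  fixes c :: "'a::euclidean_space"
  assumes "f \<in> borel_measurable borel"
  shows "(\<integral>\<^sup>+x. f (c + x) \<partial>lborel) = (\<integral>\<^sup>+x. f x \<partial>lborel)"
  by (subst (2) lborel_distr_plus[of c, symmetric], subst nn_integral_distr) (use assms in auto)

text \<open>A rotation is a composition of three shears, and a shear preserves the iterated integral
  because it merely translates the inner one.\<close>

lemma nn_integral_complex_rotate:
  fixes f :: "complex \<Rightarrow> ennreal"
  assumes f: "f \<in> borel_measurable borel" and c: "cmod c = 1"
  shows "(\<integral>\<^sup>+z. f (c * z) \<partial>lborel) = (\<integral>\<^sup>+z. f z \<partial>lborel)"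
proof -
  have shear1: "(\<integral>\<^sup>+z. g (Complex (Re z + p * Im z) (Im z)) \<partial>lborel) = (\<integral>\<^sup>+z. g z \<partial>lborel)"
    if [measurable]: "g \<in> borel_measurable borel" for g :: "complex \<Rightarrow> ennreal" and p
  proof -
    have m: "(\<lambda>x. g (Complex x y)) \<in> borel_measurable borel" for y by measurable
    have "(\<integral>\<^sup>+z. g (Complex (Re z + p * Im z) (Im z)) \<partial>lborel) =
        (\<integral>\<^sup>+y. \<integral>\<^sup>+x. g (Complex (p * y + x) y) \<partial>lborel \<partial>lborel)"
      by (subst nn_integral_complex(2)) (simp_all add: add.commute)
    also have "\<dots> = (\<integral>\<^sup>+z. g z \<partial>lborel)"
      by (simp only: nn_integral_lborel_shift[OF m] nn_integral_complex(2)[OF that])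
    finally show ?thesis .
  qed
  have shear2: "(\<integral>\<^sup>+z. g (Complex (Re z) (p * Re z + Im z)) \<partial>lborel) = (\<integral>\<^sup>+z. g z \<partial>lborel)"
    if [measurable]: "g \<in> borel_measurable borel" for g :: "complex \<Rightarrow> ennreal" and p
  proof -
    have m: "(\<lambda>y. g (Complex x y)) \<in> borel_measurable borel" for x by measurable
    have "(\<integral>\<^sup>+z. g (Complex (Re z) (p * Re z + Im z)) \<partial>lborel) =
        (\<integral>\<^sup>+x. \<integral>\<^sup>+y. g (Complex x (p * x + y)) \<partial>lborel \<partial>lborel)"
      by (subst nn_integral_complex(1)) simp_all
    also have "\<dots> = (\<integral>\<^sup>+z. g z \<partial>lborel)"
      by (simp only: nn_integral_lborel_shift[OF m] nn_integral_complex(1)[OF that])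
    finally show ?thesis .
  qed
  have rot: "(\<integral>\<^sup>+z. g (d * z) \<partial>lborel) = (\<integral>\<^sup>+z. g z \<partial>lborel)"
    if g: "g \<in> borel_measurable borel" and d: "cmod d = 1" "Im d \<noteq> 0" for g :: "complex \<Rightarrow> ennreal" and d
  proof -
    \<comment> \<open>For \<open>d = exp (\<i> * x)\<close> this is \<open>- tan (x / 2)\<close>,
      the horizontal slope in the factorisation of a rotation as horizontal, vertical, horizontal
      shear; the vertical slope is \<open>sin x\<close>.\<close>
    define p where "p = (Re d - 1) / Im d"
    define S where "S z = Complex (Re z + p * Im z) (Im z)" for z
    define T where "T z = Complex (Re z) (Im d * Re z + Im z)" for z
    have [measurable]: "S \<in> borel \<rightarrow>\<^sub>M borel" "T \<in> borel \<rightarrow>\<^sub>M borel"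
      unfolding S_def T_def by measurable
    have "(Re d)\<^sup>2 + (Im d)\<^sup>2 = 1"
      using d by (metis cmod_power2 power_one)
    then have "Im d * (p * (2 + Im d * p)) = Im d * (- Im d)"
      using d by (simp add: p_def power2_eq_square) algebra
    then have "p * (2 + Im d * p) = - Im d" and "1 + p * Im d = Re d"
      using d by (simp_all add: p_def)
    then have eq: "S (T (S z)) = d * z" for z
      unfolding S_def T_def by (simp add: complex_eq_iff) algebra
    have "(\<integral>\<^sup>+z. g (S (T (S z))) \<partial>lborel) = (\<integral>\<^sup>+z. g (S (T z)) \<partial>lborel)"
      using g shear1[of "\<lambda>z. g (S (T z))" p] by (simp add: S_def[symmetric])
    also have "\<dots> = (\<integral>\<^sup>+z. g (S z) \<partial>lborel)"
      using g shear2[of "\<lambda>z. g (S z)" "Im d"] by (simp add: T_def[symmetric])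
    also have "\<dots> = (\<integral>\<^sup>+z. g z \<partial>lborel)"
      using g shear1[of g p] by (simp add: S_def[symmetric])
    finally show ?thesis by (simp add: eq)
  qed
  show ?thesis
  proof (cases "Im c = 0")
    case False
    with rot[OF f c] show ?thesis by simp
  next
    case True
    \<comment> \<open>For real \<open>c\<close> the slope would be undefined; \<open>c\<close> is
      written as \<open>c * \<i>\<close> times \<open>- \<i>\<close>, two rotations to which
      \<open>rot\<close> applies.\<close>
    then have "Im (c * \<i>) \<noteq> 0"
      using c by (auto simp: cmod_def)
    moreover have "cmod (c * \<i>) = 1"
      using c by (simp add: norm_mult)
    moreover have "(\<lambda>z. f (c * \<i> * z)) \<in> borel_measurable borel"
      by (intro measurable_compose[OF _ f] borel_measurable_continuous_onI continuous_intros)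
    moreover from this have "(\<integral>\<^sup>+z. f (c * \<i> * (- \<i> * z)) \<partial>lborel) = (\<integral>\<^sup>+z. f (c * \<i> * z) \<partial>lborel)"
      by (intro rot) auto
    moreover have "c * \<i> * (- \<i> * z) = c * z" for z
      by (simp add: algebra_simps)
    ultimately show ?thesis
      using rot[OF f, of "c * \<i>"] by simp
  qed
qed

text \<open>The preimage of a box is in general no box, but it is still a product over the
  coordinates, so the planar case applies to each factor.\<close>

lemma lborel_cvec_rotate:
  assumes c: "cmod c = 1"
  shows "distr lborel borel (\<lambda>z. c *s z) = (lborel :: (complex ^ 'n) measure)"
proof (rule lborel_eqI[symmetric])
  interpret product_sigma_finite "\<lambda>_::'n. lborel :: complex measure" ..
  fix l u :: "complex ^ 'n"
  assume le: "\<And>b. b \<in> Basis \<Longrightarrow> l \<bullet> b \<le> u \<bullet> b"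
  have cont: "continuous_on UNIV (\<lambda>z :: complex ^ 'n. c *s z)"
    unfolding vector_scalar_mult_def by (intro continuous_intros)
  have mc: "(\<lambda>z. c *s z) \<in> (borel :: (complex ^ 'n) measure) \<rightarrow>\<^sub>M borel"
    by (rule borel_measurable_continuous_onI[OF cont])
  have mc1: "(*) c -` box a b \<in> sets borel" for a b
    by (rule measurable_sets_borel) (auto intro!: borel_measurable_continuous_onI continuous_intros)
  have set: "(\<lambda>z. c *s z) -` box l u \<in> sets borel"
    by (rule measurable_sets_borel[OF mc]) auto
  have one: "emeasure lborel ((*) c -` box a b) = emeasure lborel (box a b)" for a b
  proof -
    have "emeasure lborel ((*) c -` box a b) = (\<integral>\<^sup>+z. indicator (box a b) (c * z) \<partial>lborel)"
      using nn_integral_indicator[of "(*) c -` box a b" lborel] mc1[of a b] by (simp add: indicator_vimage o_def)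
    also have "\<dots> = emeasure lborel (box a b)"
      by (subst nn_integral_complex_rotate[OF _ c]) auto
    finally show ?thesis .
  qed
  have "emeasure (distr lborel borel (\<lambda>z. c *s z)) (box l u) = emeasure lborel ((\<lambda>z. c *s z) -` box l u)"
    using mc by (subst emeasure_distr) auto
  also have "\<dots> = emeasure (\<Pi>\<^sub>M i\<in>UNIV. lborel) (\<Pi>\<^sub>E i\<in>UNIV. (*) c -` box (l $ i) (u $ i))"
    using set by (subst lborel_vec_eq_PiM, subst emeasure_distr[OF vec_lambda_measurable])
     (auto simp: mem_box_vec space_PiM PiE_UNIV_domain Pi_iff intro!: arg_cong2[where f = emeasure])
  also have "\<dots> = (\<Prod>i\<in>UNIV. emeasure lborel (box (l $ i) (u $ i)))"
    using mc1 by (subst emeasure_PiM) (auto simp: one)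
  also have "\<dots> = ennreal (\<Prod>b\<in>Basis. (u - l) \<bullet> b)"
    by (rule prod_emeasure_box[OF le])
  finally show "emeasure (distr lborel borel (\<lambda>z. c *s z)) (box l u) = (\<Prod>b\<in>Basis. (u - l) \<bullet> b)"
    by simp
qed simp

text \<open>Read off from the total mass 1 of the normal density with variance
  \<open>a / 2\<close>.\<close>

lemma nn_integral_exp_square:
  assumes "0 < a"
  shows "(\<integral>\<^sup>+x. ennreal (exp (- (x\<^sup>2 / a))) \<partial>lborel) = ennreal (sqrt (pi * a))"
proof -
  interpret prob_space "density lborel (\<lambda>x. ennreal (normal_density 0 (sqrt (a / 2)) x))"
    by (rule prob_space_normal_density) (use assms in simp)
  have "1 = (\<integral>\<^sup>+x. ennreal (normal_density 0 (sqrt (a / 2)) x) \<partial>lborel)"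
    using emeasure_space_1 by (simp add: emeasure_density)
  also have "\<dots> = (\<integral>\<^sup>+x. ennreal (1 / sqrt (pi * a)) * ennreal (exp (- (x\<^sup>2 / a))) \<partial>lborel)"
    using assms by (intro nn_integral_cong) (simp add: normal_density_def ennreal_mult'[symmetric])
  also have "\<dots> = ennreal (1 / sqrt (pi * a)) * (\<integral>\<^sup>+x. ennreal (exp (- (x\<^sup>2 / a))) \<partial>lborel)"
    by (rule nn_integral_cmult) simp
  finally have "ennreal (sqrt (pi * a)) * 1 = ennreal (sqrt (pi * a)) * (ennreal (1 / sqrt (pi * a)) * (\<integral>\<^sup>+x. ennreal (exp (- (x\<^sup>2 / a))) \<partial>lborel))"
    by simp
  moreover have "ennreal (sqrt (pi * a)) * ennreal (1 / sqrt (pi * a)) = 1"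
    using assms by (subst ennreal_mult[symmetric]) auto
  ultimately show ?thesis
    by (simp add: mult.assoc[symmetric])
qed

text \<open>The squared norm belonging to \<open>inner_t\<close>, hence the exponent of the Gaussian
  weight and, halved, of \<open>\<gamma>\<close>.\<close>

definition quad :: "real ^ 'n \<Rightarrow> complex ^ 'n \<Rightarrow> real" where
  "quad t z = (\<Sum>j\<in>UNIV. (cmod (z $ j))\<^sup>2 / t $ j)"

text \<open>Kept outside the locale with \<open>t\<close> free: it is also applied to
  \<open>2 *\<^sub>R t\<close>, whose Gaussian is \<open>exp (- (quad t z / 2))\<close>.\<close>

lemma nn_integral_gauss:
  fixes t :: "real ^ 'n"
  assumes tpos: "\<And>j. 0 < t $ j"
  shows "(\<integral>\<^sup>+z. ennreal (exp (- quad t z)) \<partial>lborel) = ennreal (pi ^ CARD('n) * (\<Prod>j\<in>UNIV. t $ j))"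
proof -
  interpret product_sigma_finite "\<lambda>_::'n. lborel :: complex measure" ..
  have one: "(\<integral>\<^sup>+z. ennreal (exp (- ((cmod z)\<^sup>2 / a))) \<partial>lborel) = ennreal (pi * a)" if "0 < a" for a
  proof -
    have "(\<integral>\<^sup>+z. ennreal (exp (- ((cmod z)\<^sup>2 / a))) \<partial>lborel) =
      (\<integral>\<^sup>+x. \<integral>\<^sup>+y. ennreal (exp (- (x\<^sup>2 / a))) * ennreal (exp (- (y\<^sup>2 / a))) \<partial>lborel \<partial>lborel)"
      by (subst nn_integral_complex(1))
        (auto simp: cmod_power2 ennreal_mult'[symmetric] exp_add[symmetric] add_divide_distrib)
    also have "\<dots> = ennreal (sqrt (pi * a)) * ennreal (sqrt (pi * a))"
      using that by (simp add: nn_integral_cmult nn_integral_multc nn_integral_exp_square)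
    also have "\<dots> = ennreal (pi * a)"
      using that by (subst ennreal_mult[symmetric]) auto
    finally show ?thesis .
  qed
  have q: "(\<lambda>z. ennreal (exp (- quad t z))) \<in> borel_measurable borel"
    unfolding quad_def by (intro measurable_compose[OF borel_measurable_continuous_onI measurable_ennreal] continuous_intros) (use tpos in \<open>auto simp: less_imp_neq[symmetric]\<close>)
  have "(\<integral>\<^sup>+z. ennreal (exp (- quad t z)) \<partial>lborel) =
     (\<integral>\<^sup>+f. (\<Prod>i\<in>UNIV. ennreal (exp (- ((cmod (f i))\<^sup>2 / t $ i)))) \<partial>(\<Pi>\<^sub>M i\<in>(UNIV::'n set). lborel :: complex measure))"
    by (subst lborel_vec_eq_PiM, subst nn_integral_distr[OF vec_lambda_measurable]) (use q in
        \<open>simp_all add: quad_def exp_sum sum_negf[symmetric] prod_ennreal\<close>)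
  also have "\<dots> = (\<Prod>i\<in>(UNIV::'n set). \<integral>\<^sup>+z. ennreal (exp (- ((cmod z)\<^sup>2 / t $ i))) \<partial>lborel)"
    by (subst product_nn_integral_prod) auto
  also have "\<dots> = (\<Prod>i\<in>(UNIV::'n set). ennreal (pi * t $ i))"
    using tpos by (simp add: one)
  also have "\<dots> = ennreal (pi ^ CARD('n) * (\<Prod>j\<in>UNIV. t $ j))"
    by (subst prod_ennreal) (use tpos in \<open>auto simp: prod.distrib less_imp_le\<close>)
  finally show ?thesis .
qed

section \<open>Gaussian measure and the mean value property\<close>

lemma Cauchy_Schwarz_integral:
  fixes f g :: "'a \<Rightarrow> real"
  assumes [measurable]: "f \<in> borel_measurable M" "g \<in> borel_measurable M"
    and f: "integrable M (\<lambda>x. (f x)\<^sup>2)" and g: "integrable M (\<lambda>x. (g x)\<^sup>2)"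
  shows "integrable M (\<lambda>x. f x * g x)"
    and "(LINT x|M. \<bar>f x * g x\<bar>) \<le> sqrt (LINT x|M. (f x)\<^sup>2) * sqrt (LINT x|M. (g x)\<^sup>2)"
proof -
  show int: "integrable M (\<lambda>x. f x * g x)"
  proof (rule Bochner_Integration.integrable_bound)
    show "integrable M (\<lambda>x. (f x)\<^sup>2 + (g x)\<^sup>2)"
      using f g by simp
    have "\<bar>a * b\<bar> \<le> a\<^sup>2 + b\<^sup>2" for a b :: real
      using sum_squares_bound[of "\<bar>a\<bar>" "\<bar>b\<bar>"] mult_nonneg_nonneg[OF abs_ge_zero[of a] abs_ge_zero[of b]]
      unfolding abs_mult power2_abs by linarith
    then show "AE x in M. norm (f x * g x) \<le> norm ((f x)\<^sup>2 + (g x)\<^sup>2)"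
      by auto
  qed simp
  have "(\<integral>\<^sup>+x. ennreal \<bar>f x\<bar> * ennreal \<bar>g x\<bar> \<partial>M)\<^sup>2
      \<le> (\<integral>\<^sup>+x. (ennreal \<bar>f x\<bar>)\<^sup>2 \<partial>M) * (\<integral>\<^sup>+x. (ennreal \<bar>g x\<bar>)\<^sup>2 \<partial>M)"
    by (rule Cauchy_Schwarz_nn_integral) auto
  moreover have "(\<integral>\<^sup>+x. ennreal \<bar>f x\<bar> * ennreal \<bar>g x\<bar> \<partial>M) = ennreal (LINT x|M. \<bar>f x * g x\<bar>)"
    using integrable_abs[OF int] by (subst nn_integral_eq_integral[symmetric]) (auto simp: ennreal_mult'[symmetric] abs_mult)
  moreover have "(\<integral>\<^sup>+x. (ennreal \<bar>f x\<bar>)\<^sup>2 \<partial>M) = ennreal (LINT x|M. (f x)\<^sup>2)"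
    using f by (subst nn_integral_eq_integral[symmetric]) (auto simp: ennreal_power)
  moreover have "(\<integral>\<^sup>+x. (ennreal \<bar>g x\<bar>)\<^sup>2 \<partial>M) = ennreal (LINT x|M. (g x)\<^sup>2)"
    using g by (subst nn_integral_eq_integral[symmetric]) (auto simp: ennreal_power)
  ultimately have "ennreal ((LINT x|M. \<bar>f x * g x\<bar>)\<^sup>2) \<le> ennreal ((LINT x|M. (f x)\<^sup>2) * (LINT x|M. (g x)\<^sup>2))"
    by (simp add: ennreal_power ennreal_mult)
  then have "(LINT x|M. \<bar>f x * g x\<bar>)\<^sup>2 \<le> (LINT x|M. (f x)\<^sup>2) * (LINT x|M. (g x)\<^sup>2)"
    by (subst (asm) ennreal_le_iff) auto
  then show "(LINT x|M. \<bar>f x * g x\<bar>) \<le> sqrt (LINT x|M. (f x)\<^sup>2) * sqrt (LINT x|M. (g x)\<^sup>2)"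
    by (simp add: real_le_rsqrt real_sqrt_mult[symmetric])
qed

lemma vec_nth_borel_measurable [measurable (raw)]:
  fixes f :: "'a \<Rightarrow> complex ^ 'n"
  assumes "f \<in> borel_measurable M"
  shows "(\<lambda>x. f x $ j) \<in> borel_measurable M"
  by (rule measurable_compose[OF assms]) (intro borel_measurable_continuous_onI continuous_intros)

section \<open>Algebra of the weighted inner product\<close>

lemma inner_t_simps:
  "inner_t t (a + b) c = inner_t t a c + inner_t t b c"
  "inner_t t a (b + c) = inner_t t a b + inner_t t a c"
  "inner_t t (a - b) c = inner_t t a c - inner_t t b c"
  "inner_t t a (b - c) = inner_t t a b - inner_t t a c"
  "inner_t t (- a) c = - inner_t t a c"
  "inner_t t a (- c) = - inner_t t a c"
  "inner_t t (x *s a) c = x * inner_t t a c"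
  "inner_t t a (x *s c) = cnj x * inner_t t a c"
  "inner_t t (r *\<^sub>R a) c = of_real r * inner_t t a c"
  "inner_t t a (r *\<^sub>R c) = of_real r * inner_t t a c"
  "inner_t t 0 c = 0"
  "inner_t t a 0 = 0"
  unfolding inner_t_def
  by (simp_all add: algebra_simps add_divide_distrib diff_divide_distrib sum.distrib sum_subtractf
        sum_negf sum_distrib_left scaleR_conv_of_real[where 'a = complex])

lemma cnj_inner_t: "cnj (inner_t t a b) = inner_t t b a"
  by (simp add: inner_t_def mult.commute)

lemma Re_inner_t_commute: "Re (inner_t t b a) = Re (inner_t t a b)"
  using arg_cong[OF cnj_inner_t[of t a b], of Re] by simp

lemma inner_t_self: "inner_t t a a = of_real (quad t a)"
  by (simp add: inner_t_def quad_def complex_norm_square[symmetric])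

lemma quad_add: "quad t (a + b) = quad t a + quad t b + 2 * Re (inner_t t a b)"
proof -
  have "of_real (quad t (a + b)) = inner_t t a a + inner_t t b b + (inner_t t a b + inner_t t b a)"
    by (simp add: inner_t_self[symmetric] inner_t_simps)
  from arg_cong[OF this, of Re] show ?thesis
    by (simp add: inner_t_self Re_inner_t_commute[of t b a])
qed

lemma quad_minus [simp]: "quad t (- a) = quad t a"
  by (simp add: quad_def)

lemma quad_diff: "quad t (a - b) = quad t a + quad t b - 2 * Re (inner_t t a b)"
  using quad_add[of t a "- b"] by (simp add: inner_t_simps)

lemma quad_scaleR: "quad t (r *\<^sub>R a) = r\<^sup>2 * quad t a"
  by (simp add: quad_def sum_distrib_left power_mult_distrib)

lemma quad_scale: "quad t (c *s a) = (cmod c)\<^sup>2 * quad t a"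
  by (simp add: quad_def sum_distrib_left power_mult_distrib norm_mult)

lemma inner_t_measurable [measurable (raw)]:
  assumes "f \<in> borel_measurable M" "g \<in> borel_measurable M"
  shows "(\<lambda>x. inner_t t (f x) (g x)) \<in> borel_measurable M"
  unfolding inner_t_def divide_inverse
  by (intro borel_measurable_sum borel_measurable_times vec_nth_borel_measurable assms
       measurable_compose[OF vec_nth_borel_measurable[OF assms(2)], of cnj] borel_measurable_const
       borel_measurable_continuous_onI continuous_intros)

lemma quad_measurable [measurable (raw)]:
  assumes [measurable]: "f \<in> borel_measurable M"
  shows "(\<lambda>x. quad t (f x)) \<in> borel_measurable M"
  unfolding quad_def by measurable

lemma sets_mu [simp, measurable_cong]: "sets (mu_t t) = sets borel"
  by (simp add: mu_t_def)

lemma space_mu [simp]: "space (mu_t t) = UNIV"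
  by (simp add: mu_t_def)

lemma scalar_measurable [measurable (raw)]:
  fixes f :: "'a \<Rightarrow> complex ^ 'n"
  assumes "f \<in> borel_measurable M"
  shows "(\<lambda>x. c *s f x) \<in> borel_measurable M"
proof (rule measurable_compose[OF assms])
  show "(\<lambda>x :: complex ^ 'n. c *s x) \<in> borel \<rightarrow>\<^sub>M borel"
    unfolding vector_scalar_mult_def
    by (intro borel_measurable_continuous_onI continuous_intros)
qed

lemma entire_continuous: "entire f \<Longrightarrow> continuous_on UNIV f"
  unfolding entire_def by (meson continuous_at_imp_continuous_on has_derivative_continuous)

lemma entire_measurable: "entire f \<Longrightarrow> f \<in> borel_measurable borel"
  using entire_continuous borel_measurable_continuous_onI by blast

text \<open>Restriction to complex lines through 0 reduces the mean value property to one
  variable.\<close>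

lemma entire_line_holomorphic:
  assumes "entire f"
  shows "(\<lambda>\<xi>. f (\<xi> *s z)) holomorphic_on UNIV"
proof -
  have "(\<lambda>\<xi>. f (\<xi> *s z)) field_differentiable (at \<xi>)" for \<xi>
  proof -
    obtain D where D: "(f has_derivative D) (at (\<xi> *s z))" "\<And>c v. D (c *s v) = c * D v"
      using assms unfolding entire_def by blast
    have "((\<lambda>\<xi>. \<xi> *s z) has_derivative (\<lambda>h. h *s z)) (at \<xi>)"
      by (rule bounded_linear_imp_has_derivative, rule linear_conv_bounded_linear[THEN iffD1])
        (auto simp: vector_scalar_mult_def vec_eq_iff algebra_simps intro!: linearI)
    from has_derivative_compose[OF this D(1)]
    have "((\<lambda>\<xi>. f (\<xi> *s z)) has_derivative (\<lambda>h. D z * h)) (at \<xi>)"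
      by (simp add: D(2) mult.commute)
    then show ?thesis
      unfolding field_differentiable_def has_field_derivative_def by blast
  qed
  then show ?thesis
    by (simp add: holomorphic_on_def field_differentiable_at_within)
qed

text \<open>Cauchy's formula on the unit circle, in the parametrisation over \<open>{0..1}\<close>
  that suits an average over rotations.\<close>

lemma holomorphic_circle_mean:
  assumes "f holomorphic_on UNIV"
  shows "((\<lambda>x. f (exp (2 * of_real pi * \<i> * of_real x))) has_integral f 0) {0..1}"
proof -
  have "((\<lambda>u. f u / (u - 0)) has_contour_integral (2 * of_real pi * \<i> * f 0)) (circlepath 0 1)"
    by (rule Cauchy_integral_circlepath_simple) (use assms holomorphic_on_subset in auto)
  then have "((\<lambda>x. f (exp (2 * of_real pi * \<i> * of_real x)) * (2 * of_real pi * \<i>))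
      has_integral (2 * of_real pi * \<i> * f 0)) {0..1}"
    unfolding has_contour_integral_def
    by (rule has_integral_eq[rotated]) (simp add: vector_derivative_circlepath01, simp add: circlepath)
  from has_integral_mult_left[OF this, of "inverse (2 * of_real pi * \<i>)"]
  show ?thesis
    by (simp add: field_simps)
qed

locale fock_space =
  fixes t :: "real ^ 'n"
  assumes tpos: "\<And>j. 0 < t $ j"
begin

abbreviation "ip \<equiv> inner_t t"
abbreviation "q \<equiv> quad t"
abbreviation "\<mu> \<equiv> mu_t t"

definition "mass = pi ^ CARD('n) * (\<Prod>j\<in>UNIV. t $ j)"

lemma mass_pos: "0 < mass"
  unfolding mass_def using tpos by (simp add: prod_pos)

lemma mu_eq: "\<mu> = density lborel (\<lambda>z. ennreal (exp (- q z) / mass))"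
  by (simp add: mu_t_def quad_def mass_def)

lemma nn_integral_mu:
  assumes [measurable]: "f \<in> borel_measurable borel"
  shows "(\<integral>\<^sup>+z. f z \<partial>\<mu>) = ennreal (1 / mass) * (\<integral>\<^sup>+z. ennreal (exp (- q z)) * f z \<partial>lborel)"
proof -
  have "(\<integral>\<^sup>+z. f z \<partial>\<mu>) = (\<integral>\<^sup>+z. ennreal (exp (- q z) / mass) * f z \<partial>lborel)"
    unfolding mu_eq by (rule nn_integral_density) auto
  also have "\<dots> = (\<integral>\<^sup>+z. ennreal (1 / mass) * (ennreal (exp (- q z)) * f z) \<partial>lborel)"
    using mass_pos by (intro nn_integral_cong) (simp add: mult.assoc[symmetric] ennreal_mult'[symmetric])
  also have "\<dots> = ennreal (1 / mass) * (\<integral>\<^sup>+z. ennreal (exp (- q z)) * f z \<partial>lborel)"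
    by (rule nn_integral_cmult) simp
  finally show ?thesis .
qed

sublocale mu: prob_space \<mu>
proof
  have "emeasure \<mu> (space \<mu>) = (\<integral>\<^sup>+z. 1 \<partial>\<mu>)"
    by simp
  also have "\<dots> = 1"
    using mass_pos by (subst nn_integral_mu)
      (simp_all add: nn_integral_gauss[OF tpos] mass_def[symmetric] ennreal_mult[symmetric])
  finally show "emeasure \<mu> (space \<mu>) = 1" .
qed

lemma quad_nonneg: "0 \<le> q z"
  unfolding quad_def by (intro sum_nonneg divide_nonneg_nonneg) (use tpos in \<open>auto simp: less_imp_le\<close>)

text \<open>\<open>T\<close> and, below, \<open>K\<close> compare the weighted geometry with the
  Euclidean norm: \<open>T\<close> bounds every \<open>t $ j\<close>, and \<open>K\<close> is the
  constant in the Cauchy-Schwarz type bound for \<open>ip\<close>.\<close>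

definition "T = (\<Sum>j\<in>UNIV. t $ j)"

lemma T_pos: "0 < T"
  unfolding T_def by (rule sum_pos) (use tpos in auto)

lemma norm_le_quad: "(norm z)\<^sup>2 \<le> T * q z"
proof -
  have "(norm z)\<^sup>2 = (\<Sum>j\<in>UNIV. (cmod (z $ j))\<^sup>2)"
    by (simp add: norm_vec_def L2_set_def sum_nonneg)
  also have "\<dots> \<le> (\<Sum>j\<in>UNIV. T * ((cmod (z $ j))\<^sup>2 / t $ j))"
  proof (rule sum_mono)
    fix j
    have "t $ j \<le> T"
      unfolding T_def by (rule member_le_sum) (use tpos in \<open>auto simp: less_imp_le\<close>)
    then have "t $ j * ((cmod (z $ j))\<^sup>2 / t $ j) \<le> T * ((cmod (z $ j))\<^sup>2 / t $ j)"
      using tpos[of j] by (intro mult_right_mono) auto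
    then show "(cmod (z $ j))\<^sup>2 \<le> T * ((cmod (z $ j))\<^sup>2 / t $ j)"
      using tpos[of j] by simp
  qed
  finally show ?thesis by (simp add: quad_def sum_distrib_left)
qed

definition "K = (\<Sum>j\<in>UNIV. 1 / t $ j)"

lemma K_nonneg: "0 \<le> K"
  unfolding K_def by (rule sum_nonneg) (use tpos in \<open>auto simp: less_imp_le\<close>)

lemma inner_t_bound: "cmod (ip a b) \<le> K * norm a * norm b"
proof -
  have "cmod (ip a b) \<le> (\<Sum>j\<in>UNIV. norm a * norm b * (1 / t $ j))"
    unfolding inner_t_def
  proof (rule sum_norm_le)
    fix j
    have "cmod (a $ j) * cmod (b $ j) \<le> norm a * norm b"
      by (intro mult_mono) (auto simp: norm_nth_le Finite_Cartesian_Product.norm_nth_le)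
    then show "cmod (a $ j * cnj (b $ j) / of_real (t $ j)) \<le> norm a * norm b * (1 / t $ j)"
      using tpos[of j] by (simp add: norm_mult norm_divide divide_right_mono)
  qed
  then show ?thesis
    unfolding K_def sum_distrib_left[symmetric] by (simp add: mult.commute mult.left_commute)
qed

text \<open>Completing the square gives \<open>2 A \<bar>z\<bar> \<le> A\<^sup>2 T + q z\<close>, so
  half of the Gaussian exponent absorbs the exponential.\<close>

lemma integrable_exp_norm: "integrable \<mu> (\<lambda>z. exp (A * norm z))"
proof (rule integrableI_bounded)
  have le: "exp (A * norm z) \<le> exp (A\<^sup>2 * T / 2) * exp (q z / 2)" for z :: "complex ^ 'n"
  proof -
    have "0 \<le> (A * T - norm z)\<^sup>2" by simp
    then have "2 * A * norm z * T \<le> (A\<^sup>2 * T) * T + (norm z)\<^sup>2"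
      by (simp add: power2_eq_square algebra_simps)
    also have "\<dots> \<le> (A\<^sup>2 * T) * T + q z * T"
      using norm_le_quad[of z] by (simp add: mult.commute)
    finally have "2 * A * norm z \<le> A\<^sup>2 * T + q z"
      using T_pos by (simp add: distrib_right[symmetric])
    then show ?thesis by (simp add: exp_add[symmetric])
  qed
  have q2: "q z / 2 = quad (2 *\<^sub>R t) z" for z
    by (simp add: quad_def sum_divide_distrib mult.commute)
  have "(\<integral>\<^sup>+z. ennreal (norm (exp (A * norm z))) \<partial>\<mu>) \<le> (\<integral>\<^sup>+z. ennreal (exp (A\<^sup>2 * T / 2)) * ennreal (exp (q z / 2)) \<partial>\<mu>)"
    using le by (intro nn_integral_mono) (simp add: ennreal_mult'[symmetric])
  also have "\<dots> = ennreal (exp (A\<^sup>2 * T / 2)) * (ennreal (1 / mass) * (\<integral>\<^sup>+z. ennreal (exp (- (q z / 2))) \<partial>lborel))"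
    by (subst nn_integral_cmult, simp, subst nn_integral_mu) (simp_all add: ennreal_mult'[symmetric] exp_add[symmetric])
  also have "\<dots> < \<infinity>"
    unfolding q2 by (subst nn_integral_gauss) (use tpos in \<open>auto simp: ennreal_mult_less_top\<close>)
  finally show "(\<integral>\<^sup>+z. ennreal (norm (exp (A * norm z))) \<partial>\<mu>) < \<infinity>" .
qed measurable

lemma mu_rotate:
  assumes c: "cmod c = 1"
  shows "distr \<mu> borel (\<lambda>z. c *s z) = \<mu>"
proof -
  have "\<mu> = density (distr lborel borel (\<lambda>z. c *s z)) (\<lambda>z. ennreal (exp (- q z) / mass))"
    unfolding lborel_cvec_rotate[OF c] by (rule mu_eq)
  also have "\<dots> = distr (density lborel (\<lambda>z. ennreal (exp (- q (c *s z)) / mass))) borel (\<lambda>z. c *s z)"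
    by (rule density_distr) auto
  also have "\<dots> = distr \<mu> borel (\<lambda>z. c *s z)"
    by (simp add: quad_scale c mu_eq)
  finally show ?thesis ..
qed

text \<open>The Cameron-Martin formula: the density is the quotient of the shifted and the original
  Gaussian. It is behind both the reproducing formula and the isometry of the Weyl
  operators.\<close>

lemma mu_translate:
  "\<mu> = distr (density \<mu> (\<lambda>u. ennreal (exp (- (2 * Re (ip u w) + q w))))) borel ((+) w)"
proof -
  have "\<mu> = density (distr lborel borel ((+) w)) (\<lambda>z. ennreal (exp (- q z) / mass))"
    unfolding lborel_distr_plus by (rule mu_eq)
  also have "\<dots> = distr (density lborel (\<lambda>z. ennreal (exp (- q (w + z)) / mass))) borel ((+) w)"
    by (rule density_distr) auto
  also have "density lborel (\<lambda>z. ennreal (exp (- q (w + z)) / mass)) =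
      density \<mu> (\<lambda>u. ennreal (exp (- (2 * Re (ip u w) + q w))))"
    unfolding mu_eq using mass_pos
    by (subst density_density_eq)
      (auto simp: quad_add ennreal_mult'[symmetric] exp_add[symmetric] Re_inner_t_commute[of t w] intro!: arg_cong2[where f = density])
  finally show ?thesis .
qed

lemma
  fixes f :: "complex ^ 'n \<Rightarrow> 'b::{banach, second_countable_topology}"
  assumes [measurable]: "f \<in> borel_measurable borel"
  shows integrable_mu_translate: "integrable \<mu> f \<longleftrightarrow>
      integrable \<mu> (\<lambda>u. exp (- (2 * Re (ip u w) + q w)) *\<^sub>R f (w + u))"
    and integral_mu_translate: "(LINT z|\<mu>. f z) =
      (LINT u|\<mu>. exp (- (2 * Re (ip u w) + q w)) *\<^sub>R f (w + u))"
   apply (subst mu_translate[of w], subst integrable_distr_eq)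
     apply simp
    apply simp
   apply (subst integrable_density)
      apply simp_all
  apply (subst mu_translate[of w], subst integral_distr)
    apply simp
   apply simp
  apply (subst integral_density)
     apply simp_all
  done

text \<open>The Gaussian measure is invariant under \<open>z \<mapsto> e\<^sup>i\<^sup>x z\<close>, so \<open>f\<close> may be replaced by its circular means, which equal
  \<open>f 0\<close>.\<close>

lemma integral_entire:
  assumes f: "entire f" and int: "integrable \<mu> f"
  shows "(LINT z|\<mu>. f z) = f 0"
proof -
  define L where "L = density lborel (\<lambda>x :: real. indicator {0..1} x :: ennreal)"
  have [measurable]: "f \<in> borel_measurable borel"
    using f by (rule entire_measurable)
  have sL [measurable_cong]: "sets L = sets borel"
    by (simp add: L_def)
  interpret L: prob_space L
    by standard (simp add: L_def emeasure_density)
  interpret pair_sigma_finite L \<mu> ..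
  define e where "e x = exp (2 * of_real pi * \<i> * of_real x)" for x :: real
  have e1: "cmod (e x) = 1" for x
    by (simp add: e_def norm_exp_eq_Re)
  have [measurable]: "e \<in> borel_measurable borel"
    unfolding e_def by (intro borel_measurable_continuous_onI continuous_intros)
  have [measurable]: "(\<lambda>p. e (fst p) *s snd p) \<in> borel_measurable (borel \<Otimes>\<^sub>M borel :: (real \<times> (complex ^ 'n)) measure)"
    unfolding borel_prod vector_scalar_mult_def e_def by (intro borel_measurable_continuous_onI continuous_intros)
  have meas: "(\<lambda>(x, z). f (e x *s z)) \<in> borel_measurable (L \<Otimes>\<^sub>M \<mu>)"
    unfolding case_prod_unfold
  proof (rule measurable_compose[of "\<lambda>p. e (fst p) *s snd p" _ borel])
    have "sets (L \<Otimes>\<^sub>M \<mu>) = sets (borel \<Otimes>\<^sub>M borel)"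
      by (rule sets_pair_measure_cong) (simp_all add: sL)
    then show "(\<lambda>p. e (fst p) *s snd p) \<in> L \<Otimes>\<^sub>M \<mu> \<rightarrow>\<^sub>M borel"
      by (subst measurable_cong_sets[where M' = "borel \<Otimes>\<^sub>M borel"]) auto
  qed simp
  have rot: "integrable \<mu> (\<lambda>z. g (e x *s z)) \<longleftrightarrow> integrable \<mu> g" 
       "(LINT z|\<mu>. g (e x *s z)) = (LINT z|\<mu>. g z)"
    if [measurable]: "g \<in> borel_measurable borel" for x and g :: "complex ^ 'n \<Rightarrow> 'c::{banach, second_countable_topology}"
    using integrable_distr_eq[of "\<lambda>z. e x *s z" \<mu> borel g] integral_distr[of "\<lambda>z. e x *s z" \<mu> borel g]
    by (simp_all add: mu_rotate[OF e1])
  \<comment> \<open>Rotation invariance makes the inner integral of the norm constant in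
    \<open>x\<close>, hence integrable over the probability space \<open>L\<close>.\<close>
  have fub: "integrable (L \<Otimes>\<^sub>M \<mu>) (\<lambda>(x, z). f (e x *s z))"
  proof (rule Fubini_integrable[OF meas])
    show "integrable L (\<lambda>x. LINT z|\<mu>. norm (case (x, z) of (x, z) \<Rightarrow> f (e x *s z)))"
      using rot(2)[of "\<lambda>z. norm (f z)"] by simp
    show "AE x in L. integrable \<mu> (\<lambda>z. case (x, z) of (x, z) \<Rightarrow> f (e x *s z))"
      using rot(1)[of f] int by simp
  qed
  have mean: "(LINT x|L. f (e x *s z)) = f 0" for z
  proof -
    have "continuous_on UNIV (\<lambda>x. e x *s z)"
      by (auto simp: e_def vector_scalar_mult_def intro!: continuous_intros)
    from continuous_on_compose2[OF entire_continuous[OF f] this]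
    have cont: "continuous_on UNIV (\<lambda>x. f (e x *s z))" by simp
    then have "set_integrable lborel {0..1} (\<lambda>x. f (e x *s z))"
      unfolding set_integrable_def
      by (intro borel_integrable_compact) (auto intro: continuous_on_subset)
    moreover have "(LINT x|L. f (e x *s z)) = (LINT x:{0..1}|lborel. f (e x *s z))"
      using borel_measurable_continuous_onI[OF cont]
      unfolding L_def set_lebesgue_integral_def
      by (subst integral_density[where g = "indicat_real {0..1}", symmetric])
         (auto simp: ennreal_indicator)
    moreover have "((\<lambda>x. f (e x *s z)) has_integral f (0 *s z)) {0..1}"
      using holomorphic_circle_mean[OF entire_line_holomorphic[OF f, of z]] by (simp add: e_def)
    ultimately show ?thesis
      by (simp add: set_borel_integral_eq_integral(2) integral_unique)
  qed
  have "(LINT z|\<mu>. f z) = (LINT x|L. LINT z|\<mu>. f (e x *s z))"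
    using L.prob_space by (simp add: rot)
  also have "\<dots> = (LINT z|\<mu>. LINT x|L. f (e x *s z))"
    using Fubini_integral[OF fub] by simp
  also have "\<dots> = f 0"
    by (simp add: mean mu.prob_space[unfolded space_mu])
  finally show ?thesis .
qed

end

section \<open>The projection onto the Fock space\<close>

lemma entireE:
  assumes "entire f"
  obtains D where "(f has_derivative D) (at z)" "\<And>c v. D (c *s v) = c * D v"
  using assms unfolding entire_def by blast

lemma entireI:
  assumes "\<And>z. \<exists>D. (f has_derivative D) (at z) \<and> (\<forall>c v. D (c *s v) = c * D v)"
  shows "entire f"
  using assms unfolding entire_def by blast

lemma entire_mult:
  assumes f: "entire f" and g: "entire g"
  shows "entire (\<lambda>z. f z * g z)"
proof (rule entireI)
  fix z
  obtain D where D: "(f has_derivative D) (at z)" "\<And>c v. D (c *s v) = c * D v"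
    using entireE[OF f] by metis
  obtain E where E: "(g has_derivative E) (at z)" "\<And>c v. E (c *s v) = c * E v"
    using entireE[OF g] by metis
  show "\<exists>D. ((\<lambda>z. f z * g z) has_derivative D) (at z) \<and> (\<forall>c v. D (c *s v) = c * D v)"
    by (intro exI[of _ "\<lambda>h. f z * E h + D h * g z"] conjI has_derivative_mult D(1) E(1))
      (simp add: D(2) E(2) algebra_simps)
qed

lemma entire_add:
  assumes f: "entire f" and g: "entire g"
  shows "entire (\<lambda>z. f z + g z)"
proof (rule entireI)
  fix z
  obtain D where D: "(f has_derivative D) (at z)" "\<And>c v. D (c *s v) = c * D v"
    using entireE[OF f] by metis
  obtain E where E: "(g has_derivative E) (at z)" "\<And>c v. E (c *s v) = c * E v"
    using entireE[OF g] by metis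
  show "\<exists>D. ((\<lambda>z. f z + g z) has_derivative D) (at z) \<and> (\<forall>c v. D (c *s v) = c * D v)"
    by (intro exI[of _ "\<lambda>h. D h + E h"] conjI has_derivative_add D(1) E(1))
      (simp add: D(2) E(2) algebra_simps)
qed

lemma entire_const: "entire (\<lambda>z. c)"
  unfolding entire_def by (intro allI exI[of _ "\<lambda>_. 0"]) auto

lemma entire_translate:
  assumes f: "entire f"
  shows "entire (\<lambda>z. f (z + a))"
proof (rule entireI)
  fix z
  obtain D where D: "(f has_derivative D) (at (z + a))" "\<And>c v. D (c *s v) = c * D v"
    using entireE[OF f] by metis
  have "((\<lambda>z. z + a) has_derivative (\<lambda>h. h)) (at z)"
    by (auto intro!: derivative_eq_intros)
  from has_derivative_compose[OF this D(1)] D(2)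
  show "\<exists>D. ((\<lambda>z. f (z + a)) has_derivative D) (at z) \<and> (\<forall>c v. D (c *s v) = c * D v)"
    by blast
qed

lemma cnj_borel_measurable [measurable (raw)]:
  "f \<in> borel_measurable M \<Longrightarrow> (\<lambda>x. cnj (f x)) \<in> borel_measurable M"
  by (erule measurable_compose) (intro borel_measurable_continuous_onI continuous_intros)

lemma bounded_linear_inner_t: "bounded_linear (\<lambda>w. inner_t t w v)"
  by (rule linear_conv_bounded_linear[THEN iffD1])
    (auto simp: inner_t_simps scaleR_conv_of_real[where 'a = complex] intro!: linearI)

lemma entire_exp_inner: "entire (\<lambda>w. exp (inner_t t w v))"
proof (rule entireI)
  fix z
  have "((\<lambda>w. inner_t t w v) has_derivative (\<lambda>h. inner_t t h v)) (at z)"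
    by (rule bounded_linear_imp_has_derivative[OF bounded_linear_inner_t])
  moreover have "(exp has_derivative (\<lambda>h. exp (inner_t t z v) * h)) (at (inner_t t z v))"
    using DERIV_exp[of "inner_t t z v"] by (simp add: has_field_derivative_def)
  ultimately have "((\<lambda>w. exp (inner_t t w v)) has_derivative (\<lambda>h. exp (inner_t t z v) * inner_t t h v)) (at z)"
    by (rule has_derivative_compose)
  then show "\<exists>D. ((\<lambda>w. exp (inner_t t w v)) has_derivative D) (at z) \<and> (\<forall>c v. D (c *s v) = c * D v)"
    by (intro exI conjI) (auto simp: inner_t_simps)
qed

text \<open>The second order remainder behind differentiating the kernel under the integral in
  \<open>entire_kproj\<close>; the factor \<open>exp (cmod b)\<close> is harmless since exponentials
  of the norm are square integrable.\<close>

lemma norm_exp_minus_linear: "cmod (exp b - 1 - b) \<le> (cmod b)\<^sup>2 * exp (cmod b)" for b :: complex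
proof -
  have "cmod (exp b - (\<Sum>i\<le>1. b ^ i / fact i)) \<le> exp \<bar>Re b\<bar> * cmod b ^ Suc 1 / fact 1"
    by (rule Taylor_exp)
  then have "cmod (exp b - 1 - b) \<le> exp \<bar>Re b\<bar> * (cmod b)\<^sup>2"
    by (simp add: power2_eq_square diff_diff_eq)
  also have "\<dots> \<le> exp (cmod b) * (cmod b)\<^sup>2"
    by (intro mult_right_mono) (auto simp: abs_Re_le_cmod)
  finally show ?thesis by (simp add: mult.commute)
qed

context fock_space
begin

section \<open>Square integrable functions and the Fock space\<close>

abbreviation "L2 \<equiv> L2_t t"
abbreviation "nrm \<equiv> L2_norm t"

lemma L2_iff: "f \<in> L2 \<longleftrightarrow> f \<in> borel_measurable borel \<and> integrable \<mu> (\<lambda>z. (cmod (f z))\<^sup>2)"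
  by (simp add: L2_t_def cong: measurable_cong_sets)

lemma L2_add: "f \<in> L2 \<Longrightarrow> g \<in> L2 \<Longrightarrow> (\<lambda>z. f z + g z) \<in> L2"
proof (unfold L2_iff, elim conjE, intro conjI)
  assume [measurable]: "f \<in> borel_measurable borel" "g \<in> borel_measurable borel"
    and i: "integrable \<mu> (\<lambda>z. (cmod (f z))\<^sup>2)" "integrable \<mu> (\<lambda>z. (cmod (g z))\<^sup>2)"
  have "(cmod (a + b))\<^sup>2 \<le> 2 * (cmod a)\<^sup>2 + 2 * (cmod b)\<^sup>2" for a b
  proof -
    have "(cmod (a + b))\<^sup>2 \<le> (cmod a + cmod b)\<^sup>2"
      by (intro power_mono norm_triangle_ineq) auto
    also have "\<dots> \<le> 2 * (cmod a)\<^sup>2 + 2 * (cmod b)\<^sup>2"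
      using sum_squares_bound[of "cmod a" "cmod b"] by (simp add: power2_sum)
    finally show ?thesis .
  qed
  note le = this
  show "integrable \<mu> (\<lambda>z. (cmod (f z + g z))\<^sup>2)"
  proof (rule Bochner_Integration.integrable_bound)
    show "integrable \<mu> (\<lambda>z. 2 * (cmod (f z))\<^sup>2 + 2 * (cmod (g z))\<^sup>2)"
      using i by simp
    have "norm ((cmod (f z + g z))\<^sup>2) \<le> norm (2 * (cmod (f z))\<^sup>2 + 2 * (cmod (g z))\<^sup>2)" for z
      using le[of "f z" "g z"] by simp
    then show "AE z in \<mu>. norm ((cmod (f z + g z))\<^sup>2) \<le> norm (2 * (cmod (f z))\<^sup>2 + 2 * (cmod (g z))\<^sup>2)"
      by (rule AE_I2)
  qed measurable
qed measurable

lemma L2_scale: "f \<in> L2 \<Longrightarrow> (\<lambda>z. c * f z) \<in> L2"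
  by (auto simp: L2_iff norm_mult power_mult_distrib)

lemma L2_diff: "f \<in> L2 \<Longrightarrow> g \<in> L2 \<Longrightarrow> (\<lambda>z. f z - g z) \<in> L2"
  using L2_add[of f "\<lambda>z. - 1 * g z"] L2_scale[of g "- 1"] by simp

lemma L2_cnj: "f \<in> L2 \<Longrightarrow> (\<lambda>z. cnj (f z)) \<in> L2"
  by (auto simp: L2_iff)

lemma L2_dominated:
  assumes "f \<in> L2" and [measurable]: "g \<in> borel_measurable borel" and le: "\<And>z. cmod (g z) \<le> B * cmod (f z)"
  shows "g \<in> L2"
  unfolding L2_iff
proof
  have [measurable]: "f \<in> borel_measurable borel" and i: "integrable \<mu> (\<lambda>z. (cmod (f z))\<^sup>2)"
    using assms(1) by (auto simp: L2_iff)
  show "integrable \<mu> (\<lambda>z. (cmod (g z))\<^sup>2)"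
  proof (rule Bochner_Integration.integrable_bound[of _ "\<lambda>z. B\<^sup>2 * (cmod (f z))\<^sup>2"])
    show "AE z in \<mu>. norm ((cmod (g z))\<^sup>2) \<le> norm (B\<^sup>2 * (cmod (f z))\<^sup>2)"
      using power_mono[OF le norm_ge_zero, of _ 2] by (auto simp: power_mult_distrib)
  qed (use i in auto)
qed measurable

lemma nrm_nonneg: "0 \<le> nrm f"
  by (simp add: L2_norm_def)

lemma nrm_power2: "(nrm f)\<^sup>2 = (LINT z|\<mu>. (cmod (f z))\<^sup>2)"
  by (simp add: L2_norm_def)

lemma nrm_mono:
  assumes "f \<in> L2" and "g \<in> borel_measurable borel" and "\<And>z. cmod (g z) \<le> B * cmod (f z)" "0 \<le> B"
  shows "nrm g \<le> B * nrm f"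
proof -
  have "g \<in> L2" by (rule L2_dominated) fact+
  have "(LINT z|\<mu>. (cmod (g z))\<^sup>2) \<le> (LINT z|\<mu>. B\<^sup>2 * (cmod (f z))\<^sup>2)"
  proof (rule integral_mono)
    show "(cmod (g z))\<^sup>2 \<le> B\<^sup>2 * (cmod (f z))\<^sup>2" for z
      using power_mono[OF assms(3) norm_ge_zero, of z 2] by (simp add: power_mult_distrib)
  qed (use \<open>g \<in> L2\<close> \<open>f \<in> L2\<close> in \<open>auto simp: L2_iff\<close>)
  then have "(nrm g)\<^sup>2 \<le> (B * nrm f)\<^sup>2"
    by (simp add: nrm_power2 power_mult_distrib)
  then show ?thesis
    by (rule power2_le_imp_le) (use assms(4) nrm_nonneg in auto)
qed

lemma
  assumes f: "f \<in> L2" and g: "g \<in> L2"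
  shows L2_mult_integrable: "integrable \<mu> (\<lambda>z. f z * g z)"
    and L2_mult_norm_le: "(LINT z|\<mu>. cmod (f z) * cmod (g z)) \<le> nrm f * nrm g"
    and L2_mult_norm_integrable: "integrable \<mu> (\<lambda>z. cmod (f z) * cmod (g z))"
proof -
  have [measurable]: "f \<in> borel_measurable borel" "g \<in> borel_measurable borel"
    using f g by (auto simp: L2_iff)
  note CS = Cauchy_Schwarz_integral[of "\<lambda>z. cmod (f z)" \<mu> "\<lambda>z. cmod (g z)"]
  show "(LINT z|\<mu>. cmod (f z) * cmod (g z)) \<le> nrm f * nrm g"
    using CS(2) f g by (simp add: L2_iff L2_norm_def)
  show int: "integrable \<mu> (\<lambda>z. cmod (f z) * cmod (g z))"
    using CS(1) f g by (simp add: L2_iff)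
  show "integrable \<mu> (\<lambda>z. f z * g z)"
    by (rule Bochner_Integration.integrable_bound[OF int]) (auto simp: norm_mult)
qed

lemma L2_inner_le: "f \<in> L2 \<Longrightarrow> g \<in> L2 \<Longrightarrow> cmod (L2_inner t f g) \<le> nrm f * nrm g"
  unfolding L2_inner_def
  by (rule order_trans[OF integral_norm_bound]) (use L2_mult_norm_le[of f g] in \<open>simp add: norm_mult\<close>)

lemma L2_exp_growth:
  assumes [measurable]: "f \<in> borel_measurable borel" and le: "\<And>z. cmod (f z) \<le> B * exp (A * norm z)"
  shows "f \<in> L2"
proof (rule L2_dominated[OF _ assms(1)])
  show "(\<lambda>z. of_real (exp (A * norm z))) \<in> L2"
    using integrable_exp_norm[of "2 * A"] by (simp add: L2_iff exp_double[symmetric] mult.assoc)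
qed (use le in auto)

lemma exp_inner_L2: "(\<lambda>z. exp (ip w z)) \<in> L2"
proof (rule L2_exp_growth[where B = 1 and A = "K * norm w"])
  show "cmod (exp (ip w z)) \<le> 1 * exp (K * norm w * norm z)" for z
    using order_trans[OF complex_Re_le_cmod inner_t_bound[of w z]] by simp
qed measurable

lemma exp_inner_L2': "(\<lambda>z. exp (ip z w)) \<in> L2"
  using L2_cnj[OF exp_inner_L2[of w]] by (simp add: exp_cnj cnj_inner_t)

lemma Fock_iff: "f \<in> Fock t \<longleftrightarrow> f \<in> L2 \<and> entire f"
  by (simp add: Fock_def)

lemma Fock_measurable: "f \<in> Fock t \<Longrightarrow> f \<in> borel_measurable borel"
  by (simp add: Fock_iff L2_iff)

lemma exp_inner_Fock: "(\<lambda>z. exp (ip z w)) \<in> Fock t"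
  by (simp add: Fock_iff exp_inner_L2' entire_exp_inner)

lemma Fock_add: "f \<in> Fock t \<Longrightarrow> g \<in> Fock t \<Longrightarrow> (\<lambda>z. f z + g z) \<in> Fock t"
  by (simp add: Fock_iff L2_add entire_add)

lemma Fock_scale: "f \<in> Fock t \<Longrightarrow> (\<lambda>z. c * f z) \<in> Fock t"
  by (simp add: Fock_iff L2_scale entire_mult entire_const)

lemma Fock_diff: "f \<in> Fock t \<Longrightarrow> g \<in> Fock t \<Longrightarrow> (\<lambda>z. f z - g z) \<in> Fock t"
  using Fock_add[of f "\<lambda>z. - 1 * g z"] Fock_scale[of g "- 1"] by simp

lemma Fock_zero: "(\<lambda>z. 0) \<in> Fock t"
  by (simp add: Fock_iff L2_iff entire_const)

text \<open>Integration against the reproducing kernel. \<open>Fock_proj\<close> is a definite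
  description; this explicit integral carries the computations once \<open>Fock_proj_eq\<close>
  identifies the two.\<close>

definition kproj :: "(complex ^ 'n \<Rightarrow> complex) \<Rightarrow> complex ^ 'n \<Rightarrow> complex" where
  "kproj g w = (LINT z|\<mu>. exp (ip w z) * g z)"

text \<open>Translation by \<open>w\<close> turns the integrand into
  \<open>f (u + w) * exp (- ip u w)\<close>, an entire function of \<open>u\<close> whose mean is
  its value \<open>f w\<close> at 0. Integrability of the product is assumed instead of
  \<open>f \<in> L2\<close> because \<open>kproj_phase\<close> applies the formula to
  \<open>exp (ip z v) * g z\<close>, which may leave \<open>L2\<close>.\<close>

lemma reproducing:
  assumes f: "entire f" and int: "integrable \<mu> (\<lambda>z. exp (ip w z) * f z)"
  shows "kproj f w = f w"
proof -
  have [measurable]: "f \<in> borel_measurable borel"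
    using f by (rule entire_measurable)
  have eq: "exp (- (2 * Re (ip u w) + q w)) *\<^sub>R (exp (ip w (w + u)) * f (w + u)) =
      f (u + w) * exp (ip u (- w))" for u
  proof -
    have "of_real (2 * Re (ip u w)) = ip u w + ip w u"
      by (metis cnj_inner_t complex_add_cnj)
    then have "of_real (- (2 * Re (ip u w) + q w)) + ip w (w + u) = ip u (- w)"
      by (simp add: inner_t_simps inner_t_self)
    then have "exp (of_real (- (2 * Re (ip u w) + q w))) * exp (ip w (w + u)) = exp (ip u (- w))"
      by (simp only: exp_add[symmetric])
    then have "exp (of_real (- (2 * Re (ip u w) + q w))) * (exp (ip w (w + u)) * f (w + u)) = exp (ip u (- w)) * f (w + u)"
      by (simp only: mult.assoc[symmetric])
    then show ?thesis
      by (simp only: scaleR_conv_of_real exp_of_real[symmetric] mult.commute[of _ "f (w + u)"] add.commute[of u w])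
  qed
  have "kproj f w = (LINT u|\<mu>. f (u + w) * exp (ip u (- w)))"
    unfolding kproj_def by (subst integral_mu_translate[of _ w], measurable) (simp only: eq)
  also have "\<dots> = f (0 + w) * exp (ip 0 (- w))"
  proof (rule integral_entire)
    show "entire (\<lambda>u. f (u + w) * exp (ip u (- w)))"
      by (intro entire_mult entire_translate f entire_exp_inner)
    show "integrable \<mu> (\<lambda>u. f (u + w) * exp (ip u (- w)))"
      using int by (subst (asm) integrable_mu_translate[of _ w], measurable) (simp only: eq)
  qed
  finally show ?thesis by (simp add: inner_t_simps)
qed

lemma kproj_Fock: "f \<in> Fock t \<Longrightarrow> kproj f = f"
  by (intro ext reproducing L2_mult_integrable exp_inner_L2) (auto simp: Fock_iff)

lemma kproj_add: "f \<in> L2 \<Longrightarrow> g \<in> L2 \<Longrightarrow> kproj (\<lambda>z. f z + g z) w = kproj f w + kproj g w"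
  unfolding kproj_def
  by (subst Bochner_Integration.integral_add[symmetric])
    (auto simp: distrib_left intro!: L2_mult_integrable exp_inner_L2)

lemma kproj_scale: "kproj (\<lambda>z. c * f z) w = c * kproj f w"
  unfolding kproj_def by (subst integral_mult_right_zero[symmetric]) (simp add: mult.left_commute)

lemma Fock_eval_le:
  assumes "f \<in> L2"
  shows "cmod (kproj f w) \<le> nrm (\<lambda>z. exp (ip w z)) * nrm f"
  unfolding kproj_def
  by (rule order_trans[OF integral_norm_bound])
    (use L2_mult_norm_le[OF exp_inner_L2[of w] assms] in \<open>simp add: norm_mult\<close>)

text \<open>The derivative is the integral \<open>D\<close> of the differentiated kernel, complex
  linear in \<open>v\<close> because \<open>ip v z\<close> is.\<close>

lemma entire_kproj:
  assumes g: "g \<in> L2"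
  shows "entire (kproj g)"
proof (rule entireI)
  fix w
  have [measurable]: "g \<in> borel_measurable borel" using g by (simp add: L2_iff)
  define D where "D v = (LINT z|\<mu>. ip v z * exp (ip w z) * g z)" for v
  have int_exp: "integrable \<mu> (\<lambda>z. exp (A * norm z) * cmod (g z))" for A
    using L2_mult_norm_integrable[OF _ g, of "\<lambda>z. of_real (exp (A * norm z))"]
      L2_exp_growth[of "\<lambda>z. of_real (exp (A * norm z))" 1 A] by simp
  have e: "cmod (exp (ip a z)) \<le> exp (K * norm a * norm z)" for a z
    using order_trans[OF complex_Re_le_cmod inner_t_bound[of a z]] by simp
  \<comment> \<open>Powers of \<open>norm z\<close> are traded for exponentials, so that every
    majorant has the form covered by \<open>int_exp\<close>.\<close>
  have x_le: "x \<le> exp x" "x\<^sup>2 \<le> 2 * exp x" if "0 \<le> x" for x :: real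
    using exp_lower_Taylor_quadratic[OF that] that exp_ge_add_one_self[of x] zero_le_power2[of x] by linarith+
  have D_bound: "cmod (ip v z * exp (ip w z) * g z) \<le> norm v * (K * (exp ((1 + K * norm w) * norm z) * cmod (g z)))" for v z
  proof -
    have "cmod (ip v z) * cmod (exp (ip w z)) \<le> (K * norm v * norm z) * exp (K * norm w * norm z)"
      by (intro mult_mono inner_t_bound e) (use K_nonneg in auto)
    also have "\<dots> \<le> (K * norm v * exp (norm z)) * exp (K * norm w * norm z)"
      by (intro mult_mono order_refl x_le) (use K_nonneg in auto)
    also have "\<dots> = norm v * (K * exp ((1 + K * norm w) * norm z))"
      by (simp add: algebra_simps exp_add)
    finally have "cmod (ip v z) * cmod (exp (ip w z)) * cmod (g z) \<le> norm v * (K * exp ((1 + K * norm w) * norm z)) * cmod (g z)"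
      by (rule mult_right_mono) simp
    then show ?thesis by (simp add: norm_mult mult_ac)
  qed
  have D_int: "integrable \<mu> (\<lambda>z. ip v z * exp (ip w z) * g z)" for v
  proof (rule Bochner_Integration.integrable_bound)
    show "integrable \<mu> (\<lambda>z. norm v * (K * (exp ((1 + K * norm w) * norm z) * cmod (g z))))"
      using int_exp by simp
    show "AE z in \<mu>. norm (ip v z * exp (ip w z) * g z) \<le> norm (norm v * (K * (exp ((1 + K * norm w) * norm z) * cmod (g z))))"
      using order_trans[OF D_bound[of v] abs_ge_self] by simp
  qed measurable
  have lin: "bounded_linear D"
  proof (rule bounded_linear_intro[where K = "LINT z|\<mu>. K * (exp ((1 + K * norm w) * norm z) * cmod (g z))"])
    show "D (x + y) = D x + D y" for x y
      unfolding D_def by (subst Bochner_Integration.integral_add[symmetric]) (auto intro!: D_int simp: inner_t_simps distrib_right)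
    show "D (r *\<^sub>R x) = r *\<^sub>R D x" for r x
      unfolding D_def by (simp add: inner_t_simps mult.assoc scaleR_conv_of_real[where 'a = complex])
    show "norm (D x) \<le> norm x * (LINT z|\<mu>. K * (exp ((1 + K * norm w) * norm z) * cmod (g z)))" for x
    proof -
      have "norm (D x) \<le> (LINT z|\<mu>. norm (ip x z * exp (ip w z) * g z))"
        unfolding D_def by (rule integral_norm_bound)
      also have "\<dots> \<le> (LINT z|\<mu>. norm x * (K * (exp ((1 + K * norm w) * norm z) * cmod (g z))))"
        by (rule integral_mono) (use D_int D_bound int_exp in auto)
      finally show ?thesis by simp
    qed
  qed
  \<comment> \<open>In the exponent, \<open>1\<close> comes from absorbing
    \<open>(norm z)\<^sup>2\<close>, \<open>K\<close> from the remainder of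
    \<open>exp (ip v z)\<close> with \<open>norm v \<le> 1\<close>, and \<open>K * norm w\<close>
    from the kernel at \<open>w\<close>.\<close>
  define C where "C = (LINT z|\<mu>. 2 * K\<^sup>2 * (exp ((1 + K + K * norm w) * norm z) * cmod (g z)))"
  have main: "cmod (kproj g (w + v) - kproj g w - D v) \<le> C * (norm v)\<^sup>2" if v: "norm v \<le> 1" for v
  proof -
    have i1: "integrable \<mu> (\<lambda>z. exp (ip a z) * g z)" for a
      by (intro L2_mult_integrable exp_inner_L2 g)
    have pt: "cmod (exp (ip (w + v) z) * g z - exp (ip w z) * g z - ip v z * exp (ip w z) * g z)
       \<le> (norm v)\<^sup>2 * (2 * K\<^sup>2 * (exp ((1 + K + K * norm w) * norm z) * cmod (g z)))" for z
    proof -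
      have "exp (ip (w + v) z) * g z - exp (ip w z) * g z - ip v z * exp (ip w z) * g z =
          (exp (ip v z) - 1 - ip v z) * exp (ip w z) * g z"
        by (simp add: inner_t_simps exp_add algebra_simps)
      moreover have "cmod (exp (ip v z) - 1 - ip v z) \<le> (K * norm v * norm z)\<^sup>2 * exp (K * norm z)"
      proof -
        have "K * norm v * norm z \<le> K * 1 * norm z"
          by (intro mult_mono) (use K_nonneg v in auto)
        then show ?thesis
          using inner_t_bound[of v z]
          by (intro order_trans[OF norm_exp_minus_linear] mult_mono power_mono) auto
      qed
      moreover have "(K * norm v * norm z)\<^sup>2 * exp (K * norm z) \<le> (norm v)\<^sup>2 * (2 * K\<^sup>2 * (exp (norm z) * exp (K * norm z)))"
      proof -
        have "(K * norm v)\<^sup>2 * exp (K * norm z) * (norm z)\<^sup>2 \<le> (K * norm v)\<^sup>2 * exp (K * norm z) * (2 * exp (norm z))"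
          by (intro mult_left_mono x_le) auto
        then show ?thesis by (simp add: power_mult_distrib mult_ac)
      qed
      ultimately have "cmod (exp (ip (w + v) z) * g z - exp (ip w z) * g z - ip v z * exp (ip w z) * g z)
        \<le> ((norm v)\<^sup>2 * (2 * K\<^sup>2 * (exp (norm z) * exp (K * norm z)))) * exp (K * norm w * norm z) * cmod (g z)"
        by (simp only: norm_mult) (intro mult_right_mono[OF mult_mono[OF order_trans e]], auto)
      then show ?thesis by (simp add: algebra_simps exp_add)
    qed
    have "kproj g (w + v) - kproj g w - D v =
      (LINT z|\<mu>. exp (ip (w + v) z) * g z - exp (ip w z) * g z - ip v z * exp (ip w z) * g z)"
      unfolding kproj_def D_def using i1 D_int by simp
    then have "cmod (kproj g (w + v) - kproj g w - D v) \<le>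
       (LINT z|\<mu>. cmod (exp (ip (w + v) z) * g z - exp (ip w z) * g z - ip v z * exp (ip w z) * g z))"
      by (simp add: integral_norm_bound)
    also have "\<dots> \<le> (LINT z|\<mu>. (norm v)\<^sup>2 * (2 * K\<^sup>2 * (exp ((1 + K + K * norm w) * norm z) * cmod (g z))))"
      by (rule integral_mono) (use i1 D_int pt int_exp in auto)
    finally show ?thesis by (simp add: C_def mult.commute)
  qed
  have "(kproj g has_derivative D) (at w)"
  proof (rule has_derivativeI_sandwich[of 1])
    show "norm (kproj g y - kproj g w - D (y - w)) / norm (y - w) \<le> C * norm (y - w)"
      if "y \<noteq> w" "dist y w < 1" for y
      using main[of "y - w"] that by (simp add: dist_norm field_simps power2_eq_square)
    have "((\<lambda>y. C * norm (y - w)) \<longlongrightarrow> C * norm (w - w)) (at w)"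
      by (intro tendsto_intros)
    then show "((\<lambda>y. C * norm (y - w)) \<longlongrightarrow> 0) (at w)" by simp
  qed (use lin in auto)
  moreover have "D (c *s v) = c * D v" for c v
    unfolding D_def by (simp add: inner_t_simps mult.assoc)
  ultimately show "\<exists>D. (kproj g has_derivative D) (at w) \<and> (\<forall>c v. D (c *s v) = c * D v)"
    by blast
qed

text \<open>Completing the square moves the Gaussian \<open>exp (- q z / 2)\<close> to the centre
  \<open>w\<close>; its mass, taken for \<open>2 *\<^sub>R t\<close>, yields the power of 2. Thus
  \<open>exp (q z / 2)\<close> is an eigenfunction of the modulus of the kernel.\<close>

lemma nn_integral_gauss_half:
  "(\<integral>\<^sup>+z. ennreal (exp (Re (ip w z) + q z / 2)) \<partial>\<mu>) = ennreal (2 ^ CARD('n) * exp (q w / 2))"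
proof -
  have "(\<integral>\<^sup>+z. ennreal (exp (Re (ip w z) + q z / 2)) \<partial>\<mu>) =
     ennreal (1 / mass) * (\<integral>\<^sup>+z. ennreal (exp (q w / 2)) * ennreal (exp (- (q (- w + z) / 2))) \<partial>lborel)"
    by (subst nn_integral_mu) (auto simp: ennreal_mult'[symmetric] exp_add[symmetric] quad_diff Re_inner_t_commute[of t w] field_simps
        intro!: arg_cong[where f = "\<lambda>x. _ * x"] nn_integral_cong)
  also have "(\<integral>\<^sup>+z. ennreal (exp (q w / 2)) * ennreal (exp (- (q (- w + z) / 2))) \<partial>lborel) =
     ennreal (exp (q w / 2)) * (\<integral>\<^sup>+z. ennreal (exp (- (q (- w + z) / 2))) \<partial>lborel)"
    by (rule nn_integral_cmult) measurable
  also have "(\<integral>\<^sup>+z. ennreal (exp (- (q (- w + z) / 2))) \<partial>lborel) = (\<integral>\<^sup>+z. ennreal (exp (- (q z / 2))) \<partial>lborel)"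
    by (rule nn_integral_lborel_shift) measurable
  also have "\<dots> = (\<integral>\<^sup>+z. ennreal (exp (- quad (2 *\<^sub>R t) z)) \<partial>lborel)"
    by (simp add: quad_def sum_divide_distrib mult.commute)
  also have "\<dots> = ennreal (2 ^ CARD('n) * mass)"
    by (subst nn_integral_gauss) (use tpos in \<open>auto simp: prod.distrib mass_def mult_ac\<close>)
  finally show ?thesis
    using mass_pos by (simp add: ennreal_mult'[symmetric] mult.commute)
qed

sublocale mu_pair: pair_sigma_finite \<mu> \<mu> ..

text \<open>Schur test with weight \<open>exp (q z / 2)\<close>.\<close>

lemma kernel_Schur:
  assumes g: "g \<in> L2"
  shows "(\<lambda>w. LINT z|\<mu>. cmod (exp (ip w z) * g z)) \<in> borel_measurable borel"
    and "integrable \<mu> (\<lambda>w. (LINT z|\<mu>. cmod (exp (ip w z) * g z))\<^sup>2)"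
proof -
  have [measurable]: "g \<in> borel_measurable borel" using g by (simp add: L2_iff)
  show [measurable]: "(\<lambda>w. LINT z|\<mu>. cmod (exp (ip w z) * g z)) \<in> borel_measurable borel"
    by measurable
  define H where "H z = ennreal (2 ^ CARD('n) * (cmod (g z))\<^sup>2 * exp (- q z / 2))" for z
  have [measurable]: "H \<in> borel_measurable borel" unfolding H_def by measurable
  have int: "integrable \<mu> (\<lambda>z. cmod (exp (ip w z) * g z))" for w
    by (intro integrable_norm L2_mult_integrable exp_inner_L2 g)
  have CS: "(ennreal (LINT z|\<mu>. cmod (exp (ip w z) * g z)))\<^sup>2 \<le>
     (\<integral>\<^sup>+z. H z * ennreal (exp (Re (ip z w) + q w / 2)) \<partial>\<mu>)" for w
  proof -
    have "(ennreal (LINT z|\<mu>. cmod (exp (ip w z) * g z)))\<^sup>2 = (\<integral>\<^sup>+z. ennreal (cmod (exp (ip w z) * g z)) \<partial>\<mu>)\<^sup>2"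
      by (subst nn_integral_eq_integral) (use int in auto)
    \<comment> \<open>The split is chosen so that squaring the first factor produces the weight
      \<open>exp (q z / 2)\<close>, whose integral against the kernel is known.\<close>
    also have "\<dots> = (\<integral>\<^sup>+z. ennreal (exp (Re (ip w z) / 2 + q z / 4)) * ennreal (exp (Re (ip w z) / 2 - q z / 4) * cmod (g z)) \<partial>\<mu>)\<^sup>2"
      by (intro arg_cong[where f = "\<lambda>x. x\<^sup>2"] nn_integral_cong)
        (simp add: ennreal_mult'[symmetric] mult.assoc[symmetric] exp_add[symmetric] norm_mult)
    also have "\<dots> \<le> (\<integral>\<^sup>+z. (ennreal (exp (Re (ip w z) / 2 + q z / 4)))\<^sup>2 \<partial>\<mu>) *
        (\<integral>\<^sup>+z. (ennreal (exp (Re (ip w z) / 2 - q z / 4) * cmod (g z)))\<^sup>2 \<partial>\<mu>)"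
      by (rule Cauchy_Schwarz_nn_integral) measurable
    also have "(\<integral>\<^sup>+z. (ennreal (exp (Re (ip w z) / 2 + q z / 4)))\<^sup>2 \<partial>\<mu>) = ennreal (2 ^ CARD('n) * exp (q w / 2))"
      unfolding nn_integral_gauss_half[symmetric]
      by (intro nn_integral_cong) (simp add: ennreal_power exp_double[symmetric] algebra_simps)
    also have "ennreal (2 ^ CARD('n) * exp (q w / 2)) * (\<integral>\<^sup>+z. (ennreal (exp (Re (ip w z) / 2 - q z / 4) * cmod (g z)))\<^sup>2 \<partial>\<mu>) =
       (\<integral>\<^sup>+z. ennreal (2 ^ CARD('n) * exp (q w / 2)) * (ennreal (exp (Re (ip w z) / 2 - q z / 4) * cmod (g z)))\<^sup>2 \<partial>\<mu>)"
      by (rule nn_integral_cmult[symmetric]) measurable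
    also have "\<dots> = (\<integral>\<^sup>+z. H z * ennreal (exp (Re (ip z w) + q w / 2)) \<partial>\<mu>)"
    proof (intro nn_integral_cong)
      fix z
      have "2 ^ CARD('n) * exp (q w / 2) * (exp (Re (ip w z) / 2 - q z / 4) * cmod (g z))\<^sup>2 =
         2 ^ CARD('n) * (cmod (g z))\<^sup>2 * exp (- q z / 2) * exp (Re (ip z w) + q w / 2)"
        by (simp add: power_mult_distrib exp_double[symmetric] Re_inner_t_commute[of t z w] exp_add[symmetric] mult_ac)
      then show "ennreal (2 ^ CARD('n) * exp (q w / 2)) * (ennreal (exp (Re (ip w z) / 2 - q z / 4) * cmod (g z)))\<^sup>2 =
        H z * ennreal (exp (Re (ip z w) + q w / 2))"
        by (simp add: H_def ennreal_power ennreal_mult'[symmetric])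
    qed
    finally show ?thesis .
  qed
  have "(\<integral>\<^sup>+w. ennreal (norm ((LINT z|\<mu>. cmod (exp (ip w z) * g z))\<^sup>2)) \<partial>\<mu>) \<le>
      (\<integral>\<^sup>+w. \<integral>\<^sup>+z. H z * ennreal (exp (Re (ip z w) + q w / 2)) \<partial>\<mu> \<partial>\<mu>)"
    using CS by (intro nn_integral_mono) (simp add: ennreal_power)
  also have "\<dots> = (\<integral>\<^sup>+z. \<integral>\<^sup>+w. H z * ennreal (exp (Re (ip z w) + q w / 2)) \<partial>\<mu> \<partial>\<mu>)"
    by (rule mu_pair.Fubini'[symmetric]) measurable
  also have "\<dots> = (\<integral>\<^sup>+z. ennreal (4 ^ CARD('n)) * ennreal ((cmod (g z))\<^sup>2) \<partial>\<mu>)"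
  proof (rule nn_integral_cong)
    fix z
    have "(\<integral>\<^sup>+w. H z * ennreal (exp (Re (ip z w) + q w / 2)) \<partial>\<mu>) =
      H z * ennreal (2 ^ CARD('n) * exp (q z / 2))"
      by (subst nn_integral_cmult) (simp_all add: nn_integral_gauss_half)
    also have "\<dots> = ennreal (4 ^ CARD('n)) * ennreal ((cmod (g z))\<^sup>2)"
    proof -
      have "exp (- q z / 2) * exp (q z / 2) = 1" by (simp add: exp_add[symmetric])
      then have "2 ^ CARD('n) * (cmod (g z))\<^sup>2 * exp (- q z / 2) * (2 ^ CARD('n) * exp (q z / 2)) = 4 ^ CARD('n) * (cmod (g z))\<^sup>2"
        by (simp add: mult.assoc mult.left_commute[of "exp (- (q z / 2))"] power_mult_distrib[symmetric])
      then show ?thesis by (simp add: H_def ennreal_mult'[symmetric])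
    qed
    finally show "(\<integral>\<^sup>+w. H z * ennreal (exp (Re (ip z w) + q w / 2)) \<partial>\<mu>) =
      ennreal (4 ^ CARD('n)) * ennreal ((cmod (g z))\<^sup>2)" .
  qed
  also have "\<dots> < \<infinity>"
    using g by (subst nn_integral_cmult) (auto simp: L2_iff nn_integral_eq_integral ennreal_mult_less_top)
  finally show "integrable \<mu> (\<lambda>w. (LINT z|\<mu>. cmod (exp (ip w z) * g z))\<^sup>2)"
    by (intro integrableI_bounded) measurable
qed

lemma kproj_in_Fock:
  assumes g: "g \<in> L2"
  shows "kproj g \<in> Fock t"
proof -
  have "(\<lambda>w. of_real (LINT z|\<mu>. cmod (exp (ip w z) * g z))) \<in> L2"
    using kernel_Schur[OF g] by (simp add: L2_iff)
  then have "kproj g \<in> L2"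
    by (rule L2_dominated[where B = 1])
      (auto simp: kproj_def entire_measurable entire_kproj g intro: order_trans[OF integral_norm_bound])
  with g show ?thesis by (simp add: Fock_iff entire_kproj)
qed

text \<open>Hermitian symmetry of the kernel and Fubini; the absolute integrability comes from the
  Schur bound.\<close>

lemma kproj_adjoint:
  assumes g: "g \<in> L2" and h: "h \<in> L2"
  shows "L2_inner t (kproj g) h = L2_inner t g (kproj h)"
proof -
  have [measurable]: "g \<in> borel_measurable borel" "h \<in> borel_measurable borel" using g h by (auto simp: L2_iff)
  have meas: "(\<lambda>(w, z). exp (ip w z) * g z * cnj (h w)) \<in> borel_measurable (\<mu> \<Otimes>\<^sub>M \<mu>)"
    using L2_cnj[OF h] by (auto simp: L2_iff)
  have int: "integrable \<mu> (\<lambda>z. exp (ip w z) * g z)" for w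
    by (intro L2_mult_integrable exp_inner_L2 g)
  have fub: "integrable (\<mu> \<Otimes>\<^sub>M \<mu>) (\<lambda>(w, z). exp (ip w z) * g z * cnj (h w))"
  proof (rule mu_pair.Fubini_integrable[OF meas])
    have "(\<lambda>w. of_real (LINT z|\<mu>. cmod (exp (ip w z) * g z))) \<in> L2"
      using kernel_Schur[OF g] by (simp add: L2_iff)
    from L2_mult_norm_integrable[OF this h]
    show "integrable \<mu> (\<lambda>w. LINT z|\<mu>. norm (case (w, z) of (w, z) \<Rightarrow> exp (ip w z) * g z * cnj (h w)))"
      by (simp add: norm_mult)
    show "AE w in \<mu>. integrable \<mu> (\<lambda>z. case (w, z) of (w, z) \<Rightarrow> exp (ip w z) * g z * cnj (h w))"
      using int by simp
  qed
  have "L2_inner t (kproj g) h = (LINT w|\<mu>. LINT z|\<mu>. exp (ip w z) * g z * cnj (h w))"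
    by (simp add: L2_inner_def kproj_def)
  also have "\<dots> = (LINT z|\<mu>. LINT w|\<mu>. exp (ip w z) * g z * cnj (h w))"
    using mu_pair.Fubini_integral[OF fub] by simp
  also have "\<dots> = (LINT z|\<mu>. g z * cnj (LINT w|\<mu>. exp (ip z w) * h w))"
  proof (rule Bochner_Integration.integral_cong[OF refl])
    fix z
    have "cnj (LINT w|\<mu>. exp (ip z w) * h w) = (LINT w|\<mu>. exp (ip w z) * cnj (h w))"
      by (subst Bochner_Integration.integral_cnj[symmetric]) (simp add: exp_cnj cnj_inner_t)
    then show "(LINT w|\<mu>. exp (ip w z) * g z * cnj (h w)) = g z * cnj (LINT w|\<mu>. exp (ip z w) * h w)"
      by (simp add: mult_ac flip: integral_mult_right_zero)
  qed
  finally show ?thesis by (simp add: L2_inner_def kproj_def)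
qed

lemma L2_inner_diff_left:
  "f \<in> L2 \<Longrightarrow> g \<in> L2 \<Longrightarrow> h \<in> L2 \<Longrightarrow> L2_inner t (\<lambda>z. f z - g z) h = L2_inner t f h - L2_inner t g h"
  unfolding L2_inner_def
  by (subst Bochner_Integration.integral_diff[symmetric])
    (auto simp: left_diff_distrib intro!: L2_mult_integrable L2_cnj)

text \<open>Uniqueness is tested on the kernels \<open>exp (ip z w)\<close>: the inner product with
  them evaluates \<open>kproj\<close> at \<open>w\<close>, and \<open>kproj\<close> fixes the
  competitor \<open>k\<close>.\<close>

lemma Fock_proj_eq:
  assumes g: "g \<in> L2"
  shows "Fock_proj t g = kproj g"
  unfolding Fock_proj_def
proof (rule the_equality)
  show "kproj g \<in> Fock t \<and> (\<forall>h\<in>Fock t. L2_inner t (\<lambda>z. g z - kproj g z) h = 0)"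
    using kproj_in_Fock[OF g] kproj_adjoint[OF g] kproj_Fock g
    by (auto simp: L2_inner_diff_left Fock_iff)
  fix k
  assume k: "k \<in> Fock t \<and> (\<forall>h\<in>Fock t. L2_inner t (\<lambda>z. g z - k z) h = 0)"
  show "k = kproj g"
  proof
    fix w
    have "L2_inner t (\<lambda>z. g z - k z) (\<lambda>z. exp (ip z w)) = 0"
      using k exp_inner_Fock by blast
    moreover have "L2_inner t (\<lambda>z. g z - k z) (\<lambda>z. exp (ip z w)) = kproj g w - kproj k w"
      unfolding L2_inner_def kproj_def using k
      by (subst Bochner_Integration.integral_diff[symmetric])
        (auto simp: exp_cnj cnj_inner_t Fock_iff algebra_simps intro!: L2_mult_integrable exp_inner_L2 g)
    ultimately show "k w = kproj g w"
      using k kproj_Fock[of k] by simp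
  qed
qed

lemma L2_inner_self: "L2_inner t f f = of_real ((nrm f)\<^sup>2)"
  unfolding L2_inner_def nrm_power2
  by (simp add: complex_norm_square[symmetric] flip: integral_complex_of_real)

text \<open>The Schur test only yields the constant \<open>2 ^ CARD('n)\<close>. Contractivity comes
  from \<open>\<parallel>kproj g\<parallel>\<^sup>2 = <g, kproj g>\<close>, valid because
  \<open>kproj\<close> is symmetric and idempotent.\<close>

lemma nrm_kproj_le:
  assumes g: "g \<in> L2"
  shows "nrm (kproj g) \<le> nrm g"
proof -
  have k: "kproj g \<in> Fock t" "kproj g \<in> L2"
    using kproj_in_Fock[OF g] by (auto simp: Fock_iff)
  have "of_real ((nrm (kproj g))\<^sup>2) = L2_inner t g (kproj g)"
    using kproj_adjoint[OF g k(2)] by (simp add: kproj_Fock[OF k(1)] L2_inner_self)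
  then have "(nrm (kproj g))\<^sup>2 \<le> nrm g * nrm (kproj g)"
    using L2_inner_le[OF g k(2)] by (metis norm_of_real abs_of_nonneg zero_le_power2)
  then show ?thesis
    using nrm_nonneg[of g] nrm_nonneg[of "kproj g"]
    by (cases "nrm (kproj g) = 0") (auto simp: power2_eq_square)
qed

section \<open>Integrals of Weyl operators\<close>

text \<open>Translation by \<open>v\<close>, with the exponential factor that makes it isometric for
  the Gaussian measure. It acts on arbitrary functions because it is needed pointwise and on
  \<open>L2\<close> as well as on \<open>Fock t\<close>.\<close>

definition weyl :: "complex ^ 'n \<Rightarrow> (complex ^ 'n \<Rightarrow> complex) \<Rightarrow> complex ^ 'n \<Rightarrow> complex" where
  "weyl v g w = exp (ip w v - of_real (q v / 2)) * g (w - v)"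

lemma weyl_measurable [measurable (raw)]:
  assumes [measurable]: "v \<in> borel_measurable M" "w \<in> borel_measurable M" "g \<in> borel_measurable borel"
  shows "(\<lambda>x. weyl (v x) g (w x)) \<in> borel_measurable M"
proof -
  have [measurable]: "(\<lambda>x. g (w x - v x)) \<in> borel_measurable M"
    by (rule measurable_compose[of _ M borel]) measurable
  show ?thesis unfolding weyl_def by measurable
qed

text \<open>The squared modulus of the exponential factor is exactly the density in the translation
  formula for the shift by \<open>- v\<close>.\<close>

lemma
  assumes g: "g \<in> L2"
  shows weyl_L2: "weyl v g \<in> L2" and nrm_weyl: "nrm (weyl v g) = nrm g"
proof -
  have [measurable]: "g \<in> borel_measurable borel" using g by (simp add: L2_iff)
  have eq: "exp (- (2 * Re (ip u (- v)) + q (- v))) *\<^sub>R (cmod (g (- v + u)))\<^sup>2 = (cmod (weyl v g u))\<^sup>2" for u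
    by (simp add: weyl_def norm_mult power_mult_distrib exp_double[symmetric] inner_t_simps algebra_simps)
  have "integrable \<mu> (\<lambda>z. (cmod (g z))\<^sup>2)"
    using g by (simp add: L2_iff)
  then have "integrable \<mu> (\<lambda>u. (cmod (weyl v g u))\<^sup>2)"
    by (subst (asm) integrable_mu_translate[of _ "- v"], measurable) (simp only: eq)
  then show "weyl v g \<in> L2"
    by (simp add: L2_iff)
  have "(LINT z|\<mu>. (cmod (g z))\<^sup>2) = (LINT u|\<mu>. (cmod (weyl v g u))\<^sup>2)"
    by (subst integral_mu_translate[of _ "- v"], measurable) (simp only: eq)
  then show "nrm (weyl v g) = nrm g"
    by (simp add: L2_norm_def)
qed

lemma weyl_Fock:
  assumes g: "g \<in> Fock t"
  shows "weyl v g \<in> Fock t"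
proof -
  have "entire (\<lambda>w. exp (ip w v) * (exp (- of_real (q v / 2)) * g (w + (- v))))"
    using g by (intro entire_mult entire_exp_inner entire_const entire_translate) (simp add: Fock_iff)
  moreover have "weyl v g = (\<lambda>w. exp (ip w v) * (exp (- of_real (q v / 2)) * g (w + (- v))))"
    by (simp add: weyl_def fun_eq_iff mult.assoc[symmetric] exp_add[symmetric])
  ultimately show ?thesis
    using g weyl_L2[of g v] by (simp add: Fock_iff)
qed

text \<open>The Weyl form of the canonical commutation relations: the real part of
  \<open>ip a b\<close> is absorbed by \<open>q (a + b)\<close>, and the imaginary part remains as a
  scalar phase.\<close>

lemma weyl_weyl:
  "weyl a (weyl b g) w = exp (- \<i> * of_real (sigma_t t a b)) * weyl (a + b) g w"
proof -
  have e: "- ip a b = - \<i> * of_real (sigma_t t a b) - of_real (Re (ip a b))"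
    by (simp add: sigma_t_def complex_eq_iff)
  have "ip w a - of_real (q a / 2) + (ip (w - a) b - of_real (q b / 2)) =
     - \<i> * of_real (sigma_t t a b) + (ip w (a + b) - of_real (q (a + b) / 2))"
    using e by (simp add: inner_t_simps quad_add add_divide_distrib)
  then show ?thesis
    by (simp add: weyl_def mult.assoc[symmetric] exp_add[symmetric] diff_diff_eq)
qed

lemma weyl_weyl_commuting: "sigma_t t a b = 0 \<Longrightarrow> weyl a (weyl b g) w = weyl (a + b) g w"
  by (simp add: weyl_weyl)

text \<open>Uniform in \<open>v\<close>, because \<open>weyl v\<close> is isometric and evaluation
  at \<open>w\<close> is bounded on \<open>Fock t\<close>. This makes integrals of Weyl operators
  converge absolutely at each point.\<close>

lemma weyl_bound:
  assumes g: "g \<in> Fock t"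
  shows "cmod (weyl v g w) \<le> nrm (\<lambda>z. exp (ip w z)) * nrm g"
  using Fock_eval_le[of "weyl v g" w] weyl_Fock[OF g, of v] kproj_Fock[of "weyl v g"] nrm_weyl[of g v] g
  by (simp add: Fock_iff)

definition phase :: "complex ^ 'n \<Rightarrow> complex ^ 'n \<Rightarrow> complex" where
  "phase w v = exp (2 * \<i> * of_real (sigma_t t w v))"

lemma norm_phase [simp]: "cmod (phase w v) = 1"
  by (simp add: phase_def norm_exp_eq_Re)

lemma phase_measurable [measurable (raw)]:
  assumes [measurable]: "v \<in> borel_measurable M" "w \<in> borel_measurable M"
  shows "(\<lambda>x. phase (v x) (w x)) \<in> borel_measurable M"
  unfolding phase_def sigma_t_def by measurable

lemma phase_eq: "phase w v = exp (ip w v - ip v w)"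
proof -
  have "2 * \<i> * of_real (sigma_t t w v) = ip w v - ip v w"
    using complex_diff_cnj[of "ip w v"] by (simp add: sigma_t_def cnj_inner_t)
  then show ?thesis by (simp add: phase_def)
qed

text \<open>In \<open>phase z v = exp (ip z v - ip v z)\<close> the antiholomorphic factor moves the
  kernel from \<open>w\<close> to \<open>w - v\<close>, where the holomorphic factor is reproduced.
  Its value \<open>exp (ip (w - v) v)\<close> differs from the factor in \<open>weyl\<close> by the
  Gaussian.\<close>

lemma kproj_phase:
  assumes g: "g \<in> Fock t"
  shows "kproj (\<lambda>z. phase z v * g z) w = of_real (exp (- q v / 2)) * weyl v g w"
proof -
  note [measurable] = Fock_measurable[OF g]
  have L2: "(\<lambda>z. phase z v * g z) \<in> L2"
    by (rule L2_dominated[of g _ 1]) (use g in \<open>auto simp: Fock_iff norm_mult\<close>)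
  have eq: "exp (ip w z) * (phase z v * g z) = exp (ip (w - v) z) * (exp (ip z v) * g z)" for z
  proof -
    have "exp (ip w z) * phase z v = exp (ip (w - v) z) * exp (ip z v)"
      by (simp add: phase_eq exp_add[symmetric] inner_t_simps algebra_simps)
    then show ?thesis by (simp add: mult.assoc[symmetric])
  qed
  have "kproj (\<lambda>z. phase z v * g z) w = kproj (\<lambda>z. exp (ip z v) * g z) (w - v)"
    by (simp add: kproj_def eq)
  also have "\<dots> = exp (ip (w - v) v) * g (w - v)"
  proof (rule reproducing)
    show "entire (\<lambda>z. exp (ip z v) * g z)"
      using g by (intro entire_mult entire_exp_inner) (simp add: Fock_iff)
    show "integrable \<mu> (\<lambda>z. exp (ip (w - v) z) * (exp (ip z v) * g z))"
      using L2_mult_integrable[OF exp_inner_L2[of w] L2] by (simp add: eq)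
  qed
  also have "exp (ip (w - v) v) = of_real (exp (- q v / 2)) * exp (ip w v - of_real (q v / 2))"
    by (simp add: exp_of_real[symmetric] exp_add[symmetric] inner_t_simps inner_t_self)
  finally show ?thesis by (simp add: weyl_def)
qed

text \<open>The operator integral is taken pointwise in \<open>w\<close>, which avoids
  operator-valued integrands. \<open>M\<close> is Lebesgue measure for a single resolvent and a
  product measure for a product of resolvents.\<close>

definition wop :: "'a measure \<Rightarrow> ('a \<Rightarrow> complex) \<Rightarrow> ('a \<Rightarrow> complex ^ 'n) \<Rightarrow> 'n fock_op" where
  "wop M \<kappa> v = (\<lambda>g\<in>Fock t. \<lambda>w. LINT x|M. \<kappa> x * weyl (v x) g w)"

lemma wop_integrable:
  assumes \<kappa>: "integrable M \<kappa>" and [measurable]: "v \<in> borel_measurable M" and g: "g \<in> Fock t"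
  shows "integrable M (\<lambda>x. \<kappa> x * weyl (v x) g w)"
proof (rule Bochner_Integration.integrable_bound)
  note [measurable] = Fock_measurable[OF g]
  show "integrable M (\<lambda>x. cmod (\<kappa> x) * (nrm (\<lambda>z. exp (ip w z)) * nrm g))"
    using \<kappa> by simp
  show "(\<lambda>x. \<kappa> x * weyl (v x) g w) \<in> borel_measurable M"
    using \<kappa> by measurable
  show "AE x in M. norm (\<kappa> x * weyl (v x) g w) \<le> norm (cmod (\<kappa> x) * (nrm (\<lambda>z. exp (ip w z)) * nrm g))"
    using mult_left_mono[OF weyl_bound[OF g], of "cmod (\<kappa> _)"] nrm_nonneg
    by (intro AE_I2) (simp add: norm_mult)
qed

text \<open>Minkowski's integral inequality: Cauchy-Schwarz in \<open>x\<close> with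
  \<open>\<bar>\<kappa>\<bar>\<close> split into two square roots, Tonelli, and the isometry of each
  \<open>weyl (v x)\<close>.\<close>

lemma
  assumes "sigma_finite_measure M" and \<kappa>: "integrable M \<kappa>"
    and v[measurable]: "v \<in> borel_measurable M" and g: "g \<in> Fock t"
  shows wop_L2: "wop M \<kappa> v g \<in> L2"
    and nrm_wop_le: "nrm (wop M \<kappa> v g) \<le> (LINT x|M. cmod (\<kappa> x)) * nrm g"
proof -
  interpret M: sigma_finite_measure M by fact
  interpret pair_sigma_finite M \<mu> ..
  note [measurable] = Fock_measurable[OF g]
  have gL2: "g \<in> L2" using g by (simp add: Fock_iff)
  have [measurable]: "\<kappa> \<in> borel_measurable M" using \<kappa> by simp
  define c where "c = (LINT x|M. cmod (\<kappa> x))"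
  define k where "k x w = ennreal (cmod (\<kappa> x)) * ennreal ((cmod (weyl (v x) g w))\<^sup>2)" for x w
  have [measurable]: "case_prod k \<in> borel_measurable (M \<Otimes>\<^sub>M \<mu>)" "(\<lambda>(w, x). k x w) \<in> borel_measurable (\<mu> \<Otimes>\<^sub>M M)"
    unfolding k_def by measurable
  have c0: "0 \<le> c" by (simp add: c_def)
  have nn_\<kappa>: "(\<integral>\<^sup>+x. ennreal (cmod (\<kappa> x)) \<partial>M) = ennreal c"
    unfolding c_def using \<kappa> by (intro nn_integral_eq_integral) auto
  have meas[measurable]: "wop M \<kappa> v g \<in> borel_measurable borel"
    using g unfolding wop_def by simp
  have CS: "ennreal ((cmod (wop M \<kappa> v g w))\<^sup>2) \<le> ennreal c * (\<integral>\<^sup>+x. k x w \<partial>M)" for w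
  proof -
    have "ennreal (cmod (wop M \<kappa> v g w)) \<le> (\<integral>\<^sup>+x. ennreal (cmod (\<kappa> x * weyl (v x) g w)) \<partial>M)"
      using integral_norm_bound_ennreal[OF wop_integrable[OF \<kappa> v g]] g by (simp add: wop_def)
    also have "\<dots> = (\<integral>\<^sup>+x. ennreal (sqrt (cmod (\<kappa> x))) * ennreal (sqrt (cmod (\<kappa> x)) * cmod (weyl (v x) g w)) \<partial>M)"
      by (intro nn_integral_cong) (simp add: ennreal_mult'[symmetric] mult.assoc[symmetric] norm_mult)
    finally have "(ennreal (cmod (wop M \<kappa> v g w)))\<^sup>2 \<le> \<dots>\<^sup>2"
      by (rule power_mono) simp
    also have "\<dots> \<le> (\<integral>\<^sup>+x. (ennreal (sqrt (cmod (\<kappa> x))))\<^sup>2 \<partial>M) * (\<integral>\<^sup>+x. (ennreal (sqrt (cmod (\<kappa> x)) * cmod (weyl (v x) g w)))\<^sup>2 \<partial>M)"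
      by (rule Cauchy_Schwarz_nn_integral) measurable
    also have "\<dots> = ennreal c * (\<integral>\<^sup>+x. k x w \<partial>M)"
      by (simp add: k_def ennreal_power nn_\<kappa> power_mult_distrib ennreal_mult')
    finally show ?thesis by (simp add: ennreal_power)
  qed
  have "(\<integral>\<^sup>+w. ennreal ((cmod (wop M \<kappa> v g w))\<^sup>2) \<partial>\<mu>) \<le>
    (\<integral>\<^sup>+w. ennreal c * (\<integral>\<^sup>+x. k x w \<partial>M) \<partial>\<mu>)"
    by (rule nn_integral_mono) (rule CS)
  also have "\<dots> = ennreal c * (\<integral>\<^sup>+w. \<integral>\<^sup>+x. k x w \<partial>M \<partial>\<mu>)"
    by (rule nn_integral_cmult) measurable
  also have "(\<integral>\<^sup>+w. \<integral>\<^sup>+x. k x w \<partial>M \<partial>\<mu>) =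
     (\<integral>\<^sup>+x. \<integral>\<^sup>+w. k x w \<partial>\<mu> \<partial>M)"
    by (rule Fubini') measurable
  also have "\<dots> = (\<integral>\<^sup>+x. ennreal (cmod (\<kappa> x)) * ennreal ((nrm g)\<^sup>2) \<partial>M)"
  proof (rule nn_integral_cong)
    fix x
    have "(\<integral>\<^sup>+w. ennreal ((cmod (weyl (v x) g w))\<^sup>2) \<partial>\<mu>) = ennreal ((nrm g)\<^sup>2)"
      using weyl_L2[OF gL2, of "v x"] nrm_weyl[OF gL2, of "v x", symmetric]
      by (simp add: nrm_power2) (intro nn_integral_eq_integral, auto simp: L2_iff)
    then show "(\<integral>\<^sup>+w. k x w \<partial>\<mu>) = ennreal (cmod (\<kappa> x)) * ennreal ((nrm g)\<^sup>2)"
      unfolding k_def by (subst nn_integral_cmult) auto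
  qed
  also have "ennreal c * \<dots> = ennreal ((c * nrm g)\<^sup>2)"
    using c0 by (subst nn_integral_multc) (simp_all add: nn_\<kappa> ennreal_mult'[symmetric] power2_eq_square mult_ac)
  finally have fin: "(\<integral>\<^sup>+w. ennreal ((cmod (wop M \<kappa> v g w))\<^sup>2) \<partial>\<mu>) \<le> ennreal ((c * nrm g)\<^sup>2)" .
  have int: "integrable \<mu> (\<lambda>w. (cmod (wop M \<kappa> v g w))\<^sup>2)"
    using order_le_less_trans[OF fin] by (intro integrableI_bounded) auto
  then show "wop M \<kappa> v g \<in> L2"
    by (simp add: L2_iff)
  have "(nrm (wop M \<kappa> v g))\<^sup>2 \<le> (c * nrm g)\<^sup>2"
    using fin int unfolding nrm_power2 by (subst (asm) nn_integral_eq_integral) auto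
  then show "nrm (wop M \<kappa> v g) \<le> (LINT x|M. cmod (\<kappa> x)) * nrm g"
    unfolding c_def[symmetric] by (rule power2_le_imp_le) (use c0 nrm_nonneg in auto)
qed

text \<open>Holomorphy without differentiating under the integral: Fubini shows that
  \<open>kproj\<close> fixes the function, and \<open>kproj\<close> maps into
  \<open>Fock t\<close>.\<close>

lemma wop_Fock:
  assumes M: "sigma_finite_measure M" and \<kappa>: "integrable M \<kappa>"
    and v[measurable]: "v \<in> borel_measurable M" and g: "g \<in> Fock t"
  shows "wop M \<kappa> v g \<in> Fock t"
proof -
  interpret M: sigma_finite_measure M by fact
  interpret pair_sigma_finite M \<mu> ..
  note [measurable] = Fock_measurable[OF g]
  have gL2: "g \<in> L2" using g by (simp add: Fock_iff)
  have [measurable]: "\<kappa> \<in> borel_measurable M" using \<kappa> by simp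
  have "kproj (wop M \<kappa> v g) w = wop M \<kappa> v g w" for w
  proof -
    have meas: "(\<lambda>(x, z). \<kappa> x * (exp (ip w z) * weyl (v x) g z)) \<in> borel_measurable (M \<Otimes>\<^sub>M \<mu>)"
      by measurable
    have int: "integrable \<mu> (\<lambda>z. exp (ip w z) * weyl (v x) g z)" for x
      by (intro L2_mult_integrable exp_inner_L2 weyl_L2 gL2)
    have fub: "integrable (M \<Otimes>\<^sub>M \<mu>) (\<lambda>(x, z). \<kappa> x * (exp (ip w z) * weyl (v x) g z))"
    proof (rule Fubini_integrable[OF meas])
      have "cmod (\<kappa> x) * (LINT z|\<mu>. cmod (exp (ip w z)) * cmod (weyl (v x) g z)) \<le> cmod (\<kappa> x) * (nrm (\<lambda>z. exp (ip w z)) * nrm g)" for x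
        using L2_mult_norm_le[OF exp_inner_L2 weyl_L2[OF gL2], of w "v x"]
        by (intro mult_left_mono) (simp_all add: nrm_weyl gL2)
      note le = this
      have "integrable M (\<lambda>x. cmod (\<kappa> x) * (LINT z|\<mu>. cmod (exp (ip w z)) * cmod (weyl (v x) g z)))"
      proof (rule Bochner_Integration.integrable_bound)
        show "integrable M (\<lambda>x. cmod (\<kappa> x) * (nrm (\<lambda>z. exp (ip w z)) * nrm g))"
          using \<kappa> by simp
        show "AE x in M. norm (cmod (\<kappa> x) * (LINT z|\<mu>. cmod (exp (ip w z)) * cmod (weyl (v x) g z)))
          \<le> norm (cmod (\<kappa> x) * (nrm (\<lambda>z. exp (ip w z)) * nrm g))"
        proof (rule AE_I2)
          fix x
          have "0 \<le> cmod (\<kappa> x) * (LINT z|\<mu>. cmod (exp (ip w z)) * cmod (weyl (v x) g z))"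
            by (intro mult_nonneg_nonneg integral_nonneg_AE AE_I2) auto
          then show "norm (cmod (\<kappa> x) * (LINT z|\<mu>. cmod (exp (ip w z)) * cmod (weyl (v x) g z)))
            \<le> norm (cmod (\<kappa> x) * (nrm (\<lambda>z. exp (ip w z)) * nrm g))"
            unfolding real_norm_def by (rule order_trans[OF eq_refl[OF abs_of_nonneg] order_trans[OF le abs_ge_self]])
        qed
      qed measurable
      then show "integrable M (\<lambda>x. LINT z|\<mu>. norm (case (x, z) of (x, z) \<Rightarrow> \<kappa> x * (exp (ip w z) * weyl (v x) g z)))"
        by (simp only: norm_mult case_prod_conv integral_mult_right_zero)
      show "AE x in M. integrable \<mu> (\<lambda>z. case (x, z) of (x, z) \<Rightarrow> \<kappa> x * (exp (ip w z) * weyl (v x) g z))"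
        using int by simp
    qed
    have "exp (ip w z) * wop M \<kappa> v g z = (LINT x|M. \<kappa> x * (exp (ip w z) * weyl (v x) g z))" for z
    proof -
      have "exp (ip w z) * wop M \<kappa> v g z = exp (ip w z) * (LINT x|M. \<kappa> x * weyl (v x) g z)"
        by (simp add: wop_def g)
      also have "\<dots> = (LINT x|M. exp (ip w z) * (\<kappa> x * weyl (v x) g z))"
        by (rule integral_mult_right_zero[symmetric])
      finally show ?thesis by (simp only: mult.left_commute)
    qed
    then have "kproj (wop M \<kappa> v g) w = (LINT z|\<mu>. LINT x|M. \<kappa> x * (exp (ip w z) * weyl (v x) g z))"
      by (simp only: kproj_def)
    also have "\<dots> = (LINT x|M. LINT z|\<mu>. \<kappa> x * (exp (ip w z) * weyl (v x) g z))"
      using Fubini_integral[OF fub] by simp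
    also have "\<dots> = (LINT x|M. \<kappa> x * kproj (weyl (v x) g) w)"
      by (simp add: kproj_def)
    also have "\<dots> = wop M \<kappa> v g w"
      using g by (simp add: kproj_Fock weyl_Fock wop_def)
    finally show ?thesis .
  qed
  then have "kproj (wop M \<kappa> v g) = wop M \<kappa> v g"
    by (rule ext)
  then show ?thesis
    using kproj_in_Fock[OF wop_L2[OF M \<kappa> v g]] by simp
qed

section \<open>Operator norm estimates and the algebra of Weyl integrals\<close>

abbreviation "op_dist X Y \<equiv> norm_op (Fock_cstar t) (add_op (Fock_cstar t) X (scale_op (Fock_cstar t) (- 1) Y))"

text \<open>\<open>norm_op\<close> is a real supremum, informative only over a set bounded above;
  hence even the lower bound 0 is drawn from the estimate by \<open>C\<close>.\<close>

lemma opnorm_bounds: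
  assumes "\<And>f. f \<in> Fock t \<Longrightarrow> nrm (A f) \<le> C * nrm f" "0 \<le> C"
  shows "0 \<le> norm_op (Fock_cstar t) A" "norm_op (Fock_cstar t) A \<le> C"
proof -
  let ?S = "{nrm (A f) | f. f \<in> Fock t \<and> nrm f \<le> 1}"
  have ub: "x \<le> C" if "x \<in> ?S" for x
  proof -
    obtain f where f: "x = nrm (A f)" "f \<in> Fock t" "nrm f \<le> 1" using \<open>x \<in> ?S\<close> by blast
    have "x \<le> C * nrm f" using assms(1) f by simp
    also have "\<dots> \<le> C * 1" using f assms(2) by (intro mult_left_mono) auto
    finally show ?thesis by simp
  qed
  have z: "nrm (\<lambda>z. 0) = 0" by (simp add: L2_norm_def)
  have mem: "nrm (A (\<lambda>z. 0)) \<in> ?S"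
    using Fock_zero z by auto
  show "norm_op (Fock_cstar t) A \<le> C"
    unfolding Fock_cstar_def using mem ub by (auto intro!: cSup_least)
  have "0 \<le> nrm (A (\<lambda>z. 0))" by (rule nrm_nonneg)
  also have "\<dots> \<le> Sup ?S"
    by (rule cSup_upper[OF mem]) (auto intro!: bdd_aboveI ub)
  finally show "0 \<le> norm_op (Fock_cstar t) A"
    by (simp add: Fock_cstar_def)
qed

lemma wop_bounded_ops:
  assumes M: "sigma_finite_measure M" and \<kappa>: "integrable M \<kappa>" and v: "v \<in> borel_measurable M"
  shows "wop M \<kappa> v \<in> bounded_ops t"
proof -
  note int = wop_integrable[OF \<kappa> v]
  have "wop M \<kappa> v (\<lambda>z. f z + g z) = (\<lambda>z. wop M \<kappa> v f z + wop M \<kappa> v g z)" if "f \<in> Fock t" "g \<in> Fock t" for f g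
    using that Fock_add[OF that] int
    by (auto simp: wop_def weyl_def distrib_left intro!: ext)
  moreover have "wop M \<kappa> v (\<lambda>z. c * f z) = (\<lambda>z. c * wop M \<kappa> v f z)" if "f \<in> Fock t" for f c
    using that Fock_scale[OF that]
    by (auto simp: wop_def weyl_def mult.left_commute[of _ c] intro!: ext)
  moreover have "wop M \<kappa> v \<in> Fock t \<rightarrow>\<^sub>E Fock t"
    using wop_Fock[OF M \<kappa> v] by (auto simp: PiE_iff wop_def)
  ultimately show ?thesis
    using nrm_wop_le[OF M \<kappa> v] unfolding bounded_ops_def by blast
qed

lemma opnorm_wop_diff:
  assumes M: "sigma_finite_measure M" and \<kappa>: "integrable M \<kappa>" "integrable M \<kappa>'" and v: "v \<in> borel_measurable M"
  shows "0 \<le> op_dist (wop M \<kappa> v) (wop M \<kappa>' v)"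
   "op_dist (wop M \<kappa> v) (wop M \<kappa>' v)
     \<le> (LINT x|M. cmod (\<kappa> x - \<kappa>' x))"
proof -
  have "add_op (Fock_cstar t) (wop M \<kappa> v) (scale_op (Fock_cstar t) (- 1) (wop M \<kappa>' v)) f = wop M (\<lambda>x. \<kappa> x - \<kappa>' x) v f"
    if f: "f \<in> Fock t" for f
    using f wop_integrable[OF \<kappa>(1) v f] wop_integrable[OF \<kappa>(2) v f]
    by (simp add: Fock_cstar_def wop_def fun_eq_iff left_diff_distrib)
  then have "nrm (add_op (Fock_cstar t) (wop M \<kappa> v) (scale_op (Fock_cstar t) (- 1) (wop M \<kappa>' v)) f) \<le>
    (LINT x|M. cmod (\<kappa> x - \<kappa>' x)) * nrm f" if f: "f \<in> Fock t" for f
    using nrm_wop_le[OF M _ v f, of "\<lambda>x. \<kappa> x - \<kappa>' x"] \<kappa> f by simp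
  then show "0 \<le> op_dist (wop M \<kappa> v) (wop M \<kappa>' v)"
   "op_dist (wop M \<kappa> v) (wop M \<kappa>' v)
     \<le> (LINT x|M. cmod (\<kappa> x - \<kappa>' x))"
    using opnorm_bounds[of _ "LINT x|M. cmod (\<kappa> x - \<kappa>' x)"] by simp_all
qed

lemma wop_add:
  assumes \<kappa>: "integrable M \<kappa>" "integrable M \<kappa>'" and v: "v \<in> borel_measurable M"
  shows "wop M (\<lambda>x. \<kappa> x + \<kappa>' x) v = add_op (Fock_cstar t) (wop M \<kappa> v) (wop M \<kappa>' v)"
proof
  fix g
  show "wop M (\<lambda>x. \<kappa> x + \<kappa>' x) v g = add_op (Fock_cstar t) (wop M \<kappa> v) (wop M \<kappa>' v) g"
    using wop_integrable[OF \<kappa>(1) v, of g] wop_integrable[OF \<kappa>(2) v, of g]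
    by (simp add: Fock_cstar_def wop_def fun_eq_iff distrib_right restrict_def)
qed

lemma wop_scale: "wop M (\<lambda>x. c * \<kappa> x) v = scale_op (Fock_cstar t) c (wop M \<kappa> v)"
  by (simp add: Fock_cstar_def wop_def fun_eq_iff restrict_def mult.assoc)

text \<open>At a given point \<open>weyl (v x)\<close> only translates and multiplies, so it passes
  under the inner integral without any interchange of integrals.\<close>

lemma wop_wop:
  assumes "g \<in> Fock t" "wop N \<rho> u g \<in> Fock t"
  shows "wop M \<kappa> v (wop N \<rho> u g) w = (LINT x|M. LINT y|N. \<kappa> x * \<rho> y * weyl (v x) (weyl (u y) g) w)"
proof -
  have "\<kappa> x * weyl (v x) (wop N \<rho> u g) w = (LINT y|N. \<kappa> x * \<rho> y * weyl (v x) (weyl (u y) g) w)" for x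
  proof -
    have "\<kappa> x * weyl (v x) (wop N \<rho> u g) w = \<kappa> x * exp (ip w (v x) - of_real (q (v x) / 2)) * (LINT y|N. \<rho> y * weyl (u y) g (w - v x))"
      using assms(1) by (simp add: wop_def weyl_def[of "v x"])
    also have "\<dots> = (LINT y|N. \<kappa> x * exp (ip w (v x) - of_real (q (v x) / 2)) * (\<rho> y * weyl (u y) g (w - v x)))"
      by (rule integral_mult_right_zero[symmetric])
    finally show ?thesis by (simp add: weyl_def[of "v x"] mult_ac)
  qed
  then show ?thesis using assms(2) by (simp add: wop_def[of M])
qed

section \<open>Toeplitz operators with bounded symbols\<close>

lemma toeplitz_bounded_symbol:
  assumes [measurable]: "\<phi> \<in> borel_measurable borel" and B: "\<And>z. cmod (\<phi> z) \<le> B"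
  shows toeplitz_eq: "toeplitz t \<phi> = (\<lambda>g\<in>Fock t. kproj (\<lambda>z. \<phi> z * g z))"
    and toeplitz_mult_L2: "g \<in> Fock t \<Longrightarrow> (\<lambda>z. \<phi> z * g z) \<in> L2"
    and toeplitz_nrm_le: "g \<in> Fock t \<Longrightarrow> nrm (toeplitz t \<phi> g) \<le> B * nrm g"
    and toeplitz_bounded_ops: "toeplitz t \<phi> \<in> bounded_ops t"
proof -
  have L2: "(\<lambda>z. \<phi> z * g z) \<in> L2" if g: "g \<in> Fock t" for g
  proof -
    note [measurable] = Fock_measurable[OF g]
    show ?thesis
      by (rule L2_dominated[of g _ B]) (use g B in \<open>auto simp: Fock_iff norm_mult intro!: mult_right_mono\<close>)
  qed
  then have dom: "toeplitz_dom t \<phi> = Fock t"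
    by (auto simp: toeplitz_dom_def)
  then show eq: "toeplitz t \<phi> = (\<lambda>g\<in>Fock t. kproj (\<lambda>z. \<phi> z * g z))"
    using L2 by (auto simp: toeplitz_def fun_eq_iff Fock_proj_eq restrict_def)
  show "g \<in> Fock t \<Longrightarrow> (\<lambda>z. \<phi> z * g z) \<in> L2" by (rule L2)
  have B0: "0 \<le> B" using B[of 0] norm_ge_zero order_trans by blast
  have le: "nrm (toeplitz t \<phi> g) \<le> B * nrm g" if g: "g \<in> Fock t" for g
  proof -
    note [measurable] = Fock_measurable[OF g]
    have "nrm (toeplitz t \<phi> g) \<le> nrm (\<lambda>z. \<phi> z * g z)"
      using g nrm_kproj_le[OF L2[OF g]] by (simp add: eq)
    also have "\<dots> \<le> B * nrm g"
      by (rule nrm_mono) (use g B B0 in \<open>auto simp: Fock_iff norm_mult intro!: mult_right_mono\<close>)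
    finally show ?thesis .
  qed
  then show "g \<in> Fock t \<Longrightarrow> nrm (toeplitz t \<phi> g) \<le> B * nrm g" .
  have "toeplitz t \<phi> (\<lambda>z. f z + g z) = (\<lambda>z. toeplitz t \<phi> f z + toeplitz t \<phi> g z)" if "f \<in> Fock t" "g \<in> Fock t" for f g
    using that Fock_add[OF that] kproj_add[OF L2 L2, of f g] by (simp add: eq distrib_left fun_eq_iff)
  moreover have "toeplitz t \<phi> (\<lambda>z. c * f z) = (\<lambda>z. c * toeplitz t \<phi> f z)" if "f \<in> Fock t" for f c
    using that Fock_scale[OF that] by (simp add: eq kproj_scale[symmetric] mult.left_commute)
  moreover have "toeplitz t \<phi> \<in> Fock t \<rightarrow>\<^sub>E Fock t"
    using kproj_in_Fock[OF L2] by (auto simp: PiE_iff eq)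
  ultimately show "toeplitz t \<phi> \<in> bounded_ops t"
    using le unfolding bounded_ops_def by blast
qed

lemma toeplitz_add:
  assumes \<phi>: "\<phi> \<in> borel_measurable borel" "\<And>z. cmod (\<phi> z) \<le> B"
    and \<psi>: "\<psi> \<in> borel_measurable borel" "\<And>z. cmod (\<psi> z) \<le> B'"
  shows "toeplitz t (\<lambda>z. \<phi> z + \<psi> z) = add_op (Fock_cstar t) (toeplitz t \<phi>) (toeplitz t \<psi>)"
proof -
  have "\<And>z. cmod (\<phi> z + \<psi> z) \<le> B + B'"
    using \<phi>(2) \<psi>(2) by (meson add_mono norm_triangle_le)
  then have "toeplitz t (\<lambda>z. \<phi> z + \<psi> z) = (\<lambda>g\<in>Fock t. kproj (\<lambda>z. (\<phi> z + \<psi> z) * g z))"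
    using \<phi>(1) \<psi>(1) by (intro toeplitz_eq) auto
  then show ?thesis
    using kproj_add[OF toeplitz_mult_L2[OF \<phi>] toeplitz_mult_L2[OF \<psi>]]
    by (simp add: toeplitz_eq[OF \<phi>] toeplitz_eq[OF \<psi>] Fock_cstar_def fun_eq_iff restrict_def distrib_right)
qed

lemma toeplitz_scale:
  assumes \<phi>: "\<phi> \<in> borel_measurable borel" "\<And>z. cmod (\<phi> z) \<le> B"
  shows "toeplitz t (\<lambda>z. c * \<phi> z) = scale_op (Fock_cstar t) c (toeplitz t \<phi>)"
proof -
  have "toeplitz t (\<lambda>z. c * \<phi> z) = (\<lambda>g\<in>Fock t. kproj (\<lambda>z. c * \<phi> z * g z))"
    using \<phi> by (intro toeplitz_eq[of _ "cmod c * B"]) (auto simp: norm_mult intro!: mult_left_mono)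
  then show ?thesis
    by (simp add: toeplitz_eq[OF \<phi>] Fock_cstar_def fun_eq_iff restrict_def kproj_scale[symmetric] mult.assoc)
qed

lemma opnorm_toeplitz_diff:
  assumes \<phi>: "\<phi> \<in> borel_measurable borel" "\<And>z. cmod (\<phi> z) \<le> B"
    and \<psi>: "\<psi> \<in> borel_measurable borel" "\<And>z. cmod (\<psi> z) \<le> B'"
    and e: "\<And>z. cmod (\<phi> z - \<psi> z) \<le> e"
  shows "0 \<le> op_dist (toeplitz t \<phi>) (toeplitz t \<psi>)"
   "op_dist (toeplitz t \<phi>) (toeplitz t \<psi>) \<le> e"
proof -
  have "add_op (Fock_cstar t) (toeplitz t \<phi>) (scale_op (Fock_cstar t) (- 1) (toeplitz t \<psi>)) = toeplitz t (\<lambda>z. \<phi> z + (- 1) * \<psi> z)"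
    by (subst toeplitz_add[of _ B _ B'], use \<phi> \<psi> in simp_all, subst toeplitz_scale[of \<psi> B' "- 1", symmetric], use \<psi> in simp_all)
  moreover have "0 \<le> e" using e[of 0] norm_ge_zero order_trans by blast
  ultimately show "0 \<le> op_dist (toeplitz t \<phi>) (toeplitz t \<psi>)"
   "op_dist (toeplitz t \<phi>) (toeplitz t \<psi>) \<le> e"
    using opnorm_bounds[of "toeplitz t (\<lambda>z. \<phi> z + (- 1) * \<psi> z)" e] toeplitz_nrm_le[of "\<lambda>z. \<phi> z + (- 1) * \<psi> z" e] \<phi>(1) \<psi>(1) e
    by simp_all
qed

definition fourier :: "'a measure \<Rightarrow> ('a \<Rightarrow> complex) \<Rightarrow> ('a \<Rightarrow> complex ^ 'n) \<Rightarrow> complex ^ 'n \<Rightarrow> complex" where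
  "fourier M \<kappa> v w = (LINT x|M. \<kappa> x * phase w (v x))"

text \<open>Phases have modulus 1, so the Fubini hypothesis reduces to integrability of
  \<open>\<kappa>\<close>; with \<open>kproj\<close> inside the integral, \<open>kproj_phase\<close>
  treats each \<open>x\<close> separately.\<close>

lemma toeplitz_fourier:
  assumes M: "sigma_finite_measure M" and \<kappa>: "integrable M \<kappa>" and v[measurable]: "v \<in> borel_measurable M"
  shows "toeplitz t (fourier M \<kappa> v) = wop M (\<lambda>x. \<kappa> x * of_real (exp (- q (v x) / 2))) v"
proof -
  interpret M: sigma_finite_measure M by fact
  interpret pair_sigma_finite M \<mu> ..
  have [measurable]: "\<kappa> \<in> borel_measurable M" using \<kappa> by simp
  have [measurable]: "fourier M \<kappa> v \<in> borel_measurable borel"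
    unfolding fourier_def by measurable
  have bound: "cmod (fourier M \<kappa> v w) \<le> (LINT x|M. cmod (\<kappa> x))" for w
    unfolding fourier_def by (rule order_trans[OF integral_norm_bound]) (simp add: norm_mult)
  have "kproj (\<lambda>z. fourier M \<kappa> v z * g z) w = (LINT x|M. \<kappa> x * of_real (exp (- q (v x) / 2)) * weyl (v x) g w)"
    if g: "g \<in> Fock t" for g w
  proof -
    note [measurable] = Fock_measurable[OF g]
  have gL2: "g \<in> L2" using g by (simp add: Fock_iff)
    have meas: "(\<lambda>(x, z). \<kappa> x * (exp (ip w z) * (phase z (v x) * g z))) \<in> borel_measurable (M \<Otimes>\<^sub>M \<mu>)"
      by measurable
    have fub: "integrable (M \<Otimes>\<^sub>M \<mu>) (\<lambda>(x, z). \<kappa> x * (exp (ip w z) * (phase z (v x) * g z)))"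
    proof (rule Fubini_integrable[OF meas])
      show "integrable M (\<lambda>x. LINT z|\<mu>. norm (case (x, z) of (x, z) \<Rightarrow> \<kappa> x * (exp (ip w z) * (phase z (v x) * g z))))"
        using \<kappa> by (simp add: norm_mult)
      show "AE x in M. integrable \<mu> (\<lambda>z. case (x, z) of (x, z) \<Rightarrow> \<kappa> x * (exp (ip w z) * (phase z (v x) * g z)))"
      proof (rule AE_I2)
        fix x
        have "(\<lambda>z. phase z (v x) * g z) \<in> L2"
          by (rule L2_dominated[of g _ 1]) (use gL2 in \<open>auto simp: norm_mult\<close>)
        then show "integrable \<mu> (\<lambda>z. case (x, z) of (x, z) \<Rightarrow> \<kappa> x * (exp (ip w z) * (phase z (v x) * g z)))"
          using L2_mult_integrable[OF exp_inner_L2] by simp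
      qed
    qed
    have "exp (ip w z) * (fourier M \<kappa> v z * g z) = (LINT x|M. \<kappa> x * (exp (ip w z) * (phase z (v x) * g z)))" for z
    proof -
      have "exp (ip w z) * (fourier M \<kappa> v z * g z) = (exp (ip w z) * g z) * (LINT x|M. \<kappa> x * phase z (v x))"
        by (simp add: fourier_def mult_ac)
      also have "\<dots> = (LINT x|M. exp (ip w z) * g z * (\<kappa> x * phase z (v x)))"
        by (rule integral_mult_right_zero[symmetric])
      finally show ?thesis by (simp only: mult_ac)
    qed
    then have "kproj (\<lambda>z. fourier M \<kappa> v z * g z) w = (LINT z|\<mu>. LINT x|M. \<kappa> x * (exp (ip w z) * (phase z (v x) * g z)))"
      by (simp only: kproj_def)
    also have "\<dots> = (LINT x|M. LINT z|\<mu>. \<kappa> x * (exp (ip w z) * (phase z (v x) * g z)))"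
      using Fubini_integral[OF fub] by simp
    also have "\<dots> = (LINT x|M. \<kappa> x * kproj (\<lambda>z. phase z (v x) * g z) w)"
      by (simp add: kproj_def)
    also have "\<dots> = (LINT x|M. \<kappa> x * of_real (exp (- q (v x) / 2)) * weyl (v x) g w)"
      by (simp add: kproj_phase[OF g] mult.assoc)
    finally show ?thesis .
  qed
  then show ?thesis
    by (subst toeplitz_eq[OF _ bound]) (auto simp: wop_def fun_eq_iff restrict_def)
qed

end

section \<open>Resolvents\<close>

text \<open>The one-sided exponential whose integral is \<open>1 / c\<close>; multiplying it by a
  character of the line shifts \<open>c\<close> by an imaginary number.\<close>

definition ekap :: "complex \<Rightarrow> real \<Rightarrow> complex" where
  "ekap c s = (if 0 < s then exp (- c * of_real s) else 0)"

abbreviation "rekap l \<equiv> ekap (complex_of_real l)"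

lemma ekap_measurable [measurable]: "ekap c \<in> borel_measurable borel"
  unfolding ekap_def by measurable

lemma norm_ekap: "cmod (ekap c s) = (if 0 < s then exp (- Re c * s) else 0)"
  by (simp add: ekap_def)

lemma integrable_ekap:
  assumes "0 < Re c"
  shows "integrable lborel (ekap c)"
proof (rule Bochner_Integration.integrable_bound)
  interpret prob_space "density lborel (exponential_density (Re c))"
    by (rule prob_space_exponential_density) fact
  have nn: "0 \<le> exponential_density (Re c) x" for x
    by (rule exponential_density_nonneg) fact
  have "(\<integral>\<^sup>+x. ennreal (exponential_density (Re c) x) \<partial>lborel) = 1"
    using emeasure_space_1 by (simp add: emeasure_density)
  then have "integrable lborel (exponential_density (Re c))"
    using nn by (intro integrableI_nonneg) auto
  then show "integrable lborel (\<lambda>x. exponential_density (Re c) x / Re c)"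
    by simp
  show "AE x in lborel. norm (ekap c x) \<le> norm (exponential_density (Re c) x / Re c)"
    using assms by (intro AE_I2) (auto simp: norm_ekap exponential_density_def mult.commute)
qed simp

lemma integral_ekap:
  assumes c: "0 < Re c"
  shows "(LINT s|lborel. ekap c s) = 1 / c"
proof -
  have c0: "c \<noteq> 0" using c by auto
  have ein: "einterval 0 \<infinity> = {0 <..}"
    by (auto simp: einterval_def zero_ereal_def)
  have "(LBINT s=0..\<infinity>. exp (- c * of_real s)) = 0 - (- 1 / c)"
  proof (rule interval_integral_FTC_integrable)
    show "((\<lambda>s. - exp (- c * of_real s) / c) has_vector_derivative exp (- c * of_real s)) (at s)" for s
    proof -
      have "((\<lambda>z. - exp (- c * z) / c) has_field_derivative exp (- c * of_real s)) (at (of_real s))"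
        using c0 by (auto intro!: derivative_eq_intros)
      from has_vector_derivative_real_field[OF this] show ?thesis by simp
    qed
    show "isCont (\<lambda>s. exp (- c * of_real s)) s" for s
      by (intro continuous_intros)
    show "set_integrable lborel (einterval 0 \<infinity>) (\<lambda>s. exp (- c * of_real s))"
      using integrable_ekap[OF c] unfolding set_integrable_def ein
      by (rule Bochner_Integration.integrable_cong[THEN iffD1, rotated 2]) (auto simp: ekap_def)
    have "((\<lambda>s. - exp (- c * of_real s) / c) \<longlongrightarrow> - exp (- c * of_real 0) / c) (at_right 0)"
      using c0 by (intro tendsto_intros)
    then show "(((\<lambda>s. - exp (- c * of_real s) / c) \<circ> real_of_ereal) \<longlongrightarrow> - 1 / c) (at_right 0)"
      by (simp add: ereal_tendsto_simps zero_ereal_def)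
    have "((\<lambda>s. exp (- Re c * s) / cmod c) \<longlongrightarrow> 0) at_top"
      using c c0 by real_asymp
    then have "((\<lambda>s. - exp (- c * of_real s) / c) \<longlongrightarrow> 0) at_top"
      by (subst tendsto_norm_zero_iff[symmetric]) (simp add: norm_divide)
    then show "(((\<lambda>s. - exp (- c * of_real s) / c) \<circ> real_of_ereal) \<longlongrightarrow> 0) (at_left \<infinity>)"
      by (simp add: ereal_tendsto_simps)
  qed simp
  also have "(LBINT s=0..\<infinity>. exp (- c * of_real s)) = (LINT s|lborel. ekap c s)"
    unfolding interval_lebesgue_integral_def set_lebesgue_integral_def ein
    by (simp, intro Bochner_Integration.integral_cong) (auto simp: ekap_def)
  finally show ?thesis by simp
qed

text \<open>The difference is minus the kernel up to \<open>s\<close> and nonnegative beyond. Its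
  integral vanishes by translation invariance, so its \<open>L1\<close> norm is twice the integral
  over \<open>{0..s}\<close> of the kernel, which is at most 1.\<close>

lemma ekap_shift_integral:
  assumes l: "0 < l" and s: "0 < s"
  shows "(LINT r|lborel. cmod (rekap l (r - s) - rekap l r)) \<le> 2 * s"
    and "integrable lborel (\<lambda>r. rekap l (r - s))"
proof -
  define k where "k r = (if 0 < r then exp (- l * r) else 0)" for r :: real
  have [measurable]: "k \<in> borel_measurable borel" unfolding k_def by measurable
  have ek: "rekap l r = of_real (k r)" for r
    by (simp add: ekap_def k_def exp_of_real[symmetric])
  have k: "integrable lborel k"
    using integrable_Re[OF integrable_ekap[of "of_real l"]] l unfolding ek by simp
  have k': "integrable lborel (\<lambda>r. k (r - s))" and eq: "(LINT r|lborel. k (r - s)) = (LINT r|lborel. k r)"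
    using lborel_integrable_real_affine[OF k, of 1 "- s"] lborel_integral_real_affine[of 1 k "- s"] by simp_all
  show "integrable lborel (\<lambda>r. rekap l (r - s))"
    using k' by (simp add: ek)
  have ki: "integrable lborel (\<lambda>r. indicator {0..s} r * k r)"
    using integrable_mult_indicator[OF _ k, of "{0..s}"] by simp
  have pt: "cmod (rekap l (r - s) - rekap l r) = (k (r - s) - k r) + 2 * (indicator {0..s} r * k r)" for r
  proof -
    have "k r \<le> k (r - s)" if "s < r"
      using that s l by (simp add: k_def)
    then show ?thesis
      unfolding ek of_real_diff[symmetric] norm_of_real using s l
      by (cases "r \<le> 0"; cases "r \<le> s") (auto simp: k_def indicator_def)
  qed
  have "(LINT r|lborel. cmod (rekap l (r - s) - rekap l r)) = 2 * (LINT r|lborel. indicator {0..s} r * k r)"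
    unfolding pt using k k' ki eq by simp
  also have "(LINT r|lborel. indicator {0..s} r * k r) \<le> (LINT r|lborel. indicator {0..s} r)"
  proof (rule integral_mono[OF ki])
    show "integrable lborel (indicat_real {0..s})"
      by (rule integrable_real_indicator) (use s in auto)
  qed (use l in \<open>auto simp: indicator_def k_def\<close>)
  also have "\<dots> = s" using s by simp
  finally show "(LINT r|lborel. cmod (rekap l (r - s) - rekap l r)) \<le> 2 * s" by simp
qed

context fock_space
begin

lemma phase_scaleR: "phase w (s *\<^sub>R z) = exp (\<i> * of_real (s * (2 * sigma_t t w z)))"
  by (simp add: phase_def sigma_t_def inner_t_simps mult_ac)

text \<open>The Laplace transform of the one-parameter group of Weyl operators along
  \<open>z\<close>. By \<open>res_equation\<close> it is, for real \<open>c > 0\<close>, a right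
  inverse of \<open>c - \<i> * toeplitz t (sym z)\<close>.\<close>

definition res :: "complex \<Rightarrow> complex ^ 'n \<Rightarrow> 'n fock_op" where
  "res c z = wop lborel (ekap c) (\<lambda>s. s *\<^sub>R z)"

abbreviation "rres l \<equiv> res (complex_of_real l)"

abbreviation line :: "complex ^ 'n \<Rightarrow> real \<Rightarrow> complex ^ 'n" where
  "line z \<equiv> \<lambda>s. s *\<^sub>R z"

lemma scaleR_line_measurable [measurable]: "(\<lambda>s::real. s *\<^sub>R z) \<in> borel_measurable lborel"
  for z :: "complex ^ 'n"
  by simp

lemma fourier_ekap:
  assumes "0 < Re c"
  shows "fourier lborel (ekap c) (line z) w = inverse (c - 2 * \<i> * of_real (sigma_t t w z))"
proof -
  have "ekap c s * phase w (s *\<^sub>R z) = ekap (c - 2 * \<i> * of_real (sigma_t t w z)) s" for s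
    by (simp add: ekap_def phase_scaleR exp_add[symmetric] algebra_simps)
  then show ?thesis
    unfolding fourier_def using assms by (simp add: integral_ekap divide_inverse)
qed

lemma res_Fock: "0 < Re c \<Longrightarrow> h \<in> Fock t \<Longrightarrow> res c z h \<in> Fock t"
  unfolding res_def by (intro wop_Fock sigma_finite_lborel integrable_ekap) auto

text \<open>The form vanishes on a real line, so the Weyl operators along it compose additively and
  one more of them merely translates the density.\<close>

lemma weyl_res:
  assumes l: "0 < l" and h: "h \<in> Fock t"
  shows "weyl (s *\<^sub>R z) (rres l z h) w = (LINT r|lborel. rekap l (r - s) * weyl (r *\<^sub>R z) h w)"
proof -
  have [simp]: "sigma_t t (s *\<^sub>R z) (r *\<^sub>R z) = 0" for r
    by (simp add: sigma_t_def inner_t_simps inner_t_self)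
  define e where "e = exp (ip w (s *\<^sub>R z) - of_real (q (s *\<^sub>R z) / 2))"
  have "weyl (s *\<^sub>R z) (rres l z h) w = e * (LINT r|lborel. rekap l r * weyl (r *\<^sub>R z) h (w - s *\<^sub>R z))"
    using h by (simp add: res_def wop_def weyl_def[of "s *\<^sub>R z"] e_def)
  also have "\<dots> = (LINT r|lborel. e * (rekap l r * weyl (r *\<^sub>R z) h (w - s *\<^sub>R z)))"
    by (rule integral_mult_right_zero[symmetric])
  also have "\<dots> = (LINT r|lborel. rekap l r * weyl (s *\<^sub>R z) (weyl (r *\<^sub>R z) h) w)"
    by (simp only: weyl_def[of "s *\<^sub>R z"] mult.left_commute[of e] e_def[symmetric])
  also have "\<dots> = (LINT r|lborel. rekap l r * weyl ((s + r) *\<^sub>R z) h w)"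
    by (simp add: weyl_weyl_commuting scaleR_add_left)
  also have "\<dots> = (LINT r|lborel. rekap l (r - s) * weyl (r *\<^sub>R z) h w)"
    using lborel_integral_real_affine[of 1 "\<lambda>r. rekap l (r - s) * weyl (r *\<^sub>R z) h w" s] by simp
  finally show ?thesis .
qed

lemma nrm_weyl_res_diff:
  assumes l: "0 < l" and h: "h \<in> Fock t" and s: "0 < s"
  shows "nrm (\<lambda>w. weyl (s *\<^sub>R z) (rres l z h) w - rres l z h w) \<le> 2 * s * nrm h"
proof -
  have i: "integrable lborel (rekap l)" "integrable lborel (\<lambda>r. rekap l (r - s))"
    using ekap_shift_integral(2)[OF l s] l by (auto intro: integrable_ekap)
  have "(\<lambda>w. weyl (s *\<^sub>R z) (rres l z h) w - rres l z h w) =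
     wop lborel (\<lambda>r. rekap l (r - s) - rekap l r) (line z) h"
  proof
    fix w
    show "weyl (s *\<^sub>R z) (rres l z h) w - rres l z h w =
     wop lborel (\<lambda>r. rekap l (r - s) - rekap l r) (line z) h w"
      using h Bochner_Integration.integral_diff[OF wop_integrable[OF i(2) scaleR_line_measurable h] wop_integrable[OF i(1) scaleR_line_measurable h]]
      by (simp add: weyl_res[OF l h]) (simp add: res_def wop_def left_diff_distrib)
  qed
  then have "nrm (\<lambda>w. weyl (s *\<^sub>R z) (rres l z h) w - rres l z h w) \<le>
      (LINT r|lborel. cmod (rekap l (r - s) - rekap l r)) * nrm h"
    using nrm_wop_le[OF sigma_finite_lborel _ scaleR_line_measurable h, of "\<lambda>r. rekap l (r - s) - rekap l r"] i
    by simp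
  also have "\<dots> \<le> 2 * s * nrm h"
    by (intro mult_right_mono ekap_shift_integral l s nrm_nonneg)
  finally show ?thesis .
qed

lemma continuous_on_weyl_line:
  assumes h: "h \<in> Fock t"
  shows "continuous_on S (\<lambda>r::real. weyl (r *\<^sub>R z) h w)"
proof -
  have "continuous_on S (\<lambda>r::real. h (w - r *\<^sub>R z))"
    by (rule continuous_on_compose2[OF entire_continuous[of h]]) (use h in \<open>auto simp: Fock_iff intro!: continuous_intros\<close>)
  then show ?thesis
    unfolding weyl_def quad_scaleR inner_t_simps by (intro continuous_intros) auto
qed

text \<open>With \<open>F\<close> the integrand of the resolvent, the orbit at \<open>s\<close> is
  \<open>exp (l s)\<close> times the integral of \<open>F\<close> from \<open>s\<close> on. This is
  differentiable at 0, by the fundamental theorem and the product rule.\<close>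

lemma weyl_res_deriv:
  assumes l: "0 < l" and h: "h \<in> Fock t"
  shows "((\<lambda>s. (weyl (s *\<^sub>R z) (rres l z h) w - rres l z h w) / of_real s)
     \<longlongrightarrow> of_real l * rres l z h w - h w) (at_right 0)"
proof -
  define F where "F r = exp (- of_real l * of_real r) * weyl (r *\<^sub>R z) h w" for r :: real
  define g where "g = rres l z h w"
  have contF: "continuous_on S F" for S
    unfolding F_def by (intro continuous_intros continuous_on_weyl_line h)
  have ek: "rekap l r * weyl (r *\<^sub>R z) h w = indicator {0<..} r *\<^sub>R F r" for r
    by (simp add: ekap_def F_def)
  have Fint: "set_integrable lborel {0<..} F"
    unfolding set_integrable_def ek[symmetric]
    by (rule wop_integrable[OF integrable_ekap scaleR_line_measurable h]) (use l in simp)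
  have gF: "g = (LINT r:{0<..}|lborel. F r)"
    using h by (simp add: g_def res_def wop_def set_lebesgue_integral_def ek)
  have W: "weyl (s *\<^sub>R z) (rres l z h) w = exp (of_real l * of_real s) * (g - integral {0..s} F)"
    if s: "0 < s" for s
  proof -
    have "rekap l (r - s) * weyl (r *\<^sub>R z) h w = exp (of_real l * of_real s) * (indicator {s<..} r *\<^sub>R F r)" for r
      by (simp add: ekap_def F_def indicator_def exp_add[symmetric] mult.assoc[symmetric] algebra_simps)
    then have "weyl (s *\<^sub>R z) (rres l z h) w = exp (of_real l * of_real s) * (LINT r:{s<..}|lborel. F r)"
      unfolding weyl_res[OF l h] set_lebesgue_integral_def by (simp only: integral_mult_right_zero)
    moreover have "(LINT r:{0<..}|lborel. F r) = (LINT r:{0<..s}|lborel. F r) + (LINT r:{s<..}|lborel. F r)"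
    proof -
      have "{0<..} = {0<..s} \<union> {s<..}" and "{0<..s} \<inter> {s<..} = {}" using s by auto
      moreover have "set_integrable lborel {0<..s} F" "set_integrable lborel {s<..} F"
        by (rule set_integrable_subset[OF Fint]; use s in auto)+
      ultimately show ?thesis
        by (simp only: set_integral_Un)
    qed
    moreover have "(LINT r:{0<..s}|lborel. F r) = integral {0..s} F"
    proof -
      have "set_integrable lborel {0<..s} F"
        using Fint by (rule set_integrable_subset) auto
      then have "(LINT r:{0<..s}|lborel. F r) = integral {0<..s} F"
        by (rule set_borel_integral_eq_integral(2))
      also have "\<dots> = integral {0..s} F"
        by (rule integral_spike_set) (auto intro: negligible_subset[of "{0}"])
      finally show ?thesis .
    qed
    ultimately show ?thesis by (simp add: gF)
  qed
  have "((\<lambda>s. integral {0..s} F) has_vector_derivative F 0) (at 0 within {0..1})"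
    by (rule integral_has_vector_derivative[OF contF]) simp
  then have "((\<lambda>y. (1 / norm (y - 0)) *\<^sub>R (integral {0..y} F - (integral {0..0} F + (y - 0) *\<^sub>R F 0))) \<longlongrightarrow> 0) (at_right 0)"
    unfolding has_vector_derivative_def has_derivative_within by (simp add: at_within_Icc_at_right)
  moreover have "eventually (\<lambda>y. (1 / norm (y - 0)) *\<^sub>R (integral {0..y} F - (integral {0..0} F + (y - 0) *\<^sub>R F 0)) =
      integral {0..y} F / of_real y - F 0) (at_right 0)"
    using eventually_at_right_less[of "0::real"]
    by eventually_elim (simp add: scaleR_conv_of_real field_simps)
  ultimately have "((\<lambda>y. integral {0..y} F / of_real y - F 0) \<longlongrightarrow> 0) (at_right 0)"
    by (rule Lim_transform_eventually)
  then have I: "((\<lambda>s. integral {0..s} F / of_real s) \<longlongrightarrow> F 0) (at_right 0)"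
    by (rule LIM_zero_cancel)
  have "((\<lambda>s. (exp (l * s) - 1) / s) \<longlongrightarrow> l) (at_right 0)"
    by real_asymp
  from tendsto_of_real[OF this, where 'a = complex]
  have E: "((\<lambda>s. (exp (of_real l * of_real s) - 1) / of_real s :: complex) \<longlongrightarrow> of_real l) (at_right 0)"
    by (simp add: exp_of_real[symmetric])
  have "((\<lambda>s. exp (of_real l * of_real s)) \<longlongrightarrow> (exp (of_real l * of_real 0) :: complex)) (at_right 0)"
    by (intro tendsto_intros)
  then have "((\<lambda>s. (exp (of_real l * of_real s) - 1) / of_real s * g - exp (of_real l * of_real s) * (integral {0..s} F / of_real s))
     \<longlongrightarrow> of_real l * g - 1 * F 0) (at_right 0)"
    by (intro tendsto_intros E I) simp
  moreover have "F 0 = h w" by (simp add: F_def weyl_def inner_t_simps quad_def)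
  moreover have "eventually (\<lambda>s. (exp (of_real l * of_real s) - 1) / of_real s * g - exp (of_real l * of_real s) * (integral {0..s} F / of_real s) =
     (weyl (s *\<^sub>R z) (rres l z h) w - rres l z h w) / of_real s) (at_right 0)"
    using eventually_at_right_less[of "0::real"]
    by eventually_elim (simp add: W g_def[symmetric] field_simps)
  ultimately show ?thesis
    by (simp add: g_def[symmetric] tendsto_cong)
qed

text \<open>Compares multiplication by a phase, which can leave the Fock space, with the Weyl
  operator, which does not. Expanding the square, \<open>kproj_phase\<close> turns the cross term
  into \<open>exp (- q v / 2)\<close> times the one for \<open>weyl v g\<close>; the rest is
  \<open>2 (1 - exp (- q v / 2)) \<le> q v\<close>.\<close>

lemma phase_minus_one_norm:
  assumes g: "g \<in> Fock t"
  shows "(LINT w|\<mu>. (cmod ((phase w v - 1) * g w))\<^sup>2) \<le> q v * (nrm g)\<^sup>2 + (nrm (\<lambda>w. weyl v g w - g w))\<^sup>2"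
    and "integrable \<mu> (\<lambda>w. (cmod ((phase w v - 1) * g w))\<^sup>2)"
proof -
  have gL: "g \<in> L2" and [measurable]: "g \<in> borel_measurable borel" using g by (auto simp: Fock_iff L2_iff)
  have pL: "(\<lambda>w. phase w v * g w) \<in> L2"
    by (rule L2_dominated[of g _ 1]) (use gL in \<open>auto simp: norm_mult\<close>)
  have WL: "weyl v g \<in> L2" using gL by (rule weyl_L2)
  have abs2: "(cmod (a - b))\<^sup>2 = (cmod a)\<^sup>2 + (cmod b)\<^sup>2 - 2 * Re (a * cnj b)" for a b
    unfolding cmod_power2 by (simp add: power2_eq_square algebra_simps)
  have expand: "(nrm (\<lambda>w. f w - g w))\<^sup>2 = (nrm f)\<^sup>2 + (nrm g)\<^sup>2 - 2 * Re (L2_inner t f g)" if f: "f \<in> L2" for f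
  proof -
    define R where "R = (\<lambda>w. Re (f w * cnj (g w)))"
    have fg: "integrable \<mu> (\<lambda>w. f w * cnj (g w))"
      by (rule L2_mult_integrable[OF f L2_cnj[OF gL]])
    have "integrable \<mu> R" "Re (L2_inner t f g) = (LINT w|\<mu>. R w)"
      using integrable_Re[OF fg] integral_Re[OF fg] by (simp_all only: R_def L2_inner_def)
    then show ?thesis
      unfolding nrm_power2 abs2 R_def[symmetric, THEN fun_cong] using f gL by (simp add: L2_iff)
  qed
  have dL: "(\<lambda>w. phase w v * g w - g w) \<in> L2" by (rule L2_diff[OF pL gL])
  then show "integrable \<mu> (\<lambda>w. (cmod ((phase w v - 1) * g w))\<^sup>2)"
    by (simp add: L2_iff left_diff_distrib)
  have np: "nrm (\<lambda>w. phase w v * g w) = nrm g"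
    by (simp add: L2_norm_def norm_mult)
  have "L2_inner t (\<lambda>w. phase w v * g w) g = L2_inner t (\<lambda>w. phase w v * g w) (kproj g)"
    by (simp add: kproj_Fock[OF g])
  also have "\<dots> = L2_inner t (kproj (\<lambda>w. phase w v * g w)) g"
    by (rule kproj_adjoint[OF pL gL, symmetric])
  also have "kproj (\<lambda>w. phase w v * g w) = (\<lambda>w. of_real (exp (- q v / 2)) * weyl v g w)"
    using kproj_phase[OF g] by (rule ext)
  also have "L2_inner t \<dots> g = of_real (exp (- q v / 2)) * L2_inner t (weyl v g) g"
    unfolding L2_inner_def by (simp only: mult.assoc integral_mult_right_zero)
  finally have inner: "Re (L2_inner t (\<lambda>w. phase w v * g w) g) = exp (- q v / 2) * Re (L2_inner t (weyl v g) g)"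
    by simp
  define X where "X = (nrm (\<lambda>w. weyl v g w - g w))\<^sup>2"
  have X: "X = 2 * (nrm g)\<^sup>2 - 2 * Re (L2_inner t (weyl v g) g)"
    using expand[OF WL] by (simp add: X_def nrm_weyl[OF gL])
  have "(LINT w|\<mu>. (cmod ((phase w v - 1) * g w))\<^sup>2) = (nrm (\<lambda>w. phase w v * g w - g w))\<^sup>2"
    by (simp add: nrm_power2 left_diff_distrib)
  also have "\<dots> = 2 * (nrm g)\<^sup>2 - exp (- q v / 2) * (2 * Re (L2_inner t (weyl v g) g))"
    by (simp add: expand[OF pL] np inner)
  also have "\<dots> = 2 * (1 - exp (- q v / 2)) * (nrm g)\<^sup>2 + exp (- q v / 2) * X"
    by (simp add: X algebra_simps)
  also have "\<dots> \<le> q v * (nrm g)\<^sup>2 + 1 * X"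
  proof (intro add_mono mult_right_mono)
    show "2 * (1 - exp (- q v / 2)) \<le> q v"
      using exp_ge_add_one_self[of "- q v / 2"] by simp
    show "exp (- q v / 2) \<le> 1" using quad_nonneg[of v] by simp
  qed (auto simp: X_def)
  finally show "(LINT w|\<mu>. (cmod ((phase w v - 1) * g w))\<^sup>2) \<le> q v * (nrm g)\<^sup>2 + (nrm (\<lambda>w. weyl v g w - g w))\<^sup>2"
    by (simp add: X_def)
qed

definition sym :: "complex ^ 'n \<Rightarrow> complex ^ 'n \<Rightarrow> complex" where
  "sym z = (\<lambda>w. complex_of_real (2 * sigma_t t w z))"

lemma sym_measurable [measurable]: "sym z \<in> borel_measurable borel"
  unfolding sym_def sigma_t_def by measurable

abbreviation "pquot z s w \<equiv> (phase w (s *\<^sub>R z) - 1) / complex_of_real s"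

lemma phase_quotient_le: "0 < s \<Longrightarrow> cmod ((phase w (s *\<^sub>R z) - 1) / of_real s) \<le> cmod (sym z w)"
proof -
  assume s: "0 < s"
  have "cmod (exp (\<i> * of_real x) - 1) \<le> \<bar>x\<bar>" for x :: real
    using abs_sin_x_le_abs_x[of "x / 2"] by (simp add: dist_exp_i_1)
  from this[of "s * (2 * sigma_t t w z)"] s show ?thesis
    by (simp add: phase_scaleR sym_def norm_divide field_simps abs_mult)
qed

lemma phase_quotient_tendsto:
  "((\<lambda>s. (phase w (s *\<^sub>R z) - 1) / of_real s) \<longlongrightarrow> \<i> * sym z w) (at_right 0)"
proof -
  have "((\<lambda>s. exp (\<i> * s * sym z w)) has_field_derivative \<i> * sym z w) (at 0)"
    by (auto intro!: derivative_eq_intros)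
  then have "((\<lambda>s. (exp (\<i> * s * sym z w) - 1) / s) \<longlongrightarrow> \<i> * sym z w) (at 0)"
    by (simp add: has_field_derivative_iff)
  moreover have "filterlim (\<lambda>s::real. of_real s) (at (0::complex)) (at_right 0)"
    unfolding filterlim_at
    by (auto intro!: tendsto_eq_intros eventually_mono[OF eventually_at_right_less])
  ultimately have "((\<lambda>s. (exp (\<i> * of_real s * sym z w) - 1) / of_real s) \<longlongrightarrow> \<i> * sym z w) (at_right (0::real))"
    by (rule filterlim_compose)
  then show ?thesis
    by (simp add: phase_scaleR sym_def mult_ac)
qed

lemma inverse_Suc_at_right: "filterlim (\<lambda>n. inverse (real (Suc n))) (at_right 0) sequentially"
  unfolding filterlim_at
  using LIMSEQ_inverse_real_of_nat by (auto intro!: always_eventually)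

text \<open>With \<open>g = res l z h\<close>, Fatou's lemma bounds \<open>sym z * g\<close> in \<open>L2\<close> by the difference quotients
  \<open>(phase w (s z) - 1) / s * g\<close>, whose norms are controlled by \<open>\<parallel>weyl (s z) g - g\<parallel> \<le> 2 s \<parallel>h\<parallel>\<close>.\<close>

lemma res_in_dom:
  assumes l: "0 < l" and h: "h \<in> Fock t"
  shows "rres l z h \<in> toeplitz_dom t (sym z)"
proof -
  define g where "g = rres l z h"
  have g: "g \<in> Fock t" unfolding g_def by (rule res_Fock[OF _ h]) (use l in simp)
  note [measurable] = Fock_measurable[OF g]
  define s where "s n = inverse (real (Suc n))" for n
  have s: "0 < s n" for n by (simp add: s_def)
  define F where "F n w = ennreal ((cmod (pquot z (s n) w * g w))\<^sup>2)" for n w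
  have [measurable]: "F n \<in> borel_measurable borel" for n
    unfolding F_def by measurable
  \<comment> \<open>\<open>q\<close> is quadratic and the Weyl difference is at most
    \<open>2 * s n * nrm h\<close>, so both terms of \<open>phase_minus_one_norm\<close> scale like
    \<open>(s n)\<^sup>2\<close>; division leaves a bound independent of \<open>n\<close>.\<close>
  define C where "C = q z * (nrm g)\<^sup>2 + (2 * nrm h)\<^sup>2"
  have "(\<integral>\<^sup>+w. F n w \<partial>\<mu>) \<le> ennreal C" for n
  proof -
    note b = phase_minus_one_norm[OF g, of "s n *\<^sub>R z"]
    have eq: "(cmod (pquot z (s n) w * g w))\<^sup>2 =
       (cmod ((phase w (s n *\<^sub>R z) - 1) * g w))\<^sup>2 / (s n)\<^sup>2" for w
      by (simp add: norm_mult norm_divide power_mult_distrib power_divide)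
    have "(nrm (\<lambda>w. weyl (s n *\<^sub>R z) g w - g w))\<^sup>2 \<le> (2 * s n * nrm h)\<^sup>2"
      using nrm_weyl_res_diff[OF l h s] unfolding g_def by (rule power_mono) (rule nrm_nonneg)
    then have "(LINT w|\<mu>. (cmod ((phase w (s n *\<^sub>R z) - 1) * g w))\<^sup>2) \<le> C * (s n)\<^sup>2"
      using b(1) by (simp add: C_def quad_scaleR power_mult_distrib algebra_simps)
    then have "(LINT w|\<mu>. (cmod (pquot z (s n) w * g w))\<^sup>2) \<le> C"
      unfolding eq using s[of n] by (simp add: field_simps)
    moreover have "(\<integral>\<^sup>+w. F n w \<partial>\<mu>) = ennreal (LINT w|\<mu>. (cmod (pquot z (s n) w * g w))\<^sup>2)"
      unfolding F_def eq using b(2) by (intro nn_integral_eq_integral) auto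
    ultimately show ?thesis by (simp add: ennreal_leI)
  qed
  then have bound: "liminf (\<lambda>n. \<integral>\<^sup>+w. F n w \<partial>\<mu>) \<le> ennreal C"
    by (intro order_trans[OF Liminf_le_Limsup] Limsup_bounded) (auto intro!: always_eventually)
  have lim: "(\<lambda>n. F n w) \<longlonglongrightarrow> ennreal ((cmod (sym z w * g w))\<^sup>2)" for w
  proof -
    have "(\<lambda>n. pquot z (s n) w) \<longlonglongrightarrow> \<i> * sym z w"
      unfolding s_def by (rule filterlim_compose[OF phase_quotient_tendsto inverse_Suc_at_right])
    from tendsto_mult[OF this tendsto_const[of "g w"]]
    have "(\<lambda>n. F n w) \<longlonglongrightarrow> ennreal ((cmod (\<i> * sym z w * g w))\<^sup>2)"
      unfolding F_def by (intro tendsto_ennrealI tendsto_power tendsto_norm)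
    then show ?thesis by (simp add: norm_mult)
  qed
  have "(\<integral>\<^sup>+w. ennreal ((cmod (sym z w * g w))\<^sup>2) \<partial>\<mu>) = (\<integral>\<^sup>+w. liminf (\<lambda>n. F n w) \<partial>\<mu>)"
    by (intro nn_integral_cong lim_imp_Liminf[OF _ lim, symmetric]) simp
  also have "\<dots> \<le> liminf (\<lambda>n. \<integral>\<^sup>+w. F n w \<partial>\<mu>)"
    by (rule nn_integral_liminf) measurable
  also note bound
  finally have "integrable \<mu> (\<lambda>w. (cmod (sym z w * g w))\<^sup>2)"
    by (intro integrableI_bounded) (auto simp: order_le_less_trans)
  then show ?thesis
    using g unfolding toeplitz_dom_def g_def[symmetric] by (simp add: L2_iff)
qed

text \<open>The limit of \<open>kproj\<close> on the quotients \<open>(phase - 1) / s * g\<close> is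
  computed twice. Dominated convergence, with a majorant built from
  \<open>sym z * g \<in> L2\<close> (known from \<open>res_in_dom\<close>), gives the Toeplitz term;
  \<open>kproj_phase\<close> turns the quotients into Weyl quotients, whose limit is
  \<open>weyl_res_deriv\<close>.\<close>

lemma res_equation:
  assumes l: "0 < l" and h: "h \<in> Fock t"
  shows "of_real l * rres l z h w - \<i> * kproj (\<lambda>w. sym z w * rres l z h w) w = h w"
proof -
  define g where "g = rres l z h"
  have g: "g \<in> Fock t" unfolding g_def by (rule res_Fock[OF _ h]) (use l in simp)
  have gL: "g \<in> L2" and [measurable]: "g \<in> borel_measurable borel" using g by (auto simp: Fock_iff L2_iff)
  have sg: "(\<lambda>w. sym z w * g w) \<in> L2"
    using res_in_dom[OF l h] by (simp add: toeplitz_dom_def g_def)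
  have pL: "(\<lambda>w. phase w v * g w) \<in> L2" for v
    by (rule L2_dominated[of g _ 1]) (use gL in \<open>auto simp: norm_mult\<close>)
  define s where "s n = inverse (real (Suc n))" for n
  have s: "0 < s n" for n by (simp add: s_def)
  have "(\<lambda>n. LINT x|\<mu>. exp (ip w x) * (pquot z (s n) x * g x)) \<longlonglongrightarrow>
     (LINT x|\<mu>. exp (ip w x) * (\<i> * sym z x * g x))"
  proof (rule integral_dominated_convergence[where w = "\<lambda>x. cmod (exp (ip w x)) * cmod (sym z x * g x)"])
    show "AE x in \<mu>. (\<lambda>n. exp (ip w x) * (pquot z (s n) x * g x)) \<longlonglongrightarrow> exp (ip w x) * (\<i> * sym z x * g x)"
      unfolding s_def by (intro AE_I2 tendsto_intros filterlim_compose[OF phase_quotient_tendsto inverse_Suc_at_right])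
    show "integrable \<mu> (\<lambda>x. cmod (exp (ip w x)) * cmod (sym z x * g x))"
      by (intro L2_mult_norm_integrable exp_inner_L2 sg)
    show "AE x in \<mu>. norm (exp (ip w x) * (pquot z (s n) x * g x)) \<le> cmod (exp (ip w x)) * cmod (sym z x * g x)" for n
      unfolding norm_mult by (intro AE_I2 mult_left_mono mult_right_mono phase_quotient_le s) auto
  qed measurable
  moreover have e1: "(LINT x|\<mu>. exp (ip w x) * (\<i> * sym z x * g x)) = \<i> * kproj (\<lambda>w. sym z w * g w) w"
    by (simp add: kproj_def mult.left_commute[of _ \<i>] mult.assoc)
  moreover have e2: "(LINT x|\<mu>. exp (ip w x) * (pquot z (s n) x * g x)) =
      (of_real (exp (- q (s n *\<^sub>R z) / 2)) * weyl (s n *\<^sub>R z) g w - g w) / of_real (s n)" for n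
  proof -
    have "of_real (exp (- q (s n *\<^sub>R z) / 2)) * weyl (s n *\<^sub>R z) g w - g w = kproj (\<lambda>x. phase x (s n *\<^sub>R z) * g x) w - kproj g w"
      by (simp add: kproj_phase[OF g] kproj_Fock[OF g])
    also have "\<dots> = (LINT x|\<mu>. exp (ip w x) * (phase x (s n *\<^sub>R z) * g x) - exp (ip w x) * g x)"
      unfolding kproj_def by (intro Bochner_Integration.integral_diff[symmetric] L2_mult_integrable exp_inner_L2 pL gL)
    finally show ?thesis
      by (simp add: left_diff_distrib right_diff_distrib diff_divide_distrib flip: integral_divide_zero)
  qed
  ultimately have "(\<lambda>n. (of_real (exp (- q (s n *\<^sub>R z) / 2)) * weyl (s n *\<^sub>R z) g w - g w) / of_real (s n)) \<longlonglongrightarrow>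
      \<i> * kproj (\<lambda>w. sym z w * g w) w" by (simp only: e1 e2)
  moreover have "(\<lambda>n. (of_real (exp (- q (s n *\<^sub>R z) / 2)) * weyl (s n *\<^sub>R z) g w - g w) / of_real (s n)) \<longlonglongrightarrow>
      of_real l * g w - h w"
  proof -
    define a where "a = q z"
    \<comment> \<open>The Gaussian factor is 1 up to second order in \<open>s\<close>, so it does
      not contribute to the derivative.\<close>
    have "((\<lambda>s::real. (exp (- (s\<^sup>2 * a) / 2) - 1) / s) \<longlongrightarrow> 0) (at_right 0)"
      by real_asymp
    from tendsto_of_real[OF this, where 'a = complex]
    have E: "((\<lambda>s. (of_real (exp (- (s\<^sup>2 * a) / 2)) - 1) / of_real s :: complex) \<longlongrightarrow> 0) (at_right 0)"
      by simp
    have "((\<lambda>s. of_real (exp (- (s\<^sup>2 * a) / 2)) :: complex) \<longlongrightarrow> of_real (exp (- (0\<^sup>2 * a) / 2))) (at_right 0)"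
      by (intro tendsto_intros) simp
    then have "((\<lambda>s. of_real (exp (- (s\<^sup>2 * a) / 2)) * ((weyl (s *\<^sub>R z) g w - g w) / of_real s) + (of_real (exp (- (s\<^sup>2 * a) / 2)) - 1) / of_real s * g w)
       \<longlongrightarrow> 1 * (of_real l * g w - h w) + 0 * g w) (at_right 0)"
      unfolding g_def by (intro tendsto_intros E weyl_res_deriv l h) simp
    then have "((\<lambda>s. (of_real (exp (- q (s *\<^sub>R z) / 2)) * weyl (s *\<^sub>R z) g w - g w) / of_real s) \<longlongrightarrow> of_real l * g w - h w) (at_right 0)"
      by (simp add: quad_scaleR a_def diff_divide_distrib algebra_simps)
    then show ?thesis
      unfolding s_def by (rule filterlim_compose[OF _ inverse_Suc_at_right])
  qed
  ultimately have "\<i> * kproj (\<lambda>w. sym z w * g w) w = of_real l * g w - h w"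
    by (rule LIMSEQ_unique)
  then show ?thesis by (simp add: g_def)
qed

section \<open>Uniqueness and identification of the resolvent\<close>

lemma toeplitz_on_dom: "g \<in> toeplitz_dom t \<phi> \<Longrightarrow> toeplitz t \<phi> g = kproj (\<lambda>z. \<phi> z * g z)"
  by (simp add: toeplitz_def toeplitz_dom_def Fock_proj_eq)

lemma toeplitz_dom_diff:
  "g \<in> toeplitz_dom t \<phi> \<Longrightarrow> g' \<in> toeplitz_dom t \<phi> \<Longrightarrow> (\<lambda>z. g z - g' z) \<in> toeplitz_dom t \<phi>"
  by (auto simp: toeplitz_dom_def Fock_diff right_diff_distrib L2_diff)

text \<open>A real symbol gives a symmetric operator, so a nonreal eigenvalue forces
  \<open>nrm g = 0\<close>; bounded point evaluation upgrades this to vanishing everywhere.\<close>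

lemma toeplitz_real_eigenvalue:
  assumes g: "g \<in> toeplitz_dom t (sym z)" and eq: "\<And>w. c * g w = toeplitz t (sym z) g w" and c: "Im c \<noteq> 0"
  shows "g w = 0"
proof -
  have gF: "g \<in> Fock t" and gL: "g \<in> L2" and sg: "(\<lambda>w. sym z w * g w) \<in> L2"
    using g by (auto simp: toeplitz_dom_def Fock_iff)
  have "c * of_real ((nrm g)\<^sup>2) = L2_inner t (\<lambda>w. c * g w) g"
  proof -
    have "L2_inner t (\<lambda>w. c * g w) g = c * L2_inner t g g"
      by (simp add: L2_inner_def mult.assoc)
    then show ?thesis by (simp add: L2_inner_self)
  qed
  also have "\<dots> = L2_inner t (kproj (\<lambda>w. sym z w * g w)) g"
    using eq by (simp add: toeplitz_on_dom[OF g])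
  also have "\<dots> = L2_inner t (\<lambda>w. sym z w * g w) g"
    using kproj_adjoint[OF sg gL] by (simp add: kproj_Fock[OF gF])
  also have "\<dots> = of_real (LINT w|\<mu>. 2 * sigma_t t w z * (cmod (g w))\<^sup>2)"
    unfolding L2_inner_def sym_def
    by (simp add: mult.assoc complex_norm_square[symmetric] flip: integral_complex_of_real)
  finally have "Im (c * of_real ((nrm g)\<^sup>2)) = 0" by simp
  then have "nrm g = 0" using c by simp
  then show ?thesis
    using Fock_eval_le[OF gL, of w] by (simp add: kproj_Fock[OF gF])
qed

text \<open>Write \<open>A\<close> for the Toeplitz operator of \<open>sym z\<close>. Reversing
  \<open>z\<close> according to \<open>sgn r\<close> reverses its symbol, so
  \<open>res_equation\<close> reads \<open>(\<bar>r\<bar> + \<i> sgn r A) G = h\<close>, which is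
  \<open>(\<i> r - A) y = h\<close> for \<open>y = - \<i> sgn r G\<close>. For
  \<open>the_inv_into\<close>, injectivity on the domain completes the identification.\<close>

lemma toeplitz_resolvent_eq:
  assumes r: "r \<noteq> 0"
  shows "toeplitz_resolvent t (\<i> * of_real r) (sym z) =
    scale_op (Fock_cstar t) (- \<i> * of_real (sgn r)) (res (of_real \<bar>r\<bar>) (- sgn r *\<^sub>R z))"
proof
  fix h
  show "toeplitz_resolvent t (\<i> * of_real r) (sym z) h =
    scale_op (Fock_cstar t) (- \<i> * of_real (sgn r)) (res (of_real \<bar>r\<bar>) (- sgn r *\<^sub>R z)) h"
  proof (cases "h \<in> Fock t")
    case False
    then show ?thesis by (simp add: toeplitz_resolvent_def Fock_cstar_def)
  next
    case h: True
    let ?z = "- sgn r *\<^sub>R z" and ?G = "res (of_real \<bar>r\<bar>) (- sgn r *\<^sub>R z) h"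
    define y where "y = (\<lambda>w. - \<i> * of_real (sgn r) * ?G w)"
    have sgn: "sgn r * sgn r = 1" using r by (simp add: sgn_if)
    have symz: "sym ?z w = - of_real (sgn r) * sym z w" for w
      by (simp add: sym_def sigma_t_def inner_t_simps)
    have symz': "sym z w * y w = \<i> * (sym ?z w * ?G w)" for w
      unfolding symz by (simp add: y_def)
    have G: "?G \<in> toeplitz_dom t (sym ?z)"
      by (rule res_in_dom) (use r h in auto)
    have "y \<in> Fock t"
      unfolding y_def using G by (intro Fock_scale) (simp add: toeplitz_dom_def)
    moreover have "(\<lambda>w. sym z w * y w) \<in> L2"
      unfolding symz' using G by (intro L2_scale) (simp add: toeplitz_dom_def)
    ultimately have y: "y \<in> toeplitz_dom t (sym z)"
      by (simp add: toeplitz_dom_def)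
    let ?A = "\<lambda>g w. \<i> * of_real r * g w - toeplitz t (sym z) g w"
    have Ay: "?A y = h"
    proof
      fix w
      have "?A y w = \<i> * of_real r * y w - \<i> * kproj (\<lambda>w. sym ?z w * ?G w) w"
        by (simp only: toeplitz_on_dom[OF y] symz' kproj_scale)
      also have "\<dots> = of_real \<bar>r\<bar> * ?G w - \<i> * kproj (\<lambda>w. sym ?z w * ?G w) w"
        by (simp add: y_def abs_sgn[of r] mult_ac)
      also have "\<dots> = h w"
        by (rule res_equation) (use r h in auto)
      finally show "?A y w = h w" .
    qed
    have "inj_on ?A (toeplitz_dom t (sym z))"
    proof (rule inj_onI)
      fix g g' assume g: "g \<in> toeplitz_dom t (sym z)" "g' \<in> toeplitz_dom t (sym z)" and eq: "?A g = ?A g'"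
      have d: "(\<lambda>w. g w - g' w) \<in> toeplitz_dom t (sym z)" by (rule toeplitz_dom_diff) fact+
      have lin: "toeplitz t (sym z) (\<lambda>w. g w - g' w) w = toeplitz t (sym z) g w - toeplitz t (sym z) g' w" for w
        using g kproj_add[of "\<lambda>w. sym z w * g w" "\<lambda>w. - 1 * (sym z w * g' w)" w] kproj_scale[of "- 1" "\<lambda>w. sym z w * g' w" w]
          L2_scale[of "\<lambda>w. sym z w * g' w" "- 1"]
        unfolding toeplitz_on_dom[OF d] toeplitz_on_dom[OF g(1)] toeplitz_on_dom[OF g(2)]
        by (simp add: toeplitz_dom_def right_diff_distrib)
      have "\<i> * of_real r * (g w - g' w) = toeplitz t (sym z) (\<lambda>w. g w - g' w) w" for w
      proof -
        have "\<i> * of_real r * g w - \<i> * of_real r * g' w = toeplitz t (sym z) g w - toeplitz t (sym z) g' w"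
          using fun_cong[OF eq, of w] by (simp add: algebra_simps)
        then show ?thesis
          by (simp only: lin right_diff_distrib)
      qed
      from toeplitz_real_eigenvalue[OF d this] show "g = g'"
        using r by (simp add: fun_eq_iff)
    qed
    from the_inv_into_f_f[OF this y] have "the_inv_into (toeplitz_dom t (sym z)) ?A h = y"
      by (simp only: Ay)
    then show ?thesis
      using h by (simp add: toeplitz_resolvent_def Fock_cstar_def y_def)
  qed
qed

end

section \<open>Closed subalgebras containing Weyl integrals\<close>

lemma power_div_fact_le_exp:
  fixes x :: real
  assumes "0 \<le> x"
  shows "x ^ k / fact k \<le> exp x"
proof -
  have "(\<Sum>n\<in>{k}. x ^ n / fact n) \<le> (\<Sum>n. x ^ n / fact n)"
    using assms summable_exp_generic[of x] by (intro sum_le_suminf) (auto simp: divide_inverse mult.commute)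
  then show ?thesis
    by (simp add: exp_def divide_inverse mult.commute)
qed

lemma norm_exp_partial_sum_le:
  fixes b :: complex
  shows "cmod (\<Sum>k<n. b ^ k / fact k) \<le> exp (cmod b)"
proof -
  have "cmod (\<Sum>k<n. b ^ k / fact k) \<le> (\<Sum>k<n. cmod b ^ k / fact k)"
    by (rule sum_norm_le) (simp add: norm_divide norm_power)
  also have "\<dots> \<le> (\<Sum>k. cmod b ^ k / fact k)"
    using summable_exp_generic[of "cmod b"] by (intro sum_le_suminf) (auto simp: divide_inverse mult.commute)
  also have "\<dots> = exp (cmod b)"
    by (simp add: exp_def divide_inverse mult.commute)
  finally show ?thesis .
qed

lemma exp_partial_sums: "(\<lambda>n. \<Sum>k<n. b ^ k / fact k) \<longlonglongrightarrow> exp (b :: complex)"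
  using exp_converges[of b] by (simp add: sums_def scaleR_conv_of_real divide_inverse mult.commute)

text \<open>Half of the decay rate absorbs the power:
  \<open>s ^ k * exp (- l s / 2) \<le> fact k / (l / 2) ^ k\<close> for
  \<open>s > 0\<close>.\<close>

lemma integrable_power_ekap:
  assumes l: "0 < l"
  shows "integrable lborel (\<lambda>s. \<bar>s\<bar> ^ k * cmod (rekap l s))"
proof (rule Bochner_Integration.integrable_bound)
  show "integrable lborel (\<lambda>s. (fact k / (l / 2) ^ k) * cmod (ekap (of_real (l / 2)) s))"
    using integrable_ekap[of "of_real (l / 2)"] l by simp
  have "\<bar>s\<bar> ^ k * cmod (rekap l s) \<le> (fact k / (l / 2) ^ k) * cmod (ekap (of_real (l / 2)) s)" for s
  proof (cases "0 < s")
    case True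
    have "s ^ k * exp (- (l / 2 * s)) \<le> fact k / (l / 2) ^ k * 1"
      using power_div_fact_le_exp[of "l / 2 * s" k] l True
      by (simp add: power_mult_distrib exp_minus field_simps)
    then have "s ^ k * exp (- (l / 2 * s)) * exp (- (l / 2 * s)) \<le> fact k / (l / 2) ^ k * exp (- (l / 2 * s))"
      by (intro mult_right_mono) auto
    moreover have "exp (- (l / 2 * s)) * exp (- (l / 2 * s)) = exp (- (l * s))"
      by (simp add: exp_add[symmetric])
    ultimately show ?thesis
      using True by (simp add: norm_ekap mult.assoc)
  qed (simp add: norm_ekap)
  then show "AE s in lborel. norm (\<bar>s\<bar> ^ k * cmod (rekap l s)) \<le> norm ((fact k / (l / 2) ^ k) * cmod (ekap (of_real (l / 2)) s))"
    using l by (intro AE_I2) (simp add: abs_mult)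
qed measurable

text \<open>\<open>B\<close> stands for any closed subalgebra. Both generated algebras are
  intersections of such \<open>B\<close>, so membership criteria valid for every \<open>B\<close>
  suffice, and neither algebra has to be described explicitly.\<close>

locale fock_subalgebra = fock_space t for t :: "real ^ 'n" +
  fixes B :: "'n fock_op set"
  assumes B: "cstar_subalgebra (Fock_cstar t) B"
begin

lemma B_add: "X \<in> B \<Longrightarrow> Y \<in> B \<Longrightarrow> add_op (Fock_cstar t) X Y \<in> B"
  and B_scale: "X \<in> B \<Longrightarrow> scale_op (Fock_cstar t) c X \<in> B"
  and B_mult: "X \<in> B \<Longrightarrow> Y \<in> B \<Longrightarrow> mult_op (Fock_cstar t) X Y \<in> B"
  using B by (auto simp: cstar_subalgebra_def)

lemma B_closed:
  assumes X: "\<And>k. X k \<in> B" and A: "A \<in> bounded_ops t"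
    and le: "\<And>k. 0 \<le> op_dist (X k) A"
      "\<And>k. op_dist (X k) A \<le> e k"
    and e: "e \<longlonglongrightarrow> 0"
  shows "A \<in> B"
proof -
  have "(\<lambda>k. op_dist (X k) A) \<longlonglongrightarrow> 0"
    by (rule tendsto_sandwich[OF _ _ tendsto_const e]) (use le in auto)
  then have "A \<in> norm_closure (Fock_cstar t) B"
    unfolding norm_closure_def
    by (intro CollectI conjI exI[of _ X] allI X) (use A in \<open>simp_all add: Fock_cstar_def\<close>)
  then show ?thesis
    using B by (auto simp: cstar_subalgebra_def)
qed

lemma wop_dominated:
  assumes M: "sigma_finite_measure M" and v: "v \<in> borel_measurable M"
    and meas [measurable]: "\<And>n. \<kappa> n \<in> borel_measurable M" and lim: "\<And>x. (\<lambda>n. \<kappa> n x) \<longlonglongrightarrow> \<kappa>' x"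
    and bound: "\<And>n x. cmod (\<kappa> n x) \<le> W x" and W: "integrable M W"
    and mem: "\<And>n. wop M (\<kappa> n) v \<in> B"
  shows "wop M \<kappa>' v \<in> B"
proof -
  have [measurable]: "\<kappa>' \<in> borel_measurable M"
    by (rule borel_measurable_LIMSEQ_metric[OF meas lim])
  have bound': "cmod (\<kappa>' x) \<le> W x" for x
    by (rule LIMSEQ_le_const2[OF tendsto_norm[OF lim]]) (use bound in auto)
  have i: "integrable M (\<kappa> n)" "integrable M \<kappa>'" for n
    by (rule Bochner_Integration.integrable_bound[OF W], simp,
        rule AE_I2, use bound bound' in \<open>auto intro: order_trans[OF _ abs_ge_self]\<close>)+
  have "(\<lambda>n. LINT x|M. cmod (\<kappa> n x - \<kappa>' x)) \<longlonglongrightarrow> (LINT x|M. 0)"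
  proof (rule integral_dominated_convergence[where w = "\<lambda>x. 2 * W x"])
    show "AE x in M. (\<lambda>n. cmod (\<kappa> n x - \<kappa>' x)) \<longlonglongrightarrow> 0"
      using lim by (intro AE_I2 tendsto_norm_zero LIM_zero)
    have "cmod (\<kappa> n x - \<kappa>' x) \<le> 2 * W x" for n x
      using norm_triangle_ineq4[of "\<kappa> n x" "\<kappa>' x"] bound[of n x] bound'[of x] by simp
    then show "AE x in M. norm (cmod (\<kappa> n x - \<kappa>' x)) \<le> 2 * W x" for n
      by (intro AE_I2) simp
  qed (use W in auto)
  then have "(\<lambda>n. LINT x|M. cmod (\<kappa> n x - \<kappa>' x)) \<longlonglongrightarrow> 0" by simp
  then show ?thesis
    by (rule B_closed[OF mem wop_bounded_ops[OF M i(2) v] opnorm_wop_diff[OF M i v]])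
qed

lemma wop_sum:
  assumes "\<And>k. k \<in> I \<Longrightarrow> integrable M (\<kappa> k)" and v: "v \<in> borel_measurable M"
    and "\<And>k. k \<in> I \<Longrightarrow> wop M (\<kappa> k) v \<in> B" and "finite I" and "I \<noteq> {}"
  shows "wop M (\<lambda>x. \<Sum>k\<in>I. \<kappa> k x) v \<in> B"
  using assms(4,5,1,3)
proof (induction rule: finite_ne_induct)
  case (insert k I)
  then show ?case
    using wop_add[of M "\<kappa> k" "\<lambda>x. \<Sum>k\<in>I. \<kappa> k x" v] v B_add by simp
qed simp

lemma wop_lin_mem:
  assumes \<kappa>: "integrable M \<kappa>" "integrable M \<kappa>'" and v: "v \<in> borel_measurable M"
    and mem: "wop M \<kappa> v \<in> B" "wop M \<kappa>' v \<in> B"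
  shows "wop M (\<lambda>x. a * \<kappa> x + b * \<kappa>' x) v \<in> B"
proof -
  have "wop M (\<lambda>x. a * \<kappa> x + b * \<kappa>' x) v = add_op (Fock_cstar t) (wop M (\<lambda>x. a * \<kappa> x) v) (wop M (\<lambda>x. b * \<kappa>' x) v)"
    using \<kappa> by (intro wop_add v) auto
  then show ?thesis
    unfolding wop_scale by (simp only: B_add B_scale mem)
qed

text \<open>Each factor \<open>s\<close> is a difference quotient in \<open>l\<close>.\<close>

lemma wop_moments:
  assumes h [measurable]: "h \<in> borel_measurable borel" and h1: "\<And>s. cmod (h s) \<le> 1"
    and mem: "\<And>l. 0 < l \<Longrightarrow> wop lborel (\<lambda>s. rekap l s * h s) (line z) \<in> B"
    and l: "0 < l"
  shows "wop lborel (\<lambda>s. of_real (s ^ k) * rekap l s * h s) (line z) \<in> B"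
  using l
proof (induction k arbitrary: l)
  case 0
  then show ?case using mem by simp
next
  case (Suc k)
  define e where "e n = inverse (real (Suc n))" for n
  have e: "0 < e n" for n by (simp add: e_def)
  define D where "D l s = of_real (s ^ k) * rekap l s * h s" for l s
  have D_le: "cmod (D l s) \<le> \<bar>s\<bar> ^ k * cmod (rekap l s)" for l s
    using mult_left_mono[OF h1[of s], of "\<bar>s\<bar> ^ k * cmod (rekap l s)"]
    by (simp add: D_def norm_mult norm_power)
  have Dm [measurable]: "D l \<in> borel_measurable borel" for l
    unfolding D_def by measurable
  have Di: "integrable lborel (D l)" if "0 < l" for l
    by (rule Bochner_Integration.integrable_bound[OF integrable_power_ekap[OF that, of k]])
      (use D_le in auto)
  \<comment> \<open>The quotient multiplies the density by \<open>(1 - exp (- e s)) / e\<close>,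
    which lies between 0 and \<open>s\<close> for \<open>s > 0\<close>; hence one more power of
    \<open>s\<close> is a majorant.\<close>
  define \<kappa> where "\<kappa> n s = of_real (1 / e n) * D l s + of_real (- 1 / e n) * D (l + e n) s" for n s
  have \<kappa>_eq: "\<kappa> n s = of_real ((1 - exp (- (e n * s))) / e n) * D l s" for n s
  proof -
    have "ekap (of_real (l + e n)) s = rekap l s * of_real (exp (- (e n * s)))"
      by (simp add: ekap_def exp_of_real[symmetric] exp_add[symmetric] algebra_simps)
    then show ?thesis
      by (simp add: \<kappa>_def D_def diff_divide_distrib algebra_simps)
  qed
  have "wop lborel (\<lambda>s. of_real (s ^ Suc k) * rekap l s * h s) (line z) \<in> B"
  proof (rule wop_dominated[OF sigma_finite_lborel scaleR_line_measurable, where \<kappa> = \<kappa>])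
    show "\<kappa> n \<in> borel_measurable lborel" for n
      unfolding \<kappa>_def by measurable
    show "(\<lambda>n. \<kappa> n s) \<longlonglongrightarrow> of_real (s ^ Suc k) * rekap l s * h s" for s
    proof -
      have "((\<lambda>e. (1 - exp (- (e * s))) / e) \<longlongrightarrow> s) (at_right 0)"
        by real_asymp
      then have "(\<lambda>n. (1 - exp (- (e n * s))) / e n) \<longlonglongrightarrow> s"
        unfolding e_def by (rule filterlim_compose[OF _ inverse_Suc_at_right])
      from tendsto_mult[OF tendsto_of_real[OF this] tendsto_const[of "D l s"]]
      show ?thesis by (simp add: \<kappa>_eq D_def mult_ac)
    qed
    show "integrable lborel (\<lambda>s. \<bar>s\<bar> ^ Suc k * cmod (rekap l s))"
      by (rule integrable_power_ekap) (rule Suc.prems)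
    show "cmod (\<kappa> n s) \<le> \<bar>s\<bar> ^ Suc k * cmod (rekap l s)" for n s
    proof (cases "0 < s")
      case True
      have "1 - exp (- (e n * s)) \<le> e n * s"
        using exp_ge_add_one_self[of "- (e n * s)"] by simp
      then have "(1 - exp (- (e n * s))) / e n \<le> s"
        using e[of n] by (simp add: field_simps)
      moreover have "0 \<le> (1 - exp (- (e n * s))) / e n"
        using e[of n] True by simp
      ultimately have "\<bar>(1 - exp (- (e n * s))) / e n\<bar> \<le> \<bar>s\<bar>"
        by simp
      then have "\<bar>(1 - exp (- (e n * s))) / e n\<bar> * cmod (D l s) \<le> \<bar>s\<bar> * (\<bar>s\<bar> ^ k * cmod (rekap l s))"
        by (intro mult_mono D_le) auto
      then show ?thesis
        unfolding \<kappa>_eq norm_mult norm_of_real by (simp add: mult.assoc)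
    qed (simp add: \<kappa>_eq D_def ekap_def)
    show "wop lborel (\<kappa> n) (line z) \<in> B" for n
    proof -
      have "wop lborel (D l) (line z) \<in> B" "wop lborel (D (l + e n)) (line z) \<in> B"
        unfolding D_def by (rule Suc.IH; use Suc.prems e[of n] in simp)+
      then show ?thesis
        unfolding \<kappa>_def using Suc.prems e[of n]
        by (intro wop_lin_mem Di scaleR_line_measurable) auto
    qed
  qed
  then show ?case .
qed

text \<open>Used with \<open>m = 2\<close> to remove the Gaussian and with \<open>m = 1\<close> to
  pass from real to complex parameters. Convergence is decided by the majorant in \<open>W\<close>,
  where \<open>b\<close> is replaced by its modulus.\<close>

lemma wop_exp_power:
  assumes h [measurable]: "h \<in> borel_measurable borel" and h1: "\<And>s. cmod (h s) \<le> 1"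
    and mem: "\<And>l. 0 < l \<Longrightarrow> wop lborel (\<lambda>s. rekap l s * h s) (line z) \<in> B"
    and l: "0 < l"
    and W: "integrable lborel (\<lambda>s. exp (cmod b * \<bar>s\<bar> ^ m) * cmod (rekap l s * h s))"
  shows "wop lborel (\<lambda>s. exp (b * of_real (s ^ m)) * (rekap l s * h s)) (line z) \<in> B"
proof (rule wop_dominated[OF sigma_finite_lborel scaleR_line_measurable _ _ _ W])
  \<comment> \<open>\<open>Suc n\<close> keeps the index set nonempty, as \<open>wop_sum\<close>
    demands.\<close>
  define \<kappa> where "\<kappa> n s = (\<Sum>k<Suc n. (b * of_real (s ^ m)) ^ k / fact k) * (rekap l s * h s)" for n s
  show "\<kappa> n \<in> borel_measurable lborel" for n
    unfolding \<kappa>_def by measurable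
  show "(\<lambda>n. \<kappa> n s) \<longlonglongrightarrow> exp (b * of_real (s ^ m)) * (rekap l s * h s)" for s
    unfolding \<kappa>_def by (intro tendsto_mult tendsto_const LIMSEQ_Suc exp_partial_sums)
  show "cmod (\<kappa> n s) \<le> exp (cmod b * \<bar>s\<bar> ^ m) * cmod (rekap l s * h s)" for n s
    unfolding \<kappa>_def norm_mult[of "sum _ _"]
    by (intro mult_right_mono order_trans[OF norm_exp_partial_sum_le]) (auto simp: norm_mult norm_power)
  show "wop lborel (\<kappa> n) (line z) \<in> B" for n
  proof -
    define \<rho> where "\<rho> k s = (b ^ k / fact k) * (of_real (s ^ (m * k)) * rekap l s * h s)" for k s
    have "\<kappa> n = (\<lambda>s. \<Sum>k<Suc n. \<rho> k s)"
      unfolding \<kappa>_def \<rho>_def sum_distrib_right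
      by (intro ext sum.cong refl) (simp add: power_mult_distrib power_mult[symmetric] mult_ac)
    moreover have "integrable lborel (\<rho> k)" for k
    proof -
      have "integrable lborel (\<lambda>s. of_real (s ^ (m * k)) * rekap l s * h s)"
      proof (rule Bochner_Integration.integrable_bound[OF integrable_power_ekap[OF l, of "m * k"]])
        have "cmod (of_real (s ^ (m * k)) * rekap l s * h s) \<le> \<bar>s\<bar> ^ (m * k) * cmod (rekap l s)" for s
          using mult_left_mono[OF h1[of s], of "\<bar>s\<bar> ^ (m * k) * cmod (rekap l s)"]
          by (simp add: norm_mult norm_power)
        then show "AE s in lborel. norm (of_real (s ^ (m * k)) * rekap l s * h s) \<le> norm (\<bar>s\<bar> ^ (m * k) * cmod (rekap l s))"
          by (intro AE_I2) simp
      qed measurable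
      then show ?thesis unfolding \<rho>_def by simp
    qed
    moreover have "wop lborel (\<rho> k) (line z) \<in> B" for k
      unfolding \<rho>_def wop_scale by (intro B_scale wop_moments h h1 mem l)
    ultimately show ?thesis
      by (simp only:) (rule wop_sum, auto)
  qed
qed

text \<open>The Toeplitz operator has the density \<open>exp (- l s - a s\<^sup>2)\<close> on
  \<open>s > 0\<close>. The series for \<open>exp (a s\<^sup>2)\<close> has nonnegative terms, so
  after multiplication the majorant is just \<open>exp (- l s)\<close>.\<close>

lemma res_mem_if_toeplitz_mem:
  assumes mem: "\<And>l. 0 < l \<Longrightarrow> toeplitz t (\<lambda>w. inverse (of_real l - 2 * \<i> * of_real (sigma_t t w z))) \<in> B"
    and l: "0 < l"
  shows "rres l z \<in> B"
proof -
  define a where "a = q z / 2"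
  have a: "0 \<le> a" by (simp add: a_def quad_nonneg)
  define h where "h s = complex_of_real (exp (- (a * s\<^sup>2)))" for s :: real
  have [measurable]: "h \<in> borel_measurable borel"
    unfolding h_def by measurable
  have "wop lborel (\<lambda>s. exp (of_real a * of_real (s ^ 2)) * (rekap l s * h s)) (line z) \<in> B"
  proof (rule wop_exp_power[OF _ _ _ l])
    show "cmod (h s) \<le> 1" for s
      using a by (simp add: h_def)
    show "wop lborel (\<lambda>s. rekap l s * h s) (line z) \<in> B" if l: "0 < l" for l
    proof -
      have "toeplitz t (fourier lborel (rekap l) (line z)) \<in> B"
      proof -
        have "fourier lborel (rekap l) (line z) = (\<lambda>w. inverse (of_real l - 2 * \<i> * of_real (sigma_t t w z)))"
          by (intro ext fourier_ekap) (use l in simp)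
        then show ?thesis using mem[OF l] by simp
      qed
      then show ?thesis
        using l by (subst (asm) toeplitz_fourier) (auto simp: integrable_ekap sigma_finite_lborel quad_scaleR h_def a_def mult_ac)
    qed
    have "exp (cmod (of_real a) * \<bar>s\<bar> ^ 2) * cmod (rekap l s * h s) = cmod (rekap l s)" for s
      using a by (simp add: norm_mult h_def mult.left_commute exp_add[symmetric])
    then show "integrable lborel (\<lambda>s. exp (cmod (of_real a) * \<bar>s\<bar> ^ 2) * cmod (rekap l s * h s))"
      using integrable_ekap[of "of_real l"] l by simp
  qed measurable
  moreover have "exp (of_real a * of_real (s ^ 2)) * (rekap l s * h s) = rekap l s" for s
    by (simp add: h_def exp_of_real[symmetric] mult.left_commute exp_add[symmetric])
  ultimately show ?thesis by (simp only: res_def)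
qed

text \<open>The series of \<open>exp ((l - c) s)\<close> is dominated against
  \<open>exp (- l s)\<close> when \<open>\<bar>l - c\<bar> < l\<close>, and these discs exhaust the
  right half-plane.\<close>

lemma res_complex_mem:
  assumes mem: "\<And>l. 0 < l \<Longrightarrow> rres l z \<in> B" and c: "0 < Re c"
  shows "res c z \<in> B"
proof -
  \<comment> \<open>The condition \<open>\<bar>l - c\<bar> < l\<close> amounts to
    \<open>2 l Re c > \<bar>c\<bar>\<^sup>2\<close>; this \<open>l\<close> is twice the
    threshold.\<close>
  define l where "l = (cmod c)\<^sup>2 / Re c"
  have "c \<noteq> 0" using c by auto
  then have l: "0 < l" using c by (simp add: l_def)
  have "(cmod (of_real l - c))\<^sup>2 = l\<^sup>2 - 2 * (l * Re c) + (cmod c)\<^sup>2"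
    unfolding cmod_power2 by (simp add: power2_eq_square algebra_simps)
  also have "l * Re c = (cmod c)\<^sup>2" using c by (simp add: l_def)
  finally have "(cmod (of_real l - c))\<^sup>2 < l\<^sup>2" using \<open>c \<noteq> 0\<close> by simp
  then have lt: "cmod (of_real l - c) < l"
    using l by (simp add: power2_less_imp_less)
  have "wop lborel (\<lambda>s. exp ((of_real l - c) * of_real (s ^ 1)) * (rekap l s * 1)) (line z) \<in> B"
  proof (rule wop_exp_power[OF _ _ _ l])
    show "wop lborel (\<lambda>s. rekap l s * 1) (line z) \<in> B" if "0 < l" for l
      using mem[OF that] by (simp add: res_def)
    have "exp (cmod (of_real l - c) * \<bar>s\<bar> ^ 1) * cmod (rekap l s * 1) = cmod (ekap (of_real (l - cmod (of_real l - c))) s)" for s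
      by (simp add: norm_ekap exp_add[symmetric] algebra_simps)
    then show "integrable lborel (\<lambda>s. exp (cmod (of_real l - c) * \<bar>s\<bar> ^ 1) * cmod (rekap l s * 1))"
      using integrable_ekap[of "of_real (l - cmod (of_real l - c))"] lt by simp
  qed auto
  moreover have "exp ((of_real l - c) * of_real (s ^ 1)) * (rekap l s * 1) = ekap c s" for s
    by (simp add: ekap_def exp_add[symmetric] algebra_simps)
  ultimately show ?thesis by (simp add: res_def)
qed

end

section \<open>Products of resolvents\<close>

lemma sigma_finite_PiM_lborel: "finite I \<Longrightarrow> sigma_finite_measure (\<Pi>\<^sub>M i\<in>I. (lborel :: real measure))"
proof -
  interpret product_sigma_finite "\<lambda>_. lborel :: real measure" ..
  show "finite I \<Longrightarrow> sigma_finite_measure (\<Pi>\<^sub>M i\<in>I. (lborel :: real measure))"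
    by (rule sigma_finite)
qed

definition kernel_prod :: "nat \<Rightarrow> (nat \<Rightarrow> complex) \<Rightarrow> (nat \<Rightarrow> real) \<Rightarrow> complex" where
  "kernel_prod k c s = (\<Prod>i<k. ekap (c i) (s i))"

definition lin_comb :: "nat \<Rightarrow> (nat \<Rightarrow> complex ^ 'n) \<Rightarrow> (nat \<Rightarrow> real) \<Rightarrow> complex ^ 'n" where
  "lin_comb k z s = (\<Sum>i<k. s i *\<^sub>R z i)"

abbreviation "PL k \<equiv> \<Pi>\<^sub>M i\<in>{..<k::nat}. (lborel :: real measure)"

lemma lin_comb_measurable [measurable]: "lin_comb k z \<in> borel_measurable (PL k)"
proof -
  have [measurable]: "(\<lambda>s. s i) \<in> borel_measurable (PL k)" if "i < k" for i
    using measurable_component_singleton[of i "{..<k}" "\<lambda>_. lborel"] that by simp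
  show ?thesis
    unfolding lin_comb_def[abs_def] by (intro borel_measurable_sum borel_measurable_scaleR) auto
qed

lemma integrable_kernel_prod:
  assumes "\<And>i. 0 < Re (c i)"
  shows "integrable (PL k) (kernel_prod k c)"
proof -
  interpret product_sigma_finite "\<lambda>_. lborel :: real measure" ..
  show ?thesis
    unfolding kernel_prod_def[abs_def] by (rule product_integrable_prod) (use assms integrable_ekap in auto)
qed

lemma integral_kernel_prod:
  assumes "\<And>i. 0 < Re (c i)"
  shows "(LINT s|PL k. kernel_prod k c s) = (\<Prod>i<k. inverse (c i))"
proof -
  interpret product_sigma_finite "\<lambda>_. lborel :: real measure" ..
  show ?thesis
    unfolding kernel_prod_def
    by (subst product_integral_prod) (use assms integrable_ekap in \<open>auto simp: integral_ekap divide_inverse\<close>)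
qed

context fock_space
begin

lemma phase_add: "phase w (u + v) = phase w u * phase w v"
  by (simp add: phase_def sigma_t_def inner_t_simps exp_add[symmetric] distrib_left)

lemma phase_add_left: "phase (u + v) w = phase u w * phase v w"
  by (simp add: phase_def sigma_t_def inner_t_simps exp_add[symmetric] distrib_left)

lemma phase_0 [simp]: "phase 0 w = 1" "phase w 0 = 1"
  by (simp_all add: phase_def sigma_t_def inner_t_simps)

lemma ekap_phase:
  "ekap c s * phase w (s *\<^sub>R z) = ekap (c - 2 * \<i> * of_real (sigma_t t w z)) s"
  "ekap c s * phase (s *\<^sub>R z) u = ekap (c - 2 * \<i> * of_real (sigma_t t z u)) s"
  by (simp_all add: ekap_def phase_def sigma_t_def inner_t_simps exp_add[symmetric] algebra_simps)

text \<open>Phases are multiplicative, and a phase on each factor shifts its parameter without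
  changing the real part. The first identity serves the Fourier transform, the second inserts phases
  into the density of an operator.\<close>

lemma kernel_prod_phase:
  "kernel_prod k c s * phase w (lin_comb k z s) = kernel_prod k (\<lambda>i. c i - 2 * \<i> * of_real (sigma_t t w (z i))) s"
  "kernel_prod k c s * phase (lin_comb k z s) u = kernel_prod k (\<lambda>i. c i - 2 * \<i> * of_real (sigma_t t (z i) u)) s"
proof -
  have "phase w (lin_comb k z s) = (\<Prod>i<k. phase w (s i *\<^sub>R z i))"
    by (induction k) (simp_all add: lin_comb_def phase_add)
  then show "kernel_prod k c s * phase w (lin_comb k z s) = kernel_prod k (\<lambda>i. c i - 2 * \<i> * of_real (sigma_t t w (z i))) s"
    by (simp add: kernel_prod_def ekap_phase(1)[symmetric] prod.distrib)
  have "phase (lin_comb k z s) u = (\<Prod>i<k. phase (s i *\<^sub>R z i) u)"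
    by (induction k) (simp_all add: lin_comb_def phase_add_left)
  then show "kernel_prod k c s * phase (lin_comb k z s) u = kernel_prod k (\<lambda>i. c i - 2 * \<i> * of_real (sigma_t t (z i) u)) s"
    by (simp add: kernel_prod_def ekap_phase(2)[symmetric] prod.distrib)
qed

lemma fourier_kernel_prod:
  assumes "\<And>i. 0 < Re (c i)"
  shows "fourier (PL k) (kernel_prod k c) (lin_comb k z) w = (\<Prod>i<k. inverse (c i - 2 * \<i> * of_real (sigma_t t w (z i))))"
  unfolding fourier_def kernel_prod_phase by (rule integral_kernel_prod) (use assms in simp)

end

context fock_subalgebra
begin

text \<open>On an isotropic family the Weyl operators compose additively, so composing with one more
  resolvent adds one more integration variable.\<close>

lemma wop_kernel_prod_mem:
  fixes c :: "nat \<Rightarrow> complex" and z :: "nat \<Rightarrow> complex ^ 'n"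
  assumes res: "\<And>l z. 0 < l \<Longrightarrow> rres l z \<in> B"
    and c: "\<And>i. 0 < Re (c i)" and iso: "\<And>i j. sigma_t t (z i) (z j) = 0"
  shows "wop (PL k) (kernel_prod k c) (lin_comb k z) \<in> B"
proof (induction k)
  case 0
  \<comment> \<open>With no variables the operator is the identity, obtained as a resolvent along
    the zero vector: all Weyl operators there are trivial, and \<open>exp (- s)\<close> has integral
    1.\<close>
  have "wop (PL 0) (kernel_prod 0 c) (lin_comb 0 z) = res 1 0"
    by (auto simp: res_def wop_def kernel_prod_def lin_comb_def PiM_empty lebesgue_integral_count_space_finite
        integral_ekap fun_eq_iff)
  then show ?case using res[of 1 0] by simp
next
  case (Suc k)
  interpret product_sigma_finite "\<lambda>_::nat. lborel :: real measure" ..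
  let ?R = "res (c k) (z k)"
  have R: "?R \<in> B" by (rule res_complex_mem[OF res c])
  have "wop (PL (Suc k)) (kernel_prod (Suc k) c) (lin_comb (Suc k) z) = mult_op (Fock_cstar t) (wop (PL k) (kernel_prod k c) (lin_comb k z)) ?R"
  proof
    fix g
    show "wop (PL (Suc k)) (kernel_prod (Suc k) c) (lin_comb (Suc k) z) g = mult_op (Fock_cstar t) (wop (PL k) (kernel_prod k c) (lin_comb k z)) ?R g"
    proof (cases "g \<in> Fock t")
      case False
      then show ?thesis by (simp add: wop_def Fock_cstar_def)
    next
      case g: True
      have Rg: "?R g \<in> Fock t" by (rule res_Fock[OF c g])
      have "wop (PL (Suc k)) (kernel_prod (Suc k) c) (lin_comb (Suc k) z) g w = wop (PL k) (kernel_prod k c) (lin_comb k z) (?R g) w" for w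
      proof -
        have upd: "kernel_prod (Suc k) c (x(k := y)) * weyl (lin_comb (Suc k) z (x(k := y))) g w =
           kernel_prod k c x * ekap (c k) y * weyl (lin_comb k z x) (weyl (y *\<^sub>R z k) g) w" for x y
        proof -
          have "sigma_t t (lin_comb k z x) (y *\<^sub>R z k) = 0"
          proof -
            have "inner_t t (lin_comb m z x) (y *\<^sub>R z k) = of_real y * (\<Sum>i<m. of_real (x i) * inner_t t (z i) (z k))" for m
              by (induction m) (simp_all add: lin_comb_def inner_t_simps algebra_simps)
            then show ?thesis
              using iso by (simp add: sigma_t_def)
          qed
          then show ?thesis
            by (simp add: weyl_weyl_commuting) (simp add: kernel_prod_def lin_comb_def)
        qed
        have "integrable (PL (Suc k)) (\<lambda>s. kernel_prod (Suc k) c s * weyl (lin_comb (Suc k) z s) g w)"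
          by (rule wop_integrable[OF integrable_kernel_prod[OF c] lin_comb_measurable g])
        then have "(LINT s|PL (Suc k). kernel_prod (Suc k) c s * weyl (lin_comb (Suc k) z s) g w) =
          (LINT x|PL k. LINT y|lborel. kernel_prod (Suc k) c (x(k := y)) * weyl (lin_comb (Suc k) z (x(k := y))) g w)"
          unfolding lessThan_Suc by (intro product_integral_insert) auto
        then show ?thesis
          using g Rg unfolding upd by (simp add: res_def wop_wop) (simp add: wop_def)
      qed
      then show ?thesis
        using g by (simp add: Fock_cstar_def fun_eq_iff)
    qed
  qed
  then show ?case using B_mult[OF Suc R] by simp
qed

text \<open>The factors that may be inserted into the density. Quantifying over all \<open>c\<close>
  makes room for phases, which change \<open>c\<close>; the bound 1 lets the kernel itself serve as
  majorant for limits.\<close>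

definition multipliers :: "nat \<Rightarrow> (nat \<Rightarrow> complex ^ 'n) \<Rightarrow> (complex ^ 'n \<Rightarrow> complex) set" where
  "multipliers k z = {h \<in> borel_measurable borel. (\<forall>v. cmod (h v) \<le> 1) \<and>
     (\<forall>c. (\<forall>i. 0 < Re (c i)) \<longrightarrow> wop (PL k) (\<lambda>s. kernel_prod k c s * h (lin_comb k z s)) (lin_comb k z) \<in> B)}"

text \<open>The cosine is the mean of the phases at \<open>u\<close> and \<open>- u\<close>, each of
  which replaces \<open>c\<close> by parameters with the same real parts.\<close>

lemma multipliers_cos:
  assumes h: "h \<in> multipliers k z"
  shows "(\<lambda>v. of_real (cos (2 * sigma_t t v u)) * h v) \<in> multipliers k z"
proof -
  have [measurable]: "h \<in> borel_measurable borel" and h1: "\<And>v. cmod (h v) \<le> 1"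
    and hB: "\<And>c. (\<And>i. 0 < Re (c i)) \<Longrightarrow> wop (PL k) (\<lambda>s. kernel_prod k c s * h (lin_comb k z s)) (lin_comb k z) \<in> B"
    using h by (auto simp: multipliers_def)
  have [measurable]: "(\<lambda>s. h (lin_comb k z s)) \<in> borel_measurable (PL k)"
    by (rule measurable_compose[of _ _ borel]) measurable
  have "wop (PL k) (\<lambda>s. kernel_prod k c s * (of_real (cos (2 * sigma_t t (lin_comb k z s) u)) * h (lin_comb k z s))) (lin_comb k z) \<in> B"
    if c: "\<And>i. 0 < Re (c i)" for c
  proof -
    define c' where "c' a i = c i - 2 * \<i> * of_real (sigma_t t (z i) a)" for a i
    have c': "0 < Re (c' a i)" for a i using c by (simp add: c'_def)
    have cos_eq: "complex_of_real (cos (2 * sigma_t t v u)) = (phase v u + phase v (- u)) / 2" for v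
      by (simp add: phase_def sigma_t_def inner_t_simps cos_of_real[symmetric] cos_exp_eq mult_ac)
    have "kernel_prod k c s * (of_real (cos (2 * sigma_t t (lin_comb k z s) u)) * h (lin_comb k z s)) =
       (1/2) * (kernel_prod k (c' u) s * h (lin_comb k z s)) + (1/2) * (kernel_prod k (c' (- u)) s * h (lin_comb k z s))" for s
      unfolding c'_def kernel_prod_phase(2)[symmetric] cos_eq by (simp add: algebra_simps add_divide_distrib)
    moreover have ci: "integrable (PL k) (kernel_prod k (c' a))" for a
      by (rule integrable_kernel_prod[OF c'])
    have "integrable (PL k) (\<lambda>s. kernel_prod k (c' a) s * h (lin_comb k z s))" for a
    proof (rule Bochner_Integration.integrable_bound[OF ci[of a]])
      show "AE s in PL k. norm (kernel_prod k (c' a) s * h (lin_comb k z s)) \<le> norm (kernel_prod k (c' a) s)"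
        using mult_left_mono[OF h1, of "cmod (kernel_prod k (c' a) _)"] by (intro AE_I2) (simp add: norm_mult)
    qed (use borel_measurable_integrable[OF ci[of a]] in measurable)
    ultimately show ?thesis
      by (simp only:) (intro wop_lin_mem hB c' lin_comb_measurable)
  qed
  moreover have "cmod (of_real (cos (2 * sigma_t t v u)) * h v) \<le> 1" for v
    using mult_mono[OF abs_cos_le_one[of "2 * sigma_t t v u"] h1[of v]] by (simp add: norm_mult)
  moreover have "(\<lambda>v. of_real (cos (2 * sigma_t t v u)) * h v) \<in> borel_measurable borel"
    unfolding sigma_t_def by measurable
  ultimately show ?thesis by (simp add: multipliers_def)
qed

lemma multipliers_cos_power:
  assumes h: "h \<in> multipliers k z"
  shows "(\<lambda>v. of_real (cos (2 * sigma_t t v u) ^ m) * h v) \<in> multipliers k z"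
proof (induction m)
  case (Suc m)
  from multipliers_cos[OF this, of u] show ?case by (simp add: mult.assoc)
qed (use h in simp)

lemma multipliers_limit:
  assumes h: "\<And>n. h n \<in> multipliers k z" and lim: "\<And>v. (\<lambda>n. h n v) \<longlonglongrightarrow> h' v"
  shows "h' \<in> multipliers k z"
proof -
  have [measurable]: "\<And>n. h n \<in> borel_measurable borel" and h1: "\<And>n v. cmod (h n v) \<le> 1"
    using h by (auto simp: multipliers_def)
  have [measurable]: "(\<lambda>s. h n (lin_comb k z s)) \<in> borel_measurable (PL k)" for n
    by (rule measurable_compose[of _ _ borel]) measurable
  have "wop (PL k) (\<lambda>s. kernel_prod k c s * h' (lin_comb k z s)) (lin_comb k z) \<in> B" if c: "\<And>i. 0 < Re (c i)" for c
  proof (rule wop_dominated[OF sigma_finite_PiM_lborel lin_comb_measurable])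
    note i = integrable_kernel_prod[OF c, of k]
    show "(\<lambda>s. kernel_prod k c s * h n (lin_comb k z s)) \<in> borel_measurable (PL k)" for n
      using borel_measurable_integrable[OF i] by measurable
    show "integrable (PL k) (\<lambda>s. cmod (kernel_prod k c s))"
      using i by simp
    show "cmod (kernel_prod k c s * h n (lin_comb k z s)) \<le> cmod (kernel_prod k c s)" for n s
      using mult_left_mono[OF h1, of "cmod (kernel_prod k c s)"] by (simp add: norm_mult)
    show "wop (PL k) (\<lambda>s. kernel_prod k c s * h n (lin_comb k z s)) (lin_comb k z) \<in> B" for n
      using h[of n] c by (simp add: multipliers_def)
  qed (auto intro!: tendsto_intros lim)
  moreover have "cmod (h' v) \<le> 1" for v
    by (rule LIMSEQ_le_const2[OF tendsto_norm[OF lim]]) (use h1 in auto)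
  moreover have "h' \<in> borel_measurable borel"
    by (rule borel_measurable_LIMSEQ_metric[OF _ lim]) measurable
  ultimately show ?thesis by (simp add: multipliers_def)
qed

text \<open>The central limit theorem for random signs, in terms of characteristic functions. The
  limit is taken with \<open>powr\<close>, which agrees with the natural power once the cosine is
  positive.\<close>

lemma cos_power_tendsto: "(\<lambda>m. cos (x / sqrt (real (Suc m))) ^ Suc m) \<longlonglongrightarrow> exp (- (x * x / 2))"
proof -
  have lim: "((\<lambda>m::real. cos (x / sqrt m) powr m) \<longlongrightarrow> exp (- (x * x / 2))) at_top"
    by real_asymp
  have Suc: "filterlim (\<lambda>m. real (Suc m)) at_top sequentially"
    by real_asymp
  have "eventually (\<lambda>m::real. 0 < cos (x / sqrt m)) at_top"
    by real_asymp
  from eventually_compose_filterlim[OF this Suc]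
  have "eventually (\<lambda>m. cos (x / sqrt (real (Suc m))) powr real (Suc m) = cos (x / sqrt (real (Suc m))) ^ Suc m) sequentially"
    by eventually_elim (rule powr_realpow)
  from Lim_transform_eventually[OF filterlim_compose[OF lim Suc] this] show ?thesis .
qed

lemma multipliers_gauss_factor:
  assumes h: "h \<in> multipliers k z"
  shows "(\<lambda>v. of_real (exp (- ((2 * sigma_t t v u) * (2 * sigma_t t v u) / 2))) * h v) \<in> multipliers k z"
proof (rule multipliers_limit)
  define U where "U m = (1 / sqrt (real (Suc m))) *\<^sub>R u" for m
  have U: "2 * sigma_t t v (U m) = 2 * sigma_t t v u / sqrt (real (Suc m))" for v m
    by (simp add: U_def sigma_t_def inner_t_simps)
  show "(\<lambda>v. of_real (cos (2 * sigma_t t v (U m)) ^ Suc m) * h v) \<in> multipliers k z" for m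
    by (rule multipliers_cos_power[OF h])
  show "(\<lambda>m. of_real (cos (2 * sigma_t t v (U m)) ^ Suc m) * h v) \<longlonglongrightarrow>
     of_real (exp (- ((2 * sigma_t t v u) * (2 * sigma_t t v u) / 2))) * h v" for v
    unfolding U by (intro tendsto_mult tendsto_of_real cos_power_tendsto tendsto_const)
qed

lemma inner_t_axis: "inner_t t v (axis j a) = v $ j * cnj a / of_real (t $ j)"
proof -
  have "inner_t t v (axis j a) = (\<Sum>i\<in>UNIV. if i = j then v $ j * cnj a / of_real (t $ j) else 0)"
    unfolding inner_t_def by (rule sum.cong) (auto simp: axis_def)
  then show ?thesis by simp
qed

lemma multipliers_gauss:
  assumes one: "(\<lambda>_. 1) \<in> multipliers k z"
  shows "(\<lambda>v. of_real (exp (- q v / 2))) \<in> multipliers k z"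
proof -
  have "(\<lambda>v. of_real (exp (- (\<Sum>j\<in>J. (cmod (v $ j))\<^sup>2 / t $ j) / 2))) \<in> multipliers k z" for J
  proof (induction J rule: infinite_finite_induct)
    case (insert j J)
    \<comment> \<open>The vectors \<open>axis j a\<close> and \<open>axis j (- \<i> a)\<close> pick
      out the imaginary and the real part of \<open>v $ j\<close>; this \<open>a\<close> makes the
      two squares add up to \<open>(cmod (v $ j))\<^sup>2 / t $ j\<close>.\<close>
    define a where "a = sqrt (t $ j) / 2"
    define h where "h = (\<lambda>v. complex_of_real (exp (- (\<Sum>j\<in>J. (cmod (v $ j))\<^sup>2 / t $ j) / 2)))"
    have t: "0 < t $ j" "t $ j = sqrt (t $ j) * sqrt (t $ j)" using tpos[of j] by auto
    have Im: "2 * sigma_t t v (axis j (of_real a)) = Im (v $ j) / sqrt (t $ j)"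
      and Re: "2 * sigma_t t v (axis j (- \<i> * of_real a)) = Re (v $ j) / sqrt (t $ j)" for v
      using t by (simp_all add: sigma_t_def inner_t_axis a_def field_simps)
    have "(cmod (v $ j))\<^sup>2 / t $ j = Re (v $ j) / sqrt (t $ j) * (Re (v $ j) / sqrt (t $ j)) + Im (v $ j) / sqrt (t $ j) * (Im (v $ j) / sqrt (t $ j))" for v
      unfolding cmod_power2 using t by (simp add: power2_eq_square add_divide_distrib)
    then have "complex_of_real (exp (- (\<Sum>j\<in>insert j J. (cmod (v $ j))\<^sup>2 / t $ j) / 2)) =
       of_real (exp (- (Re (v $ j) / sqrt (t $ j) * (Re (v $ j) / sqrt (t $ j)) / 2))) *
       (of_real (exp (- (Im (v $ j) / sqrt (t $ j) * (Im (v $ j) / sqrt (t $ j)) / 2))) * h v)" for v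
      using insert.hyps unfolding h_def of_real_mult[symmetric] exp_add[symmetric]
      by (simp add: add_divide_distrib)
    moreover have "(\<lambda>v. of_real (exp (- (Re (v $ j) / sqrt (t $ j) * (Re (v $ j) / sqrt (t $ j)) / 2))) *
       (of_real (exp (- (Im (v $ j) / sqrt (t $ j) * (Im (v $ j) / sqrt (t $ j)) / 2))) * h v)) \<in> multipliers k z"
      using multipliers_gauss_factor[OF multipliers_gauss_factor[OF insert.IH[folded h_def], of "axis j (of_real a)"], of "axis j (- \<i> * of_real a)"]
      unfolding Re Im .
    ultimately show ?case by simp
  qed (use one in auto)
  from this[of UNIV] show ?thesis by (simp add: quad_def)
qed

text \<open>The product symbol is the Fourier integral of the product density, so its Toeplitz
  operator carries the Gaussian of \<open>lin_comb k z s\<close>. The constant multiplier 1 comes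
  from products of resolvents, and \<open>multipliers_gauss\<close> supplies the Gaussian.\<close>

lemma toeplitz_prod_mem:
  fixes c :: "nat \<Rightarrow> complex" and z :: "nat \<Rightarrow> complex ^ 'n"
  assumes res: "\<And>l z. 0 < l \<Longrightarrow> rres l z \<in> B"
    and c: "\<And>i. 0 < Re (c i)" and iso: "\<And>i j. sigma_t t (z i) (z j) = 0"
  shows "toeplitz t (\<lambda>w. \<Prod>i<k. inverse (c i - 2 * \<i> * of_real (sigma_t t w (z i)))) \<in> B"
proof -
  have "(\<lambda>_. 1) \<in> multipliers k z"
    using wop_kernel_prod_mem[OF res _ iso] by (simp add: multipliers_def)
  from multipliers_gauss[OF this]
  have "wop (PL k) (\<lambda>s. kernel_prod k c s * of_real (exp (- q (lin_comb k z s) / 2))) (lin_comb k z) \<in> B"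
    using c by (simp add: multipliers_def)
  then have "toeplitz t (fourier (PL k) (kernel_prod k c) (lin_comb k z)) \<in> B"
    by (subst toeplitz_fourier) (auto intro: sigma_finite_PiM_lborel integrable_kernel_prod c)
  moreover have "fourier (PL k) (kernel_prod k c) (lin_comb k z) = (\<lambda>w. \<Prod>i<k. inverse (c i - 2 * \<i> * of_real (sigma_t t w (z i))))"
    by (intro ext fourier_kernel_prod c)
  ultimately show ?thesis by simp
qed

end

section \<open>Bounded uniformly continuous symbols\<close>

abbreviation "BUC \<equiv> elems BUC_cstar"

lemma BUC_iff: "f \<in> BUC \<longleftrightarrow> uniformly_continuous_on UNIV f \<and> bounded (range f)"
  by (simp add: BUC_cstar_def)

lemma BUC_ops:
  "add_op BUC_cstar f g = (\<lambda>z. f z + g z)" "scale_op BUC_cstar c f = (\<lambda>z. c * f z)"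
  "mult_op BUC_cstar f g = (\<lambda>z. f z * g z)" "star_op BUC_cstar f = (\<lambda>z. cnj (f z))"
  "norm_op BUC_cstar f = (SUP z. cmod (f z))"
  by (simp_all add: BUC_cstar_def)

lemma BUC_bound: "f \<in> BUC \<Longrightarrow> \<exists>b. \<forall>z. cmod (f z) \<le> b"
  by (auto simp: BUC_iff bounded_iff)

lemma BUC_measurable: "f \<in> BUC \<Longrightarrow> f \<in> borel_measurable borel"
  by (auto simp: BUC_iff intro: borel_measurable_continuous_onI uniformly_continuous_imp_continuous)

lemma BUC_const: "(\<lambda>z. c) \<in> BUC"
  by (simp add: BUC_iff uniformly_continuous_on_const)

lemma BUC_add: "f \<in> BUC \<Longrightarrow> g \<in> BUC \<Longrightarrow> (\<lambda>z. f z + g z) \<in> BUC"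
  by (auto simp: BUC_iff uniformly_continuous_on_add intro!: bounded_plus_comp)

lemma BUC_mult:
  assumes f: "f \<in> BUC" and g: "g \<in> BUC"
  shows "(\<lambda>z. f z * g z) \<in> BUC"
proof -
  obtain a where a: "\<And>z. cmod (f z) \<le> a" using BUC_bound[OF f] by blast
  obtain b where b: "\<And>z. cmod (g z) \<le> b" using BUC_bound[OF g] by blast
  have a0: "0 \<le> a" and b0: "0 \<le> b" using a[of 0] b[of 0] norm_ge_zero order_trans by blast+
  have "uniformly_continuous_on UNIV (\<lambda>z. f z * g z)"
    unfolding uniformly_continuous_on_def
  proof (intro allI impI)
    fix e :: real assume e: "0 < e"
    define d where "d = e / (a + b + 1)"
    have d: "0 < d" using e a0 b0 by (simp add: d_def)
    obtain d1 where d1: "0 < d1" "\<And>x y. dist y x < d1 \<Longrightarrow> dist (f y) (f x) < d"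
      using f d unfolding BUC_iff uniformly_continuous_on_def by (metis UNIV_I)
    obtain d2 where d2: "0 < d2" "\<And>x y. dist y x < d2 \<Longrightarrow> dist (g y) (g x) < d"
      using g d unfolding BUC_iff uniformly_continuous_on_def by (metis UNIV_I)
    have "dist (f y * g y) (f x * g x) < e" if "dist y x < min d1 d2" for x y
    proof -
      have "f y * g y - f x * g x = f y * (g y - g x) + (f y - f x) * g x"
        by (simp add: algebra_simps)
      then have "cmod (f y * g y - f x * g x) \<le> cmod (f y) * cmod (g y - g x) + cmod (f y - f x) * cmod (g x)"
        by (metis norm_mult norm_triangle_ineq)
      also have "\<dots> \<le> a * d + d * b"
        by (intro add_mono mult_mono a b) (use d1(2)[of y x] d2(2)[of y x] that a0 d in \<open>auto simp: dist_norm\<close>)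
      also have "\<dots> < d * (a + b + 1)" using d by (simp add: algebra_simps)
      also have "\<dots> = e" using a0 b0 by (simp add: d_def)
      finally show ?thesis by (simp add: dist_norm)
    qed
    then show "\<exists>d>0. \<forall>x\<in>UNIV. \<forall>x'\<in>UNIV. dist x' x < d \<longrightarrow> dist (f x' * g x') (f x * g x) < e"
      using d1(1) d2(1) by (intro exI[of _ "min d1 d2"]) auto
  qed
  moreover have "cmod (f z * g z) \<le> a * b" for z
    unfolding norm_mult by (intro mult_mono a b a0) auto
  ultimately show ?thesis by (auto simp: BUC_iff bounded_iff)
qed

lemma BUC_scale: "f \<in> BUC \<Longrightarrow> (\<lambda>z. c * f z) \<in> BUC"
  using BUC_mult[OF BUC_const] .

lemma BUC_cnj: "f \<in> BUC \<Longrightarrow> (\<lambda>z. cnj (f z)) \<in> BUC"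
  unfolding BUC_iff uniformly_continuous_on_def bounded_iff
  by (simp add: dist_norm flip: complex_cnj_diff)

text \<open>Trades the sup norm for pointwise bounds \<open>e k\<close>;
  \<open>S \<subseteq> BUC\<close> ensures that the suprema are taken over bounded sets.\<close>

lemma norm_closure_BUC_E:
  assumes "f \<in> norm_closure BUC_cstar S" and S: "S \<subseteq> BUC"
  obtains X e where "f \<in> BUC" "\<And>k. X k \<in> S" "e \<longlonglongrightarrow> 0" "\<And>k z. cmod (X k z - f z) \<le> e k"
proof -
  obtain X where f: "f \<in> BUC" and X: "\<And>k. X k \<in> S"
    and lim: "(\<lambda>k. norm_op BUC_cstar (add_op BUC_cstar (X k) (scale_op BUC_cstar (- 1) f))) \<longlonglongrightarrow> 0"
    using assms(1) by (auto simp: norm_closure_def)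
  have "cmod (X k z - f z) \<le> (SUP z. cmod (X k z - f z))" for k z
  proof (rule cSUP_upper2)
    have "(\<lambda>z. X k z + - 1 * f z) \<in> BUC"
      using X S by (intro BUC_add BUC_scale f) auto
    then show "bdd_above (range (\<lambda>z. cmod (X k z - f z)))"
      using BUC_bound by (fastforce intro: bdd_aboveI2)
  qed auto
  with f X lim show thesis
    by (intro that[of X "\<lambda>k. SUP z. cmod (X k z - f z)"]) (auto simp: BUC_ops)
qed

section \<open>Resolvent functions and Lagrangian subspaces\<close>

context fock_space
begin

definition gen :: "complex \<Rightarrow> complex ^ 'n \<Rightarrow> complex ^ 'n \<Rightarrow> complex" where
  "gen c z = (\<lambda>w. inverse (c - 2 * \<i> * of_real (sigma_t t w z)))"

lemma cnj_gen: "(\<lambda>w. cnj (gen c z w)) = gen (cnj c) (- z)"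
  by (simp add: gen_def sigma_t_def inner_t_simps)

text \<open>Reduces \<open>Re c < 0\<close> to \<open>Re c > 0\<close>, the case in which a Laplace
  integral represents the function.\<close>

lemma gen_minus: "gen (- c) (- z) w = - gen c z w"
proof -
  have "- c - 2 * \<i> * of_real (sigma_t t w (- z)) = - (c - 2 * \<i> * of_real (sigma_t t w z))"
    by (simp add: sigma_t_def inner_t_simps)
  then show ?thesis unfolding gen_def by (simp only: inverse_minus_eq)
qed

text \<open>The denominator is Lipschitz and stays at distance at least
  \<open>\<bar>Re c\<bar>\<close> from 0, so its inverse is bounded and Lipschitz.\<close>

lemma gen_BUC:
  assumes c: "Re c \<noteq> 0"
  shows "gen c z \<in> BUC"
proof -
  define a where "a w = c - 2 * \<i> * of_real (sigma_t t w z)" for w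
  have Re: "Re (a w) = Re c" for w by (simp add: a_def)
  have a: "\<bar>Re c\<bar> \<le> cmod (a w)" for w
    using abs_Re_le_cmod[of "a w"] by (simp add: Re)
  have a0: "a w \<noteq> 0" for w using Re[of w] c by auto
  have b: "cmod (inverse (a w)) \<le> 1 / \<bar>Re c\<bar>" for w
    using a[of w] c by (simp add: norm_inverse divide_inverse le_imp_inverse_le)
  have "cmod (a x - a y) \<le> 2 * K * norm z * norm (x - y)" for x y
  proof -
    have "a x - a y = - 2 * \<i> * of_real (Im (ip (x - y) z))"
      by (simp add: a_def sigma_t_def inner_t_simps algebra_simps)
    then have "cmod (a x - a y) = 2 * \<bar>Im (ip (x - y) z)\<bar>"
      by (simp add: norm_mult)
    also have "\<dots> \<le> 2 * (K * norm (x - y) * norm z)"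
      using order_trans[OF abs_Im_le_cmod inner_t_bound[of "x - y" z]] by simp
    finally show ?thesis by (simp add: mult_ac)
  qed
  then have diff: "dist (inverse (a x)) (inverse (a y)) \<le> (1 / \<bar>Re c\<bar> * (1 / \<bar>Re c\<bar>) * (2 * K * norm z)) * dist x y" for x y
  proof -
    have "inverse (a x) - inverse (a y) = inverse (a x) * inverse (a y) * (a y - a x)"
      using a0[of x] a0[of y] by (simp add: field_simps)
    then have "dist (inverse (a x)) (inverse (a y)) = cmod (inverse (a x)) * cmod (inverse (a y)) * cmod (a y - a x)"
      by (simp only: dist_norm norm_mult)
    also have "\<dots> \<le> (1 / \<bar>Re c\<bar> * (1 / \<bar>Re c\<bar>)) * (2 * K * norm z * norm (y - x))"
      by (intro mult_mono b) (use \<open>\<And>x y. cmod (a x - a y) \<le> 2 * K * norm z * norm (x - y)\<close> in auto)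
    finally show ?thesis by (simp add: dist_norm norm_minus_commute mult.assoc)
  qed
  have "uniformly_continuous_on UNIV (\<lambda>w. inverse (a w))"
    by (rule lipschitz_on_uniformly_continuous, rule lipschitz_onI, rule diff) (use K_nonneg in simp)
  with b show ?thesis
    by (auto simp: BUC_iff gen_def a_def[symmetric] bounded_iff)
qed

text \<open>The real vectors form an isotropic subspace, and remain so after multiplying the
  coordinates by complex numbers; these are chosen to bring \<open>z\<close> into the image.\<close>

lemma exists_lagrangian: "\<exists>V. lagrangian t V \<and> z \<in> V"
proof -
  \<comment> \<open>The value 1 at vanishing coordinates keeps the map injective and hence the
    dimension equal to \<open>CARD('n)\<close>.\<close>
  define b where "b j = (if z $ j = 0 then 1 else z $ j)" for j
  have b0: "b j \<noteq> 0" for j by (simp add: b_def)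
  define L :: "real ^ 'n \<Rightarrow> complex ^ 'n" where "L r = (\<chi> j. of_real (r $ j) * b j)" for r
  have lin: "linear L"
    by (rule linearI) (auto simp: L_def vec_eq_iff algebra_simps scaleR_conv_of_real[where 'a = complex])
  have inj: "inj L"
    by (rule injI) (use b0 in \<open>auto simp: L_def vec_eq_iff\<close>)
  have "subspace (range L)"
    using linear_subspace_image[OF lin subspace_UNIV] .
  moreover have "dim (range L) = CARD('n)"
    using dim_image_eq[OF lin, of UNIV] inj by (simp add: dim_UNIV)
  moreover have "sigma_t t (L r) (L s) = 0" for r s
  proof -
    have e: "of_real (r $ j) * b j * cnj (of_real (s $ j) * b j) / of_real (t $ j) = of_real (r $ j * s $ j * (cmod (b j))\<^sup>2 / t $ j)" for j
      using complex_norm_square[of "b j"] by (simp add: mult_ac)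
    have "inner_t t (L r) (L s) = of_real (\<Sum>j\<in>UNIV. r $ j * s $ j * (cmod (b j))\<^sup>2 / t $ j)"
      by (simp only: inner_t_def L_def vec_lambda_beta e of_real_sum)
    then show ?thesis by (simp add: sigma_t_def)
  qed
  moreover have "z = L (\<chi> j. if z $ j = 0 then 0 else 1)"
    by (simp add: L_def b_def vec_eq_iff)
  ultimately show ?thesis
    unfolding lagrangian_def by (intro exI[of _ "range L"]) auto
qed

end

section \<open>Toeplitz operators of the classical algebras\<close>

context fock_subalgebra
begin

lemma toeplitz_limit_mem:
  assumes X: "\<And>k. X k \<in> BUC" "\<And>k. toeplitz t (X k) \<in> B" and f: "f \<in> BUC"
    and e: "e \<longlonglongrightarrow> 0" and le: "\<And>k z. cmod (X k z - f z) \<le> e k"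
  shows "toeplitz t f \<in> B"
proof -
  obtain b where b: "\<And>z. cmod (f z) \<le> b" using BUC_bound[OF f] by blast
  obtain c where c: "\<And>k z. cmod (X k z) \<le> c k" using BUC_bound[OF X(1)] by metis
  show ?thesis
    using opnorm_toeplitz_diff[OF BUC_measurable[OF X(1)] c BUC_measurable[OF f] b le]
    by (intro B_closed[OF X(2) toeplitz_bounded_ops[OF BUC_measurable[OF f] b] _ _ e])
qed

lemma toeplitz_add_mem:
  assumes f: "f \<in> BUC" "toeplitz t f \<in> B" and g: "g \<in> BUC" "toeplitz t g \<in> B"
  shows "toeplitz t (\<lambda>z. f z + g z) \<in> B"
proof -
  obtain b where b: "\<And>z. cmod (f z) \<le> b" using BUC_bound[OF f(1)] by blast
  obtain c where c: "\<And>z. cmod (g z) \<le> c" using BUC_bound[OF g(1)] by blast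
  show ?thesis
    using toeplitz_add[OF BUC_measurable[OF f(1)] b BUC_measurable[OF g(1)] c] B_add[OF f(2) g(2)] by simp
qed

lemma toeplitz_scale_mem:
  assumes f: "f \<in> BUC" "toeplitz t f \<in> B"
  shows "toeplitz t (\<lambda>z. c * f z) \<in> B"
proof -
  obtain b where b: "\<And>z. cmod (f z) \<le> b" using BUC_bound[OF f(1)] by blast
  show ?thesis
    using toeplitz_scale[OF BUC_measurable[OF f(1)] b, of c] B_scale[OF f(2)] by simp
qed

text \<open>Only positive real parts are allowed, as in \<open>toeplitz_prod_mem\<close>; the empty
  word, which is the constant 1, is included.\<close>

definition words :: "(complex ^ 'n) set \<Rightarrow> (complex ^ 'n \<Rightarrow> complex) set" where
  "words V = {\<lambda>w. \<Prod>i<k. gen (c i) (z i) w | (k :: nat) c z. \<forall>i. z i \<in> V \<and> 0 < Re (c i)}"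

text \<open>Having the Toeplitz operators of \<open>f\<close> and \<open>g\<close> in
  \<open>B\<close> does not by itself place that of their product there. Quantifying over all words
  builds products with generators into the condition, which stays linear and closed in
  \<open>f\<close>.\<close>

definition word_stable :: "(complex ^ 'n) set \<Rightarrow> (complex ^ 'n \<Rightarrow> complex) set" where
  "word_stable V = {f \<in> BUC. \<forall>p\<in>words V. toeplitz t (\<lambda>w. f w * p w) \<in> B}"

lemma words_BUC: "p \<in> words V \<Longrightarrow> p \<in> BUC"
proof -
  assume "p \<in> words V"
  then obtain k :: nat and c z where p: "p = (\<lambda>w. \<Prod>i<k. gen (c i) (z i) w)" and c: "\<And>i. 0 < Re (c i)"
    by (auto simp: words_def)
  have "(\<lambda>w. \<Prod>i<m. gen (c i) (z i) w) \<in> BUC" for m :: nat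
  proof (induction m)
    case (Suc m)
    have "Re (c m) \<noteq> 0" using c[of m] by simp
    from BUC_mult[OF Suc gen_BUC[OF this, of "z m"]] show ?case by simp
  qed (simp add: BUC_const)
  then show ?thesis by (simp add: p)
qed

lemma words_mult_gen:
  assumes p: "p \<in> words V" and z: "z \<in> V" and c: "0 < Re c"
  shows "(\<lambda>w. gen c z w * p w) \<in> words V"
proof -
  obtain k :: nat and d y where p: "p = (\<lambda>w. \<Prod>i<k. gen (d i) (y i) w)" and d: "\<forall>i. y i \<in> V \<and> 0 < Re (d i)"
    using p by (auto simp: words_def)
  have "(\<lambda>w. gen c z w * p w) = (\<lambda>w. \<Prod>i<Suc k. gen ((d(k := c)) i) ((y(k := z)) i) w)"
    by (simp add: p fun_eq_iff mult.commute)
  then show ?thesis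
    unfolding words_def using d z c
    by (intro CollectI exI[of _ "Suc k"] exI[of _ "d(k := c)"] exI[of _ "y(k := z)"]) auto
qed

lemma word_stable_limit:
  assumes X: "\<And>k. X k \<in> word_stable V" and f: "f \<in> BUC"
    and e: "e \<longlonglongrightarrow> 0" and le: "\<And>k z. cmod (X k z - f z) \<le> e k"
  shows "f \<in> word_stable V"
  unfolding word_stable_def
proof (intro CollectI conjI ballI f)
  fix p assume p: "p \<in> words V"
  obtain b where b: "\<And>z. cmod (p z) \<le> b" using BUC_bound[OF words_BUC[OF p]] by blast
  show "toeplitz t (\<lambda>w. f w * p w) \<in> B"
  proof (rule toeplitz_limit_mem[where e = "\<lambda>k. e k * b"])
    show "(\<lambda>w. X k w * p w) \<in> BUC" "toeplitz t (\<lambda>w. X k w * p w) \<in> B" for k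
      using X[of k] p words_BUC[OF p] by (auto simp: word_stable_def BUC_mult)
    show "(\<lambda>w. f w * p w) \<in> BUC"
      by (rule BUC_mult[OF f words_BUC[OF p]])
    show "(\<lambda>k. e k * b) \<longlonglongrightarrow> 0"
      using tendsto_mult[OF e tendsto_const[of b]] by simp
    show "cmod (X k z * p z - f z * p z) \<le> e k * b" for k z
      unfolding left_diff_distrib[symmetric] norm_mult
      by (intro mult_mono le b order_trans[OF norm_ge_zero le]) auto
  qed
qed

lemma word_stable_add: "f \<in> word_stable V \<Longrightarrow> g \<in> word_stable V \<Longrightarrow> (\<lambda>w. f w + g w) \<in> word_stable V"
  unfolding word_stable_def
  by (auto simp: BUC_add distrib_right intro!: toeplitz_add_mem BUC_mult intro: words_BUC)

lemma word_stable_scale: "f \<in> word_stable V \<Longrightarrow> (\<lambda>w. c * f w) \<in> word_stable V"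
  unfolding word_stable_def
  by (auto simp: BUC_scale mult.assoc intro!: toeplitz_scale_mem BUC_mult intro: words_BUC)

text \<open>A generator with positive real part is absorbed into the word; the other sign follows
  from \<open>gen_minus\<close>, as \<open>V\<close> is closed under negation.\<close>

lemma word_stable_gen:
  assumes f: "f \<in> word_stable V" and z: "z \<in> V" and V: "subspace V" and c: "Re c \<noteq> 0"
  shows "(\<lambda>w. gen c z w * f w) \<in> word_stable V"
proof -
  have pos: "(\<lambda>w. gen c z w * f w) \<in> word_stable V" if "0 < Re c" "z \<in> V" for c z
    unfolding word_stable_def
  proof (intro CollectI conjI ballI)
    show "(\<lambda>w. gen c z w * f w) \<in> BUC"
      using f gen_BUC[of c z] that by (simp add: word_stable_def BUC_mult)
    fix p assume "p \<in> words V"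
    from words_mult_gen[OF this that(2,1)] have "toeplitz t (\<lambda>w. f w * (gen c z w * p w)) \<in> B"
      using f by (simp add: word_stable_def)
    then show "toeplitz t (\<lambda>w. gen c z w * f w * p w) \<in> B"
      by (simp only: mult_ac)
  qed
  show ?thesis
  proof (cases "0 < Re c")
    case True
    with pos z show ?thesis by blast
  next
    case False
    then have "(\<lambda>w. gen (- c) (- z) w * f w) \<in> word_stable V"
      using c z V by (intro pos) (auto simp: subspace_neg)
    from word_stable_scale[OF this, of "- 1"] show ?thesis
      by (simp add: gen_minus)
  qed
qed

text \<open>The multipliers of the closed linear space \<open>word_stable V\<close> form a C*-algebra containing the
  generators of \<open>R_cl_V t V\<close>, and \<open>word_stable V\<close> contains \<open>1\<close>.\<close>

lemma R_cl_V_mem: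
  assumes res: "\<And>l z. 0 < l \<Longrightarrow> rres l z \<in> B" and V: "lagrangian t V" and f: "f \<in> R_cl_V t V"
  shows "f \<in> BUC" "toeplitz t f \<in> B"
proof -
  let ?N = "word_stable V"
  \<comment> \<open>Requiring the condition for the conjugate as well makes \<open>N\<close> closed
    under the star; generators meet it because the conjugate of \<open>gen c z\<close> is
    \<open>gen (cnj c) (- z)\<close>.\<close>
  define N where "N = {f \<in> BUC. \<forall>h\<in>?N. (\<lambda>w. f w * h w) \<in> ?N \<and> (\<lambda>w. cnj (f w) * h w) \<in> ?N}"
  have sub: "subspace V" and iso: "\<And>z w. z \<in> V \<Longrightarrow> w \<in> V \<Longrightarrow> sigma_t t z w = 0"
    using V by (auto simp: lagrangian_def)
  have gens: "gen c z \<in> N" if "z \<in> V" "Re c \<noteq> 0" for c z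
    using that gen_BUC[OF that(2)] sub unfolding N_def
    by (auto simp: cnj_gen[THEN fun_cong] subspace_neg intro!: word_stable_gen)
  have "cstar_subalgebra BUC_cstar N"
    unfolding cstar_subalgebra_def BUC_ops
  proof (intro conjI ballI allI)
    show "N \<subseteq> BUC" by (auto simp: N_def)
    show "N \<noteq> {}" using gens[of 0 1] subspace_0[OF sub] by auto
    show "(\<lambda>z. f z + g z) \<in> N" if "f \<in> N" "g \<in> N" for f g
      using that by (auto simp: N_def BUC_add distrib_right intro!: word_stable_add)
    show "(\<lambda>z. c * f z) \<in> N" if "f \<in> N" for c f
      using that by (auto simp: N_def BUC_scale mult.assoc intro!: word_stable_scale)
    show "(\<lambda>z. f z * g z) \<in> N" if "f \<in> N" "g \<in> N" for f g
      using that by (auto simp: N_def BUC_mult mult.assoc)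
    show "(\<lambda>z. cnj (f z)) \<in> N" if "f \<in> N" for f
      using that by (auto simp: N_def BUC_cnj)
    show "norm_closure BUC_cstar N \<subseteq> N"
    proof
      fix f assume "f \<in> norm_closure BUC_cstar N"
      moreover have "N \<subseteq> BUC" by (auto simp: N_def)
      ultimately obtain X e where f: "f \<in> BUC" and X: "\<And>k. X k \<in> N"
        and e: "e \<longlonglongrightarrow> 0" and le: "\<And>k z. cmod (X k z - f z) \<le> e k"
        by (rule norm_closure_BUC_E) blast
      have "(\<lambda>w. f w * h w) \<in> ?N \<and> (\<lambda>w. cnj (f w) * h w) \<in> ?N" if h: "h \<in> ?N" for h
      proof -
        have hB: "h \<in> BUC" using h by (simp add: word_stable_def)
        obtain b where b: "\<And>z. cmod (h z) \<le> b" using BUC_bound[OF hB] by blast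
        have eb: "(\<lambda>k. e k * b) \<longlonglongrightarrow> 0"
          using tendsto_mult[OF e tendsto_const[of b]] by simp
        have "cmod (X k z * h z - f z * h z) \<le> e k * b" for k z
          unfolding left_diff_distrib[symmetric] norm_mult
          by (intro mult_mono le b order_trans[OF norm_ge_zero le]) auto
        moreover have "cmod (cnj (X k z) * h z - cnj (f z) * h z) \<le> e k * b" for k z
          unfolding left_diff_distrib[symmetric] norm_mult complex_cnj_diff[symmetric] complex_mod_cnj
          by (intro mult_mono le b order_trans[OF norm_ge_zero le]) auto
        ultimately show ?thesis
          using X h
          by (intro conjI word_stable_limit[OF _ BUC_mult[OF f hB] eb, of "\<lambda>k w. X k w * h w"]
             word_stable_limit[OF _ BUC_mult[OF BUC_cnj[OF f] hB] eb, of "\<lambda>k w. cnj (X k w) * h w"])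
            (auto simp: N_def)
      qed
      then show "f \<in> N" using f by (simp add: N_def)
    qed
  qed
  then have "R_cl_V t V \<subseteq> N"
    unfolding R_cl_V_def cstar_generated_def
    by (intro hull_minimal) (auto simp: gen_def[symmetric] gens)
  with f have fN: "f \<in> N" by blast
  then show "f \<in> BUC" by (simp add: N_def)
  \<comment> \<open>Isotropy enters through \<open>toeplitz_prod_mem\<close>, which puts the
    constant 1 into \<open>?N\<close>. Then \<open>f * 1\<close> lies in \<open>?N\<close>, and
    testing it on the empty word returns \<open>f\<close> itself.\<close>
  have word_mem: "toeplitz t p \<in> B" if "p \<in> words V" for p
    using that toeplitz_prod_mem[OF res] iso unfolding words_def gen_def by auto
  then have "(\<lambda>_. 1) \<in> ?N"
    by (simp add: word_stable_def BUC_const)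
  moreover have "\<forall>h\<in>?N. (\<lambda>w. f w * h w) \<in> ?N"
    using fN by (simp add: N_def)
  ultimately have "(\<lambda>w. f w * 1) \<in> ?N"
    by (rule bspec[rotated])
  moreover have "(\<lambda>_. 1) \<in> words V"
    unfolding words_def using subspace_0[OF sub]
    by (intro CollectI exI[of _ 0] exI[of _ "\<lambda>_. 1"] exI[of _ "\<lambda>_. 0"]) auto
  ultimately show "toeplitz t f \<in> B"
    by (auto simp: word_stable_def)
qed

lemma R_cl_0_closure_mem:
  assumes res: "\<And>l z. 0 < l \<Longrightarrow> rres l z \<in> B" and f: "f \<in> norm_closure BUC_cstar (R_cl_0 t)"
  shows "toeplitz t f \<in> B"
proof -
  have R0: "f \<in> BUC \<and> toeplitz t f \<in> B" if fR: "f \<in> R_cl_0 t" for f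
  proof -
    obtain \<V> g where f: "f = (\<lambda>w. \<Sum>V\<in>\<V>. g V w)" and fin: "finite \<V>"
      and g: "\<And>V. V \<in> \<V> \<Longrightarrow> lagrangian t V \<and> g V \<in> R_cl_V t V"
      using fR unfolding R_cl_0_def by blast
    \<comment> \<open>The sum over no subspaces is the zero symbol, whose operator is obtained as 0
      times that of a generator.\<close>
    have zero: "toeplitz t (\<lambda>_. 0) \<in> B"
    proof -
      obtain V where V: "lagrangian t V" using exists_lagrangian by blast
      then have "0 \<in> V" by (simp add: lagrangian_def subspace_0)
      then have "gen 1 0 \<in> R_cl_V t V"
        unfolding R_cl_V_def cstar_generated_def gen_def
        by (intro hull_inc CollectI exI[of _ 1] exI[of _ 0]) auto
      from toeplitz_scale_mem[OF R_cl_V_mem[OF res V this], of 0] show ?thesis by simp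
    qed
    have "(\<lambda>w. \<Sum>V\<in>\<V>. g V w) \<in> BUC \<and> toeplitz t (\<lambda>w. \<Sum>V\<in>\<V>. g V w) \<in> B"
      using fin g
    proof (induction \<V>)
      case (insert V \<V>)
      then have "g V \<in> BUC" "toeplitz t (g V) \<in> B"
        using R_cl_V_mem[OF res, of V "g V"] by auto
      then show ?case
        using insert by (simp add: BUC_add toeplitz_add_mem)
    qed (use zero in \<open>simp add: BUC_const\<close>)
    then show ?thesis by (simp add: f)
  qed
  have "R_cl_0 t \<subseteq> BUC" using R0 by blast
  from norm_closure_BUC_E[OF f this] obtain X e where fB: "f \<in> BUC" and X: "\<And>k. X k \<in> R_cl_0 t"
    and e: "e \<longlonglongrightarrow> 0" and le: "\<And>k z. cmod (X k z - f z) \<le> e k" by blast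
  show ?thesis
    by (rule toeplitz_limit_mem[OF R0[OF X, THEN conjunct1] R0[OF X, THEN conjunct2] fB e le])
qed

lemma res_mem_if_resolvents:
  assumes sub: "{toeplitz_resolvent t (\<i> * of_real r) (sym z) | r z. r \<noteq> 0} \<subseteq> B" and l: "0 < l"
  shows "rres l z \<in> B"
proof -
  \<comment> \<open>For \<open>r = l > 0\<close> the identification reverses the direction, so
    \<open>- z\<close> is the vector to take; what remains is the scalar \<open>- \<i>\<close>,
    removed by \<open>\<i>\<close>.\<close>
  have "toeplitz_resolvent t (\<i> * of_real l) (sym (- z)) \<in> B"
    by (rule subsetD[OF sub], intro CollectI exI[of _ l] exI[of _ "- z"]) (use l in simp)
  moreover have "toeplitz_resolvent t (\<i> * of_real l) (sym (- z)) = scale_op (Fock_cstar t) (- \<i>) (rres l z)"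
    using toeplitz_resolvent_eq[of l "- z"] l by simp
  ultimately have "scale_op (Fock_cstar t) \<i> (scale_op (Fock_cstar t) (- \<i>) (rres l z)) \<in> B"
    by (simp add: B_scale)
  moreover have "scale_op (Fock_cstar t) \<i> (scale_op (Fock_cstar t) (- \<i>) (rres l z)) = rres l z"
    by (simp add: res_def wop_scale[symmetric] mult.assoc[symmetric])
  ultimately show ?thesis by simp
qed

lemma res_mem_if_toeplitz:
  assumes sub: "toeplitz t ` norm_closure BUC_cstar (R_cl_0 t) \<subseteq> B" and l: "0 < l"
  shows "rres l z \<in> B"
proof (rule res_mem_if_toeplitz_mem[OF _ l])
  fix l :: real assume l: "0 < l"
  define f where "f = gen (of_real l) z"
  \<comment> \<open>Any single \<open>z\<close> lies in a Lagrangian subspace, so each generator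
    belongs to one of the summands of \<open>R_cl_0 t\<close>.\<close>
  obtain V where V: "lagrangian t V" "z \<in> V" using exists_lagrangian by blast
  have fB: "f \<in> BUC" unfolding f_def by (rule gen_BUC) (use l in simp)
  have "f \<in> R_cl_V t V"
    unfolding R_cl_V_def cstar_generated_def f_def gen_def
    by (intro hull_inc CollectI exI[of _ "of_real l"] exI[of _ z]) (use V l in auto)
  then have "f \<in> R_cl_0 t"
    unfolding R_cl_0_def using V
    by (intro CollectI exI[of _ "{V}"] exI[of _ "\<lambda>_. f"]) auto
  then have "f \<in> norm_closure BUC_cstar (R_cl_0 t)"
    unfolding norm_closure_def using fB
    by (intro CollectI conjI exI[of _ "\<lambda>_. f"]) (auto simp: BUC_ops)
  then show "toeplitz t (\<lambda>w. inverse (of_real l - 2 * \<i> * of_real (sigma_t t w z))) \<in> B"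
    using sub by (auto simp: f_def gen_def)
qed

end

theorem proposition4p26:
  fixes t :: "real ^ 'n"
  assumes "\<forall>j. t $ j > 0"
  shows "resolvent_algebra t = toeplitz_algebra t (norm_closure BUC_cstar (R_cl_0 t))"
proof -
  interpret fock_space t by standard (use assms in auto)
  let ?R = "{toeplitz_resolvent t (\<i> * of_real r) (sym z) | r z. r \<noteq> 0}"
  let ?T = "toeplitz t ` norm_closure BUC_cstar (R_cl_0 t)"
  \<comment> \<open>Equal families of subalgebras have equal intersections, so both inclusions are
    settled for each \<open>B\<close> separately.\<close>
  have "?R \<subseteq> B \<longleftrightarrow> ?T \<subseteq> B" if B: "cstar_subalgebra (Fock_cstar t) B" for B
  proof -
    interpret fock_subalgebra t B by standard (rule B)
    show ?thesis
    proof
      assume "?R \<subseteq> B"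
      then show "?T \<subseteq> B"
        using R_cl_0_closure_mem[OF res_mem_if_resolvents] by blast
    next
      assume T: "?T \<subseteq> B"
      show "?R \<subseteq> B"
        using toeplitz_resolvent_eq B_scale[OF res_mem_if_toeplitz[OF T]] by auto
    qed
  qed
  then show ?thesis
    unfolding resolvent_algebra_def toeplitz_algebra_def cstar_generated_def hull_def sym_def
    by (intro arg_cong[where f = Inter]) auto
qed

end
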